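(* Let $n\ge 1$ and let $A$ be one of the following right-symmetric algebras: $W_n^{rsym}$ (with $\mathrm{char}\,K=0$), $W_n^{+rsym}$ (with $\mathrm{char}\,K=0$), $W_n^{rsym}(\mathbf{m})$ (with $\mathrm{char}\,K=p>0$). (i) $A$ satisfies the right-symmetric standard identity of degree $2n+1$: $$\sum_{\sigma\in Sym_{2n}}\mathrm{sign}(\sigma)\,a_{\sigma(1)}\circ a_{\sigma(2)}\circ\cdots\circ a_{\sigma(2n)}\circ a_{2n+1}=0$$ for any $a_1,\ldots,a_{2n+1}\in A$. In particular, the polynomials $\tau_l s_{2n}^{rsym}$, $l=0,1,\ldots,2n$, are also identities of $A$. (ii) If $\mathrm{char}\,K=0$, then the algebra $A=W_n^{rsym}$ or $W_n^{+rsym}$ has no (nontrivial) left polynomial identity of degree less than $2n+1$. If $p>0$, then the algebra $W_n^{rsym}(\mathbf{m})$ has no (nontrivial) multilinear left polynomial identity of degree less than $2n+1$. (iii) Let $f$ be any left polynomial identity of $A$ of degree $2n+1$; in the case $A=W_n^{rsym}(\mathbf{m})$, $p>0$, suppose that $f$ is also multilinear. Then $f$ is a linear combination of $\tau_l s_{2n}^{rsym}$, $l=0,1,\ldots,2n$.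
   Context: $K$ is a field. An algebra $(A,\circ)$ over $K$ is right-symmetric if $a\circ(b\circ c)-(a\circ b)\circ c=a\circ(c\circ b)-(a\circ c)\circ b$ for all $a,b,c\in A$. Products without brackets are right-normed: $x_1\circ x_2\circ\cdots\circ x_k$ means $x_1\circ(x_2\circ(\cdots\circ(x_{k-1}\circ x_k)\cdots))$. Witt algebras. Let $U$ be a commutative associative algebra with commuting derivations $\partial_1,\ldots,\partial_n$, and consider the space of formal sums $\sum_{i=1}^n u_i\partial_i$ with $u_i\in U$ (a free $U$-module with basis $\partial_1,\ldots,\partial_n$) with the bilinear multiplication $u\partial_i\circ v\partial_j=v\,\partial_j(u)\,\partial_i$; this is a right-symmetric algebra. It is denoted - $W_n^{rsym}$ if $\mathrm{char}\,K=0$, $U=K[x_1^{\pm1},\ldots,x_n^{\pm1}]$ (Laurent polynomials), $\partial_i=\partial/\partial x_i$; - $W_n^{+rsym}$ if $\mathrm{char}\,K=0$, $U=K[x_1,\ldots,x_n]$, $\partial_i=\partial/\partial x_i$; - $W_n^{rsym}(\mathbf{m})$ (also written $W_n(\mathbf{m})$) if $\mathrm{char}\,K=p>0$, $\mathbf{m}=(m_1,\ldots,m_n)$ with integers $m_i>0$, and $U=O_n(\mathbf{m})$ is the divided power algebra with basis $x^{(\alpha)}$, $\alpha=(\alpha_1,\ldots,\alpha_n)$, $0\le\alpha_i<p^{m_i}$, multiplication $x^{(\alpha)}x^{(\beta)}=\prod_i\binom{\alpha_i+\beta_i}{\alpha_i}x^{(\alpha+\beta)}$ (zero if $\alpha_i+\beta_i\ge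 p^{m_i}$ for some $i$), and $\partial_i(x^{(\alpha)})=x^{(\alpha-\epsilon_i)}$ (zero if $\alpha_i=0$), where $\epsilon_i$ is the $i$-th unit vector. Left polynomials. A left monomial in variables $t_j$ is $\lambda\, t_{i_1}\circ t_{i_2}\circ\cdots\circ t_{i_k}$ (right-normed), $\lambda\in K$; it is nontrivial if $\lambda\ne0$, and its degree is then $k$. A left polynomial is a (finite) sum of left monomials; it is nontrivial if, after collecting equal words, some coefficient is nonzero, and its degree is the maximal degree of its nontrivial monomials. (Left polynomials are elements of the free right-symmetric algebra on the variables.) A left polynomial of degree $d$ is multilinear if it is in $d$ variables and each of its monomials contains each of these variables exactly once. A left polynomial identity of $A$ is a left polynomial $f$ that vanishes under every substitution of elements of $A$ for its variables. Standard polynomials. In the variables $t_0,t_1,\ldots,t_{2n}$ put $$s_{2n}^{rsym}(t_0,t_1,\ldots,t_{2n})=\sum_{\sigma\in Sym_{2n}}\mathrm{sign}(\sigma)\,t_{\sigma(1)}\circ\cdots\circ t_{\sigma(2n)}\circ t_0 ,$$ and for $l=0,1,\ldots,2n$ let $\tau_l s_{2n}^{rsym}$ be the polynomial obtained by the cyclic rearrangement of arguments putting $t_l$ in the distinguished (last factor) place: $$(\tau_l s_{2n}^{rsym})(t_0,\ldots,t_{2n})=s_{2n}^{rsym}(t_l,t_0,t_1,\ldots,t_{l-1},t_{l+1},\ldots,t_{2n}).$$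
   Formalization: In (iii), for f not multilinear (char 0), "linear combination of τ_l s" means of the τ_l s with arguments any variables of f, possibly repeated; in fixed distinct variables it fails for s(t_1,t_1,t_2,…,t_{2n}). For multilinear f, the arguments are the 2n+1 variables of f. *)

theory Defs
  imports
    "HOL-Analysis.Finite_Cartesian_Product"
    "HOL-Library.Poly_Mapping"
    "HOL-Combinatorics.Permutations"
begin

text \<open>
  The dimension \<open>n\<close> is \<open>CARD('n)\<close> for a finite index type \<open>'n\<close>; in particular \<open>n \<ge> 1\<close>.
  Laurent polynomials are the monoid algebra of \<open>\<int>\<^sup>n\<close>, polynomials the monoid algebra of
  \<open>\<nat>\<^sup>n\<close>, both with the convolution product of \<open>Poly_Mapping\<close>.
\<close>

type_synonym ('k, 'n) laurent = "(int ^ 'n) \<Rightarrow>\<^sub>0 'k"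
type_synonym ('k, 'n) mpoly = "(nat ^ 'n) \<Rightarrow>\<^sub>0 'k"

definition pm_scale :: "'k::field \<Rightarrow> ('e \<Rightarrow>\<^sub>0 'k) \<Rightarrow> ('e \<Rightarrow>\<^sub>0 'k)"
  where "pm_scale c f = Poly_Mapping.map ((*) c) f"

lemma lookup_pm_scale: "Poly_Mapping.lookup (pm_scale c f) w = c * Poly_Mapping.lookup f w"
  by (auto simp: pm_scale_def Poly_Mapping.map.rep_eq when_def)

interpretation pm: vector_space "pm_scale :: 'k::field \<Rightarrow> ('e \<Rightarrow>\<^sub>0 'k) \<Rightarrow> ('e \<Rightarrow>\<^sub>0 'k)"
  by unfold_locales
    (auto intro!: poly_mapping_eqI simp: lookup_pm_scale lookup_add algebra_simps)

definition laurent_deriv :: "'n::finite \<Rightarrow> ('k::field, 'n) laurent \<Rightarrow> ('k, 'n) laurent"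
  where "laurent_deriv i f =
    (\<Sum>\<alpha>\<in>Poly_Mapping.keys f.
       Poly_Mapping.single (\<alpha> - axis i 1) (of_int (\<alpha> $ i) * Poly_Mapping.lookup f \<alpha>))"

text \<open>The subtraction below truncates only where the coefficient vanishes.\<close>

definition mpoly_deriv :: "'n::finite \<Rightarrow> ('k::field, 'n) mpoly \<Rightarrow> ('k, 'n) mpoly"
  where "mpoly_deriv i f =
    (\<Sum>\<alpha>\<in>Poly_Mapping.keys f.
       Poly_Mapping.single (\<alpha> - axis i 1) (of_nat (\<alpha> $ i) * Poly_Mapping.lookup f \<alpha>))"

text \<open>
  The divided power algebra \<open>O\<^sub>n(m)\<close> over a field of characteristic \<open>p = CHAR('k)\<close>. Since \<open>m\<close> is a
  value, it is a carrier set in the type of finitely supported functions \<open>\<nat>\<^sup>n \<Rightarrow>\<^sub>0 'k\<close>, where the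
  basis vector \<open>x\<^sup>(\<^sup>\<alpha>\<^sup>)\<close> is \<open>single \<alpha> 1\<close>, with its own multiplication in place of the convolution.
\<close>

definition dp_carrier :: "('n::finite \<Rightarrow> nat) \<Rightarrow> ('k::field, 'n) mpoly set"
  where "dp_carrier m = {f. \<forall>\<alpha>\<in>Poly_Mapping.keys f. \<forall>i. \<alpha> $ i < CHAR('k) ^ m i}"

definition dp_mult ::
    "('n::finite \<Rightarrow> nat) \<Rightarrow> ('k::field, 'n) mpoly \<Rightarrow> ('k, 'n) mpoly \<Rightarrow> ('k, 'n) mpoly"
  where "dp_mult m f g =
    (\<Sum>\<alpha>\<in>Poly_Mapping.keys f. \<Sum>\<beta>\<in>Poly_Mapping.keys g.
       if \<forall>i. \<alpha> $ i + \<beta> $ i < CHAR('k) ^ m i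
       then Poly_Mapping.single (\<alpha> + \<beta>)
              (of_nat (\<Prod>i\<in>UNIV. (\<alpha> $ i + \<beta> $ i) choose (\<alpha> $ i))
                * Poly_Mapping.lookup f \<alpha> * Poly_Mapping.lookup g \<beta>)
       else 0)"

definition dp_deriv :: "'n::finite \<Rightarrow> ('k::field, 'n) mpoly \<Rightarrow> ('k, 'n) mpoly"
  where "dp_deriv i f =
    (\<Sum>\<alpha>\<in>Poly_Mapping.keys f.
       if \<alpha> $ i = 0 then 0
       else Poly_Mapping.single (\<alpha> - axis i 1) (Poly_Mapping.lookup f \<alpha>))"

text \<open>Nonassociative algebras over \<open>'k\<close>; the addition is that of the type \<open>'a\<close>.\<close>

record ('k, 'a) nalg =
  space :: "'a set"
  prod :: "'a \<Rightarrow> 'a \<Rightarrow> 'a"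
  scal :: "'k \<Rightarrow> 'a \<Rightarrow> 'a"
hide_const (open) space prod scal

text \<open>
  The formal sum \<open>\<Sum>\<^sub>i u\<^sub>i \<partial>\<^sub>i\<close> is the vector \<open>u\<close>. Extending \<open>u \<partial>\<^sub>i \<circ> v \<partial>\<^sub>j = v \<partial>\<^sub>j(u) \<partial>\<^sub>i\<close> biadditively, the
  coefficient of \<open>\<partial>\<^sub>i\<close> in \<open>a \<circ> b\<close> is \<open>\<Sum>\<^sub>j b\<^sub>j \<partial>\<^sub>j(a\<^sub>i)\<close>.
\<close>

definition witt ::
    "'u set \<Rightarrow> ('u \<Rightarrow> 'u \<Rightarrow> 'u) \<Rightarrow> ('k \<Rightarrow> 'u \<Rightarrow> 'u) \<Rightarrow> ('n \<Rightarrow> 'u \<Rightarrow> 'u)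
      \<Rightarrow> ('k, ('u::comm_monoid_add) ^ ('n::finite)) nalg"
  where "witt U mul sc D =
    \<lparr> nalg.space = {a. \<forall>i. a $ i \<in> U},
      nalg.prod = (\<lambda>a b. \<chi> i. \<Sum>j\<in>UNIV. mul (b $ j) (D j (a $ i))),
      nalg.scal = (\<lambda>c a. \<chi> i. sc c (a $ i)) \<rparr>"

definition W_rsym :: "('k::field, ('k, 'n::finite) laurent ^ 'n) nalg"
  where "W_rsym = witt UNIV (*) pm_scale laurent_deriv"

definition W_plus_rsym :: "('k::field, ('k, 'n::finite) mpoly ^ 'n) nalg"
  where "W_plus_rsym = witt UNIV (*) pm_scale mpoly_deriv"

definition W_rsym_dp :: "('n::finite \<Rightarrow> nat) \<Rightarrow> ('k::field, ('k, 'n) mpoly ^ 'n) nalg"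
  where "W_rsym_dp m = witt (dp_carrier m) (dp_mult m) pm_scale dp_deriv"

fun rn_prod :: "('a \<Rightarrow> 'a \<Rightarrow> 'a) \<Rightarrow> 'a list \<Rightarrow> 'a" where
  "rn_prod mul [] = undefined"
| "rn_prod mul [a] = a"
| "rn_prod mul (a # b # as) = mul a (rn_prod mul (b # as))"

text \<open>
  The word \<open>[i, j, \<dots>, k]\<close> stands for the right-normed monomial \<open>t\<^sub>i \<circ> (t\<^sub>j \<circ> (\<dots> \<circ> t\<^sub>k))\<close>, where \<open>t\<^sub>0, t\<^sub>1, \<dots>\<close>
  is a countable supply of variables. A left polynomial, with equal words collected, is a finitely
  supported function on nonempty words; it is nontrivial iff it is nonzero.
\<close>

type_synonym 'k lpoly = "nat list \<Rightarrow>\<^sub>0 'k"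

definition left_poly :: "('k::field) lpoly \<Rightarrow> bool"
  where "left_poly f \<longleftrightarrow> [] \<notin> Poly_Mapping.keys f"

text \<open>The degree of the trivial polynomial is set to \<open>0\<close>.\<close>

definition ldegree :: "('k::field) lpoly \<Rightarrow> nat"
  where "ldegree f = Max (insert 0 (length ` Poly_Mapping.keys f))"

definition lvars :: "('k::field) lpoly \<Rightarrow> nat set"
  where "lvars f = (\<Union>w\<in>Poly_Mapping.keys f. set w)"

definition multilinear :: "('k::field) lpoly \<Rightarrow> bool"
  where "multilinear f \<longleftrightarrow>
    (\<exists>V. finite V \<and> card V = ldegree f \<and>
         (\<forall>w\<in>Poly_Mapping.keys f. distinct w \<and> set w = V))"

definition leval :: "('k::field, 'a::comm_monoid_add) nalg \<Rightarrow> (nat \<Rightarrow> 'a) \<Rightarrow> 'k lpoly \<Rightarrow> 'a"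
  where "leval A a f =
    (\<Sum>w\<in>Poly_Mapping.keys f.
       nalg.scal A (Poly_Mapping.lookup f w) (rn_prod (nalg.prod A) (map a w)))"

definition left_identity :: "('k::field, 'a::comm_monoid_add) nalg \<Rightarrow> 'k lpoly \<Rightarrow> bool"
  where "left_identity A f \<longleftrightarrow>
    left_poly f \<and> (\<forall>a. (\<forall>i. a i \<in> nalg.space A) \<longrightarrow> leval A a f = 0)"

text \<open>
  \<open>std_poly n v\<close> is \<open>s\<^sub>2\<^sub>n(t_{v 0}, \<dots>, t_{v (2n)})\<close>, and \<open>tau_std n l v\<close> is \<open>\<tau>\<^sub>l s\<^sub>2\<^sub>n\<close> in the same
  arguments; \<open>v = id\<close> gives the polynomials in \<open>t\<^sub>0, \<dots>, t\<^sub>2\<^sub>n\<close> themselves.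
\<close>

definition std_poly :: "nat \<Rightarrow> (nat \<Rightarrow> nat) \<Rightarrow> ('k::field) lpoly"
  where "std_poly n v =
    (\<Sum>\<sigma> | \<sigma> permutes {1..2 * n}.
       Poly_Mapping.single (map (\<lambda>i. v (\<sigma> i)) [1..<2 * n + 1] @ [v 0]) (of_int (sign \<sigma>)))"

definition tau_std :: "nat \<Rightarrow> nat \<Rightarrow> (nat \<Rightarrow> nat) \<Rightarrow> ('k::field) lpoly"
  where "tau_std n l v =
    std_poly n (\<lambda>i. if i = 0 then v l else if i \<le> l then v (i - 1) else v i)"

definition satisfies_standard :: "('k::field, 'a::comm_monoid_add) nalg \<Rightarrow> nat \<Rightarrow> bool"
  where "satisfies_standard A n \<longleftrightarrow>
    (\<forall>a. (\<forall>i\<in>{1..2 * n + 1}. a i \<in> nalg.space A) \<longrightarrow>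
      (\<Sum>\<sigma> | \<sigma> permutes {1..2 * n}.
         nalg.scal A (of_int (sign \<sigma>))
           (rn_prod (nalg.prod A) (map (\<lambda>i. a (\<sigma> i)) [1..<2 * n + 1] @ [a (2 * n + 1)]))) = 0)"

text \<open>
  A multilinear \<open>f\<close> in \<open>2n + 1\<close> variables, listed in any order as \<open>t_{v 0}, \<dots>, t_{v (2n)}\<close>, is a linear
  combination of the \<open>\<tau>\<^sub>l s\<^sub>2\<^sub>n\<close> in exactly these variables.
\<close>

definition std_combination :: "nat \<Rightarrow> ('k::field) lpoly \<Rightarrow> bool"
  where "std_combination n f \<longleftrightarrow>
    (\<forall>v. bij_betw v {..2 * n} (lvars f) \<longrightarrow>
      (\<exists>c. f = (\<Sum>l\<le>2 * n. pm_scale (c l) (tau_std n l v))))"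

text \<open>
  For \<open>f\<close> that is not multilinear the variables of \<open>f\<close> may be repeated among the arguments of
  \<open>\<tau>\<^sub>l s\<^sub>2\<^sub>n\<close>, and different terms may have different arguments: \<open>s\<^sub>2\<^sub>n(t\<^sub>1, t\<^sub>1, t\<^sub>2, \<dots>, t\<^sub>2\<^sub>n)\<close> is a nontrivial
  identity of degree \<open>2n + 1\<close>.
\<close>

definition std_span :: "nat \<Rightarrow> ('k::field) lpoly \<Rightarrow> ('k lpoly) set"
  where "std_span n f = pm.span {tau_std n l v | l v. l \<le> 2 * n \<and> v ` {..2 * n} \<subseteq> lvars f}"

end

theory Submission
  imports
    Defs
    "HOL-Analysis.Cartesian_Space"
    "HOL-Combinatorics.Cycles"
    "HOL-Combinatorics.Multiset_Permutations"
    "HOL-Computational_Algebra.Primes"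
begin

text \<open>
  The product \<open>a \<circ> b\<close> of two vector fields is the Jacobian matrix of \<open>a\<close> applied to the vector \<open>b\<close>
  (\<open>embed_prod\<close>). A right-normed word \<open>a\<^sub>1 \<circ> \<dots> \<circ> a\<^sub>k\<close> is therefore a product of \<open>k - 1\<close> matrices over
  the commutative algebra \<open>U\<close> applied to a vector, and left identities of Witt algebras correspond to
  identities of \<open>n \<times> n\<close> matrices of degree one less. The standard identity of degree \<open>2n + 1\<close> is the
  Amitsur--Levitzki theorem \<open>s\<^sub>2\<^sub>n = 0\<close>; minimality and uniqueness are those of \<open>s\<^sub>2\<^sub>n\<close> among the matrix
  identities.

  The Amitsur--Levitzki theorem (\<open>amitsur_levitzki\<close>) is proved first for integer matrices, following
  Razmyslov. The multilinear Cayley--Hamilton identity for \<open>n\<close> matrices is a signed sum, over the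
  permutations of \<open>n + 1\<close> points, of products of traces; it vanishes because it antisymmetrizes over
  \<open>n + 1\<close> vertices chosen among \<open>n\<close> (\<open>sum_cyclic_sum_eq_0\<close>). Products \<open>A\<^bsub>2k-1\<^esub>A\<^bsub>2k\<^esub>\<close> are substituted for
  its arguments and the result is antisymmetrized. Then each trace is that of a standard polynomial of
  even degree and vanishes (\<open>cyclic_sum_eq_0\<close>), and the terms without a trace all agree
  (\<open>full_cycle_conjugate\<close>), so that a positive multiple of \<open>s\<^sub>2\<^sub>n\<close> is \<open>0\<close>. Expansion into matrix units
  carries the identity over to every commutative ring.

  For the converse, one variable is replaced by a constant field \<open>\<partial>\<^sub>b\<close>, whose Jacobian matrix is \<open>0\<close>, and the
  others by linear fields \<open>x\<^sub>t \<partial>\<^sub>s\<close>, whose Jacobian matrices are the matrix units. What survives of a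
  multilinear identity is the sum of the coefficients of those words whose edges form a walk
  (\<open>sum_over_walks_eq_0\<close>). Up to degree \<open>2n\<close> the edges can be chosen so that a single word remains,
  which kills its coefficient. In degree \<open>2n + 1\<close>, two choices that leave two words each show that the
  coefficients are alternating in all letters but the last
  (\<open>coefficient_swap_first\<close>, \<open>coefficient_rotate\<close>, \<open>alternating_permute\<close>), and this is the span of the
  \<open>\<tau>\<^sub>l s\<^sub>2\<^sub>n\<close>. Identities that are not multilinear are reduced to multilinear ones by polarization
  (\<open>left_identity_linearize\<close>).

  The three families enter only through the locale \<open>witt_embedding\<close>. For divided powers the coefficient
  algebra is embedded into the ring of divided power series without bounds on the exponents, where the
  products that the truncation suppresses vanish by themselves, their binomial coefficients being
  divisible by \<open>p\<close>.
\<close>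

section \<open>Sums over vertex labellings of a permutation\<close>

text \<open>
  Composing with a transposition that \<open>F\<close> does not see is a sign-reversing bijection of the index
  set. This generalizes the vanishing of a determinant with two equal columns.
\<close>

lemma sum_sign_eq_0_if_transpose_invariant:
  fixes F :: "(nat \<Rightarrow> nat) \<Rightarrow> int"
  assumes "finite E" "x \<in> E" "y \<in> E" "x \<noteq> y"
    and inv: "\<And>\<pi>. \<pi> permutes E \<Longrightarrow> F (Transposition.transpose x y \<circ> \<pi>) = F \<pi>"
  shows "(\<Sum>\<pi> | \<pi> permutes E. sign \<pi> * F \<pi>) = 0"
proof -
  let ?t = "Transposition.transpose x y"
  have t: "?t permutes E" using assms by (simp add: permutes_swap_id)
  have tt: "?t \<circ> (?t \<circ> \<pi>) = \<pi>" for \<pi> :: "nat \<Rightarrow> nat" by (simp add: fun_eq_iff)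
  have "(\<Sum>\<pi> | \<pi> permutes E. sign \<pi> * F \<pi>) = (\<Sum>\<pi> | \<pi> permutes E. sign (?t \<circ> \<pi>) * F (?t \<circ> \<pi>))"
    by (rule sum.reindex_bij_witness[of _ "\<lambda>\<pi>. ?t \<circ> \<pi>" "\<lambda>\<pi>. ?t \<circ> \<pi>"])
      (auto simp: tt intro: permutes_compose[OF _ t])
  also have "\<dots> = (\<Sum>\<pi> | \<pi> permutes E. - (sign \<pi> * F \<pi>))"
  proof (rule sum.cong[OF refl])
    fix \<pi> assume "\<pi> \<in> {\<pi>. \<pi> permutes E}"
    then have "sign (?t \<circ> \<pi>) = - sign \<pi>"
      using assms(1,4) by (subst sign_compose)
        (auto simp: sign_swap_id permutation_swap_id intro: permutes_imp_permutation)
    then show "sign (?t \<circ> \<pi>) * F (?t \<circ> \<pi>) = - (sign \<pi> * F \<pi>)"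
      using inv[of \<pi>] \<open>\<pi> \<in> _\<close> by simp
  qed
  finally show ?thesis by (simp add: sum_negf)
qed

text \<open>
  Positions are \<open>1, \<dots>, 2n + 1\<close>. At each position \<open>p\<close> an edge leaves the vertex \<open>q p\<close> for the vertex
  \<open>q (\<rho> p)\<close>, and it is weighted by a matrix entry. Summing over all labellings \<open>q\<close> turns every cycle of
  \<open>\<rho>\<close> into the trace of the product of the matrices along it, so \<open>cyclic_sum n A \<rho>\<close> is an
  antisymmetrized product of traces whose shape is the cycle type of \<open>\<rho>\<close>. The matrix at position
  \<open>2n + 1\<close> stays fixed under the antisymmetrization; taking a matrix unit for it extracts one entry
  from the cycle through \<open>2n + 1\<close>.
\<close>

definition cyclic_sum :: "nat \<Rightarrow> (nat \<Rightarrow> 'v::finite \<Rightarrow> 'v \<Rightarrow> int) \<Rightarrow> (nat \<Rightarrow> nat) \<Rightarrow> int"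
  where "cyclic_sum n A \<rho> =
    (\<Sum>\<sigma> | \<sigma> permutes {1..2 * n}. \<Sum>q\<in>PiE {1..2 * n + 1} (\<lambda>_. UNIV).
       sign \<sigma> * (\<Prod>p\<in>{1..2 * n + 1}. A (\<sigma> p) (q p) (q (\<rho> p))))"

text \<open>
  Conjugating \<open>\<rho>\<close> only renames positions. Undoing the renaming in \<open>q\<close> costs nothing, undoing it in \<open>\<sigma>\<close>
  costs the sign of \<open>\<tau>\<close>.
\<close>

lemma cyclic_sum_conjugate:
  assumes \<tau>: "\<tau> permutes {1..2 * n}"
  shows "cyclic_sum n A (\<tau> \<circ> \<rho> \<circ> inv \<tau>) = sign \<tau> * cyclic_sum n A \<rho>"
proof -
  let ?P = "{1..2 * n + 1}"
  have \<tau>P: "\<tau> permutes ?P" using \<tau> by (rule permutes_subset) auto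
  have i\<tau>P: "inv \<tau> permutes ?P" using \<tau>P by (rule permutes_inv)
  have i\<tau>: "inv \<tau> permutes {1..2*n}" using \<tau> by (rule permutes_inv)
  note [simp] = permutes_inverses[OF \<tau>]
  have prm: "permutation \<tau>" using \<tau> by (rule permutes_imp_permutation[rotated]) simp
  have sg: "sign (\<sigma> \<circ> \<tau>) = sign \<sigma> * sign \<tau>" if "\<sigma> permutes {1..2 * n}" for \<sigma>
    using that prm by (intro sign_compose) (auto intro: permutes_imp_permutation)
  have "cyclic_sum n A (\<tau> \<circ> \<rho> \<circ> inv \<tau>) =
    (\<Sum>\<sigma> | \<sigma> permutes {1..2 * n}. \<Sum>q\<in>PiE ?P (\<lambda>_. UNIV).
       sign \<sigma> * (\<Prod>p\<in>?P. A (\<sigma> (\<tau> p)) (q (\<tau> p)) (q (\<tau> (\<rho> p)))))"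
    unfolding cyclic_sum_def
    by (intro sum.cong refl arg_cong2[where f="(*)"], subst prod.permute[OF \<tau>P])
      (simp add: o_def)
  also have "\<dots> = (\<Sum>\<sigma> | \<sigma> permutes {1..2 * n}. \<Sum>q\<in>PiE ?P (\<lambda>_. UNIV).
       sign \<sigma> * (\<Prod>p\<in>?P. A ((\<sigma> \<circ> \<tau>) p) (q p) (q (\<rho> p))))"
  proof (rule sum.cong[OF refl])
    fix \<sigma>
    show "(\<Sum>q\<in>PiE ?P (\<lambda>_. UNIV). sign \<sigma> * (\<Prod>p\<in>?P. A (\<sigma> (\<tau> p)) (q (\<tau> p)) (q (\<tau> (\<rho> p)))))
      = (\<Sum>q\<in>PiE ?P (\<lambda>_. UNIV). sign \<sigma> * (\<Prod>p\<in>?P. A ((\<sigma> \<circ> \<tau>) p) (q p) (q (\<rho> p))))"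
      by (rule sum.reindex_bij_witness[of _ "\<lambda>q. q \<circ> inv \<tau>" "\<lambda>q. q \<circ> \<tau>"])
        (auto simp: fun_eq_iff PiE_iff extensional_def permutes_not_in[OF \<tau>P] permutes_not_in[OF i\<tau>P])
  qed
  also have "\<dots> = (\<Sum>\<sigma> | \<sigma> permutes {1..2 * n}. \<Sum>q\<in>PiE ?P (\<lambda>_. UNIV).
       sign \<tau> * (sign \<sigma> * (\<Prod>p\<in>?P. A (\<sigma> p) (q p) (q (\<rho> p)))))"
  proof (rule sum.reindex_bij_witness[of _ "\<lambda>\<sigma>. \<sigma> \<circ> inv \<tau>" "\<lambda>\<sigma>. \<sigma> \<circ> \<tau>"])
    fix \<sigma> assume "\<sigma> \<in> {\<sigma>. \<sigma> permutes {1..2 * n}}"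
    then have \<sigma>: "\<sigma> permutes {1..2 * n}" by simp
    show "\<sigma> \<circ> \<tau> \<in> {\<sigma>. \<sigma> permutes {1..2 * n}}" "\<sigma> \<circ> inv \<tau> \<in> {\<sigma>. \<sigma> permutes {1..2 * n}}"
      using permutes_compose[OF \<tau> \<sigma>] permutes_compose[OF i\<tau> \<sigma>] by auto
    show "(\<Sum>q\<in>PiE ?P (\<lambda>_. UNIV). sign \<tau> * (sign (\<sigma> \<circ> \<tau>) * (\<Prod>p\<in>?P. A ((\<sigma> \<circ> \<tau>) p) (q p) (q (\<rho> p)))))
      = (\<Sum>q\<in>PiE ?P (\<lambda>_. UNIV). sign \<sigma> * (\<Prod>p\<in>?P. A ((\<sigma> \<circ> \<tau>) p) (q p) (q (\<rho> p))))"
      unfolding sg[OF \<sigma>] by (intro sum.cong refl) (simp add: ac_simps)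
  qed (auto simp: fun_eq_iff)
  also have "\<dots> = sign \<tau> * cyclic_sum n A \<rho>"
    by (simp add: cyclic_sum_def sum_distrib_left)
  finally show ?thesis .
qed

text \<open>
  The involution that exchanges \<open>2k - 1\<close> and \<open>2k\<close>. It pairs the \<open>2n\<close> matrices into \<open>n\<close> products of two,
  which is what lowers the number of factors to one where the determinant argument below applies.
\<close>

definition mate :: "nat \<Rightarrow> nat \<Rightarrow> nat"
  where "mate n p = (if p \<in> {1..2 * n} then if odd p then p + 1 else p - 1 else p)"

lemma mate_in_iff: "mate n p \<in> {1..2 * n} \<longleftrightarrow> p \<in> {1..2 * n}"
  unfolding mate_def atLeastAtMost_iff by presburger

lemma odd_mate_iff: "p \<in> {1..2 * n} \<Longrightarrow> odd (mate n p) \<longleftrightarrow> even p"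
  by (auto simp: mate_def)

lemma mate_mate [simp]: "mate n (mate n p) = p"
proof (cases "p \<in> {1..2 * n}")
  case True
  then show ?thesis
    using mate_in_iff[of n p] odd_mate_iff[OF True] by (auto simp: mate_def)
qed (auto simp: mate_def)

lemma mate_permutes: "mate n permutes {1..2 * n}"
proof (rule bij_imp_permutes)
  show "bij_betw (mate n) {1..2 * n} {1..2 * n}"
    by (rule bij_betw_byWitness[where f'="mate n"]) (auto simp only: mate_mate mate_in_iff)
qed (auto simp: mate_def)

abbreviation odds :: "nat \<Rightarrow> nat set"
  where "odds n \<equiv> {p\<in>{1..2 * n + 1}. odd p}"

lemma card_odds: "card (odds n) = n + 1"
proof -
  have "odds n = (\<lambda>k. 2 * k + 1) ` {..n}" by (auto elim!: oddE)
  then show ?thesis by (simp add: card_image inj_on_def)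
qed

lemma sum_distrib_swap:
  fixes s :: "'b \<Rightarrow> 'c \<Rightarrow> 'r::comm_ring"
  shows "(\<Sum>a\<in>A. \<Sum>b\<in>B. \<Sum>c\<in>C. s b c * g a b c) = (\<Sum>b\<in>B. \<Sum>c\<in>C. s b c * (\<Sum>a\<in>A. g a b c))"
proof -
  have "(\<Sum>a\<in>A. \<Sum>b\<in>B. \<Sum>c\<in>C. s b c * g a b c) = (\<Sum>b\<in>B. \<Sum>a\<in>A. \<Sum>c\<in>C. s b c * g a b c)"
    by (rule sum.swap)
  also have "\<dots> = (\<Sum>b\<in>B. \<Sum>c\<in>C. \<Sum>a\<in>A. s b c * g a b c)"
    by (rule sum.cong[OF refl]) (rule sum.swap)
  finally show ?thesis by (simp add: sum_distrib_left)
qed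

text \<open>
  The multilinear form of the Cayley--Hamilton theorem. There are \<open>n + 1\<close> odd positions and only \<open>n\<close>
  vertices, so two odd positions carry the same vertex in every labelling; the successors of all
  positions pass through \<open>\<pi>\<close> on the odd positions, hence the signed sum over \<open>\<pi>\<close> cancels labelling by
  labelling.
\<close>

lemma sum_cyclic_sum_eq_0:
  fixes A :: "nat \<Rightarrow> 'v::finite \<Rightarrow> 'v \<Rightarrow> int"
  assumes n: "n = CARD('v)"
  shows "(\<Sum>\<pi> | \<pi> permutes odds n. sign \<pi> * cyclic_sum n A (\<pi> \<circ> mate n)) = 0"
proof -
  have "(\<Sum>\<pi> | \<pi> permutes odds n. sign \<pi> * cyclic_sum n A (\<pi> \<circ> mate n)) =
    (\<Sum>\<pi> | \<pi> permutes odds n. \<Sum>\<sigma> | \<sigma> permutes {1..2 * n}. \<Sum>q\<in>PiE {1..2 * n + 1} (\<lambda>_. UNIV).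
       sign \<sigma> * (sign \<pi> * (\<Prod>p\<in>{1..2 * n + 1}. A (\<sigma> p) (q p) (q (\<pi> (mate n p))))))"
    unfolding cyclic_sum_def sum_distrib_left o_apply
    by (intro sum.cong refl) (rule mult.left_commute)
  also have "\<dots> = (\<Sum>\<sigma> | \<sigma> permutes {1..2 * n}. \<Sum>q\<in>PiE {1..2 * n + 1} (\<lambda>_. UNIV).
       sign \<sigma> * (\<Sum>\<pi> | \<pi> permutes odds n. sign \<pi> *
         (\<Prod>p\<in>{1..2 * n + 1}. A (\<sigma> p) (q p) (q (\<pi> (mate n p))))))"
    by (rule sum_distrib_swap)
  also have "\<dots> = 0"
  proof (rule sum.neutral, rule ballI, rule sum.neutral, rule ballI)
    fix \<sigma> and q :: "nat \<Rightarrow> 'v"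
    have "\<not> inj_on q (odds n)"
    proof
      assume "inj_on q (odds n)"
      then have "card (odds n) \<le> CARD('v)"
        by (rule card_inj_on_le) auto
      then show False using card_odds[of n] n by linarith
    qed
    then obtain x y where xy: "x \<in> odds n" "y \<in> odds n" "x \<noteq> y" "q x = q y"
      unfolding inj_on_def by blast
    have qt: "q (Transposition.transpose x y z) = q z" for z
      using xy(4) by (simp add: Transposition.transpose_def)
    have fin: "finite (odds n)" by simp
    have "(\<Sum>\<pi> | \<pi> permutes odds n. sign \<pi> *
         (\<Prod>p\<in>{1..2 * n + 1}. A (\<sigma> p) (q p) (q (\<pi> (mate n p))))) = 0"
      by (rule sum_sign_eq_0_if_transpose_invariant[OF fin xy(1,2,3)]) (simp only: qt o_apply)
    then show "sign \<sigma> * (\<Sum>\<pi> | \<pi> permutes odds n. sign \<pi> *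
         (\<Prod>p\<in>{1..2 * n + 1}. A (\<sigma> p) (q p) (q (\<pi> (mate n p))))) = 0" by (simp only: mult_zero_right)
  qed
  finally show ?thesis .
qed

lemma sign_cycle_of_list:
  assumes "distinct cs" "cs \<noteq> []"
  shows "sign (cycle_of_list cs) = (-1) ^ (length cs - 1)"
  using assms
proof (induction cs rule: cycle_of_list.induct)
  case (1 i j cs)
  then have IH: "sign (cycle_of_list (j # cs)) = (-1) ^ length cs" by simp
  have step: "sign (cycle_of_list (i # j # cs)) =
    sign (Transposition.transpose i j) * sign (cycle_of_list (j # cs))"
    unfolding cycle_of_list.simps(1)
    by (rule sign_compose[OF permutation_swap_id permutation_of_cycle])
  show ?case unfolding step IH using 1(2) by (simp add: sign_swap_id)
qed auto

text \<open>
  The cycle \<open>1 \<mapsto> 2 \<mapsto> \<dots> \<mapsto> 2n + 1 \<mapsto> 1\<close>; its cyclic sum is the standard polynomial in \<open>2n\<close> matrices.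
\<close>

definition succ_cycle :: "nat \<Rightarrow> nat \<Rightarrow> nat"
  where "succ_cycle n p = (if p \<in> {1..2 * n} then p + 1 else if p = 2 * n + 1 then 1 else p)"

lemma succ_cycle_permutes: "succ_cycle n permutes {1..2 * n + 1}"
proof (rule inj_imp_permutes)
  show "inj_on (succ_cycle n) {1..2 * n + 1}"
    by (auto simp: inj_on_def succ_cycle_def split: if_splits)
qed (auto simp: succ_cycle_def)

text \<open>
  The permutations \<open>\<pi> \<circ> mate n\<close> with \<open>\<pi>\<close> permuting the odd positions are those occurring in
  \<open>sum_cyclic_sum_eq_0\<close>. Away from \<open>2n + 1\<close> they lead from odd to even positions and back.
\<close>

context
  fixes n :: nat and \<pi> :: "nat \<Rightarrow> nat"
  assumes \<pi>: "\<pi> permutes odds n"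
begin

lemma alternating_permutes: "\<pi> \<circ> mate n permutes {1..2 * n + 1}"
proof (rule permutes_compose)
  show "mate n permutes {1..2 * n + 1}" using mate_permutes by (rule permutes_subset) auto
  show "\<pi> permutes {1..2 * n + 1}" using \<pi> by (rule permutes_subset) auto
qed

lemma alternating_odd:
  assumes "p \<in> {1..2 * n}" "odd p"
  shows "(\<pi> \<circ> mate n) p = p + 1"
proof -
  have "p + 1 \<notin> odds n" using assms by simp
  then show ?thesis using assms permutes_not_in[OF \<pi>] by (simp add: mate_def)
qed

lemma alternating_even:
  assumes "p \<in> {1..2 * n}" "even p"
  shows "(\<pi> \<circ> mate n) p \<in> odds n"
proof -
  have "mate n p \<in> odds n" using assms by (auto simp: mate_def)
  then show ?thesis using permutes_in_image[OF \<pi>] by simp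
qed

lemma alternating_last: "(\<pi> \<circ> mate n) (2 * n + 1) \<in> odds n"
proof -
  have "mate n (2 * n + 1) \<in> odds n" by (auto simp: mate_def)
  then show ?thesis using permutes_in_image[OF \<pi>] by simp
qed

lemma alternating_permutation: "permutation (\<pi> \<circ> mate n)"
  using alternating_permutes by (rule permutes_imp_permutation[rotated]) simp

text \<open>
  A cycle that avoids \<open>2n + 1\<close> has even length, so rotating it by one step is an odd permutation of the
  positions that commutes with the whole permutation: the sum equals its own negative. In terms of
  matrices, the trace of the standard polynomial of even degree vanishes.
\<close>

lemma cyclic_sum_eq_0:
  fixes A :: "nat \<Rightarrow> 'v::finite \<Rightarrow> 'v \<Rightarrow> int"
  assumes x: "x \<in> {1..2 * n + 1}" and avoid: "2 * n + 1 \<notin> set (support (\<pi> \<circ> mate n) x)"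
  shows "cyclic_sum n A (\<pi> \<circ> mate n) = 0"
proof -
  define \<rho> where "\<rho> = \<pi> \<circ> mate n"
  define C where "C = set (support \<rho> x)"
  define \<tau> where "\<tau> = cycle_of_list (support \<rho> x)"
  have perm: "permutation \<rho>" and \<rho>: "\<rho> permutes {1..2 * n + 1}"
    using alternating_permutation alternating_permutes by (simp_all add: \<rho>_def)
  have inj: "inj \<rho>" using \<rho> by (rule permutes_inj)
  have C_range: "C = range (\<lambda>i. (\<rho> ^^ i) x)"
    unfolding C_def by (rule support_set[OF perm])
  have C_sub: "C \<subseteq> {1..2 * n}"
  proof
    fix y assume y: "y \<in> C"
    then have "y \<in> {1..2 * n + 1}"
      unfolding C_range using permutes_in_image[OF permutes_funpow[OF \<rho>]] x by blast
    moreover have "y \<noteq> 2 * n + 1" using y avoid unfolding C_def \<rho>_def by blast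
    ultimately show "y \<in> {1..2 * n}" by auto
  qed
  have finC: "finite C" by (simp add: C_def)
  have C_step: "\<rho> y \<in> C" if "y \<in> C" for y
  proof -
    from that obtain i where "y = (\<rho> ^^ i) x" unfolding C_range by blast
    then have "\<rho> y = (\<rho> ^^ Suc i) x" by simp
    then show ?thesis unfolding C_range by (rule range_eqI)
  qed
  have \<rho>C: "\<rho> ` C = C"
    using C_step inj by (intro endo_inj_surj finC) (auto intro: inj_on_subset)
  have C_iff: "\<rho> y \<in> C \<longleftrightarrow> y \<in> C" for y
    using \<rho>C inj by (metis inj_image_mem_iff)
  have \<tau>_in: "\<tau> y = \<rho> y" if "y \<in> C" for y
    using cycle_restrict[OF perm, of y x] that by (simp add: \<tau>_def C_def)
  have \<tau>_out: "\<tau> y = y" if "y \<notin> C" for y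
    using id_outside_supp[of y] that by (simp add: \<tau>_def C_def)
  have "\<tau> permutes C" unfolding \<tau>_def C_def by (rule cycle_permutes)
  then have \<tau>: "\<tau> permutes {1..2 * n}" using C_sub by (rule permutes_subset)
  \<comment> \<open>\<open>\<tau>\<close> rotates the cycle \<open>C\<close> and fixes everything else, in particular \<open>2n + 1\<close>.\<close>
  have "\<tau> \<circ> \<rho> = \<rho> \<circ> \<tau>"
  proof
    fix y
    show "(\<tau> \<circ> \<rho>) y = (\<rho> \<circ> \<tau>) y"
      using \<tau>_in[of y] \<tau>_in[of "\<rho> y"] \<tau>_out[of y] \<tau>_out[of "\<rho> y"] C_iff[of y]
      by (cases "y \<in> C") simp_all
  qed
  then have comm: "\<tau> \<circ> \<rho> \<circ> inv \<tau> = \<rho>"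
    using permutes_inv_o(1)[OF \<tau>] by (simp add: o_assoc[symmetric])
  \<comment> \<open>Odd and even positions alternate along a cycle that avoids \<open>2n + 1\<close>.\<close>
  have "\<rho> ` {y\<in>C. odd y} \<subseteq> {y\<in>C. even y}"
  proof safe
    fix y assume y: "y \<in> C" "odd y"
    then show "\<rho> y \<in> C" using C_step by simp
    have "y \<in> {1..2 * n}" using y C_sub by blast
    from alternating_odd[OF this y(2)] y(2) show "even (\<rho> y)" by (simp add: \<rho>_def)
  qed
  moreover have "\<rho> ` {y\<in>C. even y} \<subseteq> {y\<in>C. odd y}"
  proof (rule image_subsetI)
    fix y assume y: "y \<in> {y\<in>C. even y}"
    then have "y \<in> {1..2 * n}" "even y" using C_sub by auto
    from alternating_even[OF this] show "\<rho> y \<in> {y\<in>C. odd y}"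
      using y C_step by (simp add: \<rho>_def)
  qed
  moreover have "inj_on \<rho> B" for B using inj by (rule inj_on_subset) simp
  ultimately have "card {y\<in>C. odd y} = card {y\<in>C. even y}"
    using finC by (intro antisym) (auto intro!: card_inj_on_le[of \<rho>])
  moreover have "card C = card {y\<in>C. odd y} + card {y\<in>C. even y}"
    using finC by (subst card_Un_disjoint[symmetric]) (auto intro: arg_cong[where f=card])
  ultimately have "even (card C)" by simp
  moreover have dist: "distinct (support \<rho> x)" by (rule cycle_of_permutation[OF perm])
  then have "length (support \<rho> x) = card C" unfolding C_def by (rule distinct_card[symmetric])
  moreover have "x \<in> C" unfolding C_range by (rule range_eqI[of _ _ 0]) simp
  then have "C \<noteq> {}" by blast
  then have "card C \<noteq> 0" "support \<rho> x \<noteq> []" using finC by (auto simp: C_def)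
  ultimately have "sign \<tau> = -1"
    unfolding \<tau>_def using sign_cycle_of_list[OF dist] by simp
  then have "cyclic_sum n A \<rho> = - cyclic_sum n A \<rho>"
    using cyclic_sum_conjugate[OF \<tau>, of A \<rho>] comm by simp
  then show ?thesis by (simp add: \<rho>_def)
qed

text \<open>
  If no cycle avoids \<open>2n + 1\<close>, the permutation is one cycle of length \<open>2n + 1\<close>. Numbering the positions
  along it, starting after \<open>2n + 1\<close>, conjugates it to the standard cycle. The numbering moves the pairs
  \<open>{2k - 1, 2k}\<close> as blocks, and a permutation of blocks of size two is even.
\<close>

lemma full_cycle_conjugate:
  assumes n: "n > 0"
    and full: "\<And>x. x \<in> {1..2 * n + 1} \<Longrightarrow> 2 * n + 1 \<in> set (support (\<pi> \<circ> mate n) x)"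
  obtains \<tau> where "\<tau> permutes {1..2 * n}" "sign \<tau> = 1"
    "\<pi> \<circ> mate n = \<tau> \<circ> succ_cycle n \<circ> inv \<tau>"
proof -
  define \<rho> where "\<rho> = \<pi> \<circ> mate n"
  define N where "N = 2 * n + 1"
  have perm: "permutation \<rho>" and \<rho>: "\<rho> permutes {1..N}"
    using alternating_permutation alternating_permutes by (simp_all add: \<rho>_def N_def)
  have in_P: "(\<rho> ^^ k) N \<in> {1..N}" for k
    using permutes_in_image[OF permutes_funpow[OF \<rho>], of k N] by (simp add: N_def)
  have "x \<in> set (support \<rho> N)" if "x \<in> {1..N}" for x
    using disjoint_support'[OF perm, of x N] disjoint_support'[OF perm, of N x] full[of x] that
    by (auto simp: \<rho>_def N_def)
  moreover have "set (support \<rho> N) \<subseteq> {1..N}" using in_P by auto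
  ultimately have set_eq: "set (support \<rho> N) = {1..N}" by blast
  have dist: "distinct (support \<rho> N)" by (rule cycle_of_permutation[OF perm])
  have lp: "least_power \<rho> N = N"
    using distinct_card[OF dist] set_eq by simp
  have inj: "inj_on (\<lambda>k. (\<rho> ^^ k) N) {0..<N}"
    using dist unfolding lp distinct_map by simp
  have return: "(\<rho> ^^ N) N = N"
    using least_power_of_permutation(1)[OF perm, of N] lp by simp
  define \<tau> where "\<tau> p = (if p \<in> {1..2 * n} then (\<rho> ^^ p) N else p)" for p
  have \<tau>_P: "\<tau> p = (\<rho> ^^ p) N" if "p \<in> {1..N}" for p
    using that return by (cases "p = N") (auto simp: \<tau>_def N_def)
  have \<tau>_in: "\<tau> p \<in> {1..2 * n}" if "p \<in> {1..2 * n}" for p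
  proof -
    have "(\<rho> ^^ p) N \<noteq> (\<rho> ^^ 0) N"
      using inj_onD[OF inj, of p 0] that by (auto simp: N_def)
    then show ?thesis using that in_P[of p] by (auto simp: \<tau>_def N_def)
  qed
  have \<tau>: "\<tau> permutes {1..2 * n}"
  proof (rule inj_imp_permutes)
    show "inj_on \<tau> {1..2 * n}"
      using inj by (auto simp: inj_on_def \<tau>_def N_def)
  qed (use \<tau>_in in \<open>auto simp: \<tau>_def\<close>)
  have step: "\<tau> (p + 1) = \<rho> (\<tau> p)" if "p \<in> {1..2 * n}" for p
    using that \<tau>_P[of "p + 1"] by (simp add: \<tau>_def N_def)
  have "\<rho> (\<tau> p) = \<tau> (succ_cycle n p)" for p
  proof -
    consider "p \<in> {1..2 * n}" | "p = N" | "p \<notin> {1..N}" by (force simp: N_def)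
    then show ?thesis
    proof cases
      case 1 then show ?thesis using step[OF 1] by (simp add: succ_cycle_def)
    next
      case 2 then show ?thesis using n by (simp add: succ_cycle_def \<tau>_def N_def)
    next
      case 3
      then have "succ_cycle n p = p" "\<tau> p = p" "\<rho> p = p"
        using permutes_not_in[OF \<rho>, of p] by (auto simp: succ_cycle_def \<tau>_def N_def)
      then show ?thesis by simp
    qed
  qed
  then have "\<rho> \<circ> \<tau> = \<tau> \<circ> succ_cycle n" by (auto simp: fun_eq_iff)
  then have conj: "\<rho> = \<tau> \<circ> succ_cycle n \<circ> inv \<tau>"
    using permutes_inv_o(1)[OF \<tau>] by (metis comp_id o_assoc)
  have parity: "odd (\<tau> p) \<longleftrightarrow> odd p" if "p \<in> {1..2 * n}" for p
    using that
  proof (induction p)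
    case (Suc p)
    show ?case
    proof (cases "p = 0")
      case True
      then have "\<tau> (Suc p) = \<rho> N" using n by (simp add: \<tau>_def)
      then show ?thesis using alternating_last True by (simp add: \<rho>_def N_def)
    next
      case False
      with Suc have p: "p \<in> {1..2 * n}" and IH: "odd (\<tau> p) \<longleftrightarrow> odd p" by auto
      show ?thesis
        using step[OF p] alternating_odd[OF \<tau>_in[OF p]] alternating_even[OF \<tau>_in[OF p]] IH
        by (cases "odd p") (auto simp: \<rho>_def)
    qed
  qed simp
  \<comment> \<open>\<open>\<tau>\<close> acts on the pairs \<open>{2k - 1, 2k}\<close>: it is the product of a permutation of the odd
    positions with its conjugate by \<open>mate\<close>, hence even.\<close>
  define \<kappa> where "\<kappa> p = (if odd p then \<tau> p else p)" for p
  have \<kappa>_perm: "\<kappa> permutes {1..2 * n}"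
  proof (rule inj_imp_permutes)
    show "inj_on \<kappa> {1..2 * n}"
    proof (rule inj_onI)
      fix p q assume pq: "p \<in> {1..2 * n}" "q \<in> {1..2 * n}" "\<kappa> p = \<kappa> q"
      have "odd p \<longleftrightarrow> odd q"
        using pq parity[of p] parity[of q] unfolding \<kappa>_def by (metis (full_types))
      with pq(3) have "p = q \<or> \<tau> p = \<tau> q" by (simp add: \<kappa>_def split: if_splits)
      then show "p = q" using permutes_inj[OF \<tau>] by (auto dest: injD)
    qed
  qed (use \<tau>_in in \<open>auto simp: \<kappa>_def \<tau>_def\<close>)
  have "\<tau> = \<kappa> \<circ> (mate n \<circ> \<kappa> \<circ> mate n)"
  proof
    fix p
    consider "p \<notin> {1..2 * n}" | "p \<in> {1..2 * n}" "odd p" | "p \<in> {1..2 * n}" "even p" by blast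
    then show "\<tau> p = (\<kappa> \<circ> (mate n \<circ> \<kappa> \<circ> mate n)) p"
    proof cases
      case 1
      then have "mate n p = p" "\<tau> p = p" by (auto simp: mate_def \<tau>_def)
      then show ?thesis by (simp add: \<kappa>_def)
    next
      case 2
      then show ?thesis using odd_mate_iff[OF 2(1)] by (simp add: \<kappa>_def)
    next
      case 3
      then have p1: "mate n p = p - 1" "p - 1 \<in> {1..2 * n}" "odd (p - 1)" by (auto simp: mate_def)
      then have o: "odd (\<tau> (p - 1))" using parity by blast
      have "\<tau> p = \<tau> (p - 1) + 1"
        using step[OF p1(2)] alternating_odd[OF \<tau>_in[OF p1(2)] o] 3 by (simp add: \<rho>_def)
      moreover have "mate n (\<tau> (p - 1)) = \<tau> (p - 1) + 1"
        using o \<tau>_in[OF p1(2)] by (simp add: mate_def)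
      ultimately show ?thesis using o p1 by (simp add: \<kappa>_def)
    qed
  qed
  moreover have "permutation \<kappa>" "permutation (mate n)"
    using \<kappa>_perm mate_permutes[of n] by (auto intro: permutes_imp_permutation[rotated])
  ultimately have "sign \<tau> = 1"
    by (simp add: sign_compose permutation_compose mult_ac)
  then show ?thesis using that \<tau> conj by (simp add: \<rho>_def)
qed

end

text \<open>
  In the vanishing sum \<open>sum_cyclic_sum_eq_0\<close> only the full cycles survive. They all contribute
  \<open>cyclic_sum n A (succ_cycle n)\<close> with the same sign, so a positive multiple of this integer is \<open>0\<close>.
  Over the integers the multiple can be cancelled.
\<close>

theorem cyclic_sum_succ_cycle_eq_0:
  fixes A :: "nat \<Rightarrow> 'v::finite \<Rightarrow> 'v \<Rightarrow> int"
  assumes n: "n = CARD('v)"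
  shows "cyclic_sum n A (succ_cycle n) = 0"
proof -
  define full where "full = {\<pi>. \<pi> permutes odds n \<and> (\<exists>\<tau>. \<tau> permutes {1..2 * n} \<and> sign \<tau> = 1 \<and>
    \<pi> \<circ> mate n = \<tau> \<circ> succ_cycle n \<circ> inv \<tau>)}"
  define \<epsilon> where "\<epsilon> = sign (succ_cycle n) * sign (mate n)"
  have n0: "n > 0" unfolding n by simp
  have pm: "permutation (mate n)" and ps: "permutation (succ_cycle n)"
    using mate_permutes[of n] succ_cycle_permutes[of n]
    by (auto intro: permutes_imp_permutation[rotated])
  have fin: "finite {\<pi>. \<pi> permutes odds n}" by (rule finite_permutations) simp
  have "0 = (\<Sum>\<pi> | \<pi> permutes odds n. sign \<pi> * cyclic_sum n A (\<pi> \<circ> mate n))"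
    using sum_cyclic_sum_eq_0[OF n, of A] by simp
  also have "\<dots> = (\<Sum>\<pi>\<in>full. sign \<pi> * cyclic_sum n A (\<pi> \<circ> mate n))"
  proof (rule sum.mono_neutral_right[OF fin])
    show "\<forall>\<pi>\<in>{\<pi>. \<pi> permutes odds n} - full. sign \<pi> * cyclic_sum n A (\<pi> \<circ> mate n) = 0"
    proof
      fix \<pi> assume "\<pi> \<in> {\<pi>. \<pi> permutes odds n} - full"
      then have \<pi>: "\<pi> permutes odds n" and nf: "\<pi> \<notin> full" by auto
      obtain x where "x \<in> {1..2 * n + 1}" "2 * n + 1 \<notin> set (support (\<pi> \<circ> mate n) x)"
      proof (rule ccontr)
        assume "\<not> thesis"
        then have "\<And>x. x \<in> {1..2 * n + 1} \<Longrightarrow> 2 * n + 1 \<in> set (support (\<pi> \<circ> mate n) x)"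
          using that by blast
        from full_cycle_conjugate[OF \<pi> n0 this] have "\<pi> \<in> full"
          unfolding full_def using \<pi> by blast
        with nf show False by simp
      qed
      from cyclic_sum_eq_0[OF \<pi> this] show "sign \<pi> * cyclic_sum n A (\<pi> \<circ> mate n) = 0" by simp
    qed
  qed (auto simp: full_def)
  also have "\<dots> = (\<Sum>\<pi>\<in>full. \<epsilon> * cyclic_sum n A (succ_cycle n))"
  proof (rule sum.cong[OF refl])
    fix \<pi> assume "\<pi> \<in> full"
    then obtain \<tau> where \<pi>: "\<pi> permutes odds n" and \<tau>: "\<tau> permutes {1..2 * n}" "sign \<tau> = 1"
      and conj: "\<pi> \<circ> mate n = \<tau> \<circ> succ_cycle n \<circ> inv \<tau>"
      unfolding full_def by blast
    have pt: "permutation \<tau>" using \<tau> by (auto intro: permutes_imp_permutation[rotated])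
    have pp: "permutation \<pi>" using \<pi> by (rule permutes_imp_permutation[rotated]) simp
    have "sign \<pi> * sign (mate n) = sign (\<tau> \<circ> succ_cycle n \<circ> inv \<tau>)"
      using sign_compose[OF pp pm] conj by simp
    also have "\<dots> = sign (succ_cycle n)"
      using pt ps \<tau>(2) by (simp add: sign_compose permutation_compose permutation_inverse sign_inverse)
    finally have "sign \<pi> * (sign (mate n) * sign (mate n)) = \<epsilon>"
      unfolding \<epsilon>_def by (simp only: mult.assoc[symmetric])
    then have "sign \<pi> = \<epsilon>" by simp
    then show "sign \<pi> * cyclic_sum n A (\<pi> \<circ> mate n) = \<epsilon> * cyclic_sum n A (succ_cycle n)"
      unfolding conj cyclic_sum_conjugate[OF \<tau>(1)] by (simp add: \<tau>(2))
  qed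
  finally have "int (card full) * (\<epsilon> * cyclic_sum n A (succ_cycle n)) = 0" by simp
  \<comment> \<open>The standard cycle is itself one of the full cycles, so their number is not zero.\<close>
  moreover have "succ_cycle n \<circ> mate n \<in> full"
  proof -
    have "succ_cycle n \<circ> mate n permutes {1..2 * n + 1}"
      by (intro permutes_compose[OF _ succ_cycle_permutes] permutes_subset[OF mate_permutes]) auto
    then have "succ_cycle n \<circ> mate n permutes odds n"
    proof (rule permutes_superset)
      fix p assume "p \<in> {1..2 * n + 1} - odds n"
      then have "p \<in> {1..2 * n}" "even p" by (auto elim!: evenE)
      moreover from this have "p - 1 \<in> {1..2 * n}" by auto
      ultimately show "(succ_cycle n \<circ> mate n) p = p" by (simp add: mate_def succ_cycle_def)
    qed
    moreover have "succ_cycle n \<circ> mate n \<circ> mate n = id \<circ> succ_cycle n \<circ> inv id"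
      by (simp add: fun_eq_iff)
    ultimately show ?thesis unfolding full_def using permutes_id sign_id by blast
  qed
  moreover have "finite full" by (rule finite_subset[OF _ fin]) (auto simp: full_def)
  ultimately have "card full \<noteq> 0" "int (card full) * (\<epsilon> * cyclic_sum n A (succ_cycle n)) = 0" by auto
  moreover have "\<epsilon> \<noteq> 0" by (simp add: \<epsilon>_def)
  ultimately show ?thesis by simp
qed

section \<open>The Amitsur--Levitzki identity\<close>

text \<open>
  The standard identity for matrix units, read in Swan's way: \<open>2n\<close> labelled edges on \<open>n\<close> vertices can
  be arranged to a walk from \<open>a\<close> to \<open>b\<close> in as many even as odd orders.
\<close>

lemma signed_walks_cancel:
  fixes e :: "nat \<Rightarrow> 'v::finite \<times> 'v"
  assumes n: "n = CARD('v)"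
  shows "(\<Sum>\<sigma> | \<sigma> permutes {1..2 * n}. \<Sum>q\<in>{q \<in> PiE {1..2 * n + 1} (\<lambda>_. UNIV). q 1 = a \<and> q (2 * n + 1) = b}.
    sign \<sigma> * (\<Prod>p\<in>{1..2 * n}. of_bool (e (\<sigma> p) = (q p, q (p + 1))))) = 0"
proof -
  define A where "A p x y = (if p = 2 * n + 1 then of_bool (y = a \<and> x = b) else of_bool (e p = (x, y)) :: int)"
    for p x y
  have n0: "n > 0" unfolding n by simp
  have "0 = cyclic_sum n A (succ_cycle n)"
    using cyclic_sum_succ_cycle_eq_0[OF n] by simp
  also have "\<dots> = (\<Sum>\<sigma> | \<sigma> permutes {1..2 * n}. \<Sum>q\<in>PiE {1..2 * n + 1} (\<lambda>_. UNIV).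
    (if q 1 = a \<and> q (2 * n + 1) = b
      then sign \<sigma> * (\<Prod>p\<in>{1..2 * n}. of_bool (e (\<sigma> p) = (q p, q (p + 1)))) else 0))"
    unfolding cyclic_sum_def
  proof (rule sum.cong[OF refl], rule sum.cong[OF refl])
    fix \<sigma> q assume "\<sigma> \<in> {\<sigma>. \<sigma> permutes {1..2 * n}}"
    then have \<sigma>: "\<sigma> permutes {1..2 * n}" by simp
    have \<sigma>N: "\<sigma> (2 * n + 1) = 2 * n + 1" using permutes_not_in[OF \<sigma>] by simp
    have \<sigma>p: "\<sigma> p \<noteq> 2 * n + 1" if "p \<in> {1..2 * n}" for p
      using permutes_in_image[OF \<sigma>, of p] that by auto
    have "{1..2 * n + 1} = insert (2 * n + 1) {1..2 * n}" by auto
    then have "(\<Prod>p\<in>{1..2 * n + 1}. A (\<sigma> p) (q p) (q (succ_cycle n p))) =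
      A (2 * n + 1) (q (2 * n + 1)) (q 1) * (\<Prod>p\<in>{1..2 * n}. A (\<sigma> p) (q p) (q (succ_cycle n p)))"
      using \<sigma>N n0 by (simp add: succ_cycle_def)
    also have "(\<Prod>p\<in>{1..2 * n}. A (\<sigma> p) (q p) (q (succ_cycle n p))) =
      (\<Prod>p\<in>{1..2 * n}. of_bool (e (\<sigma> p) = (q p, q (p + 1))))"
      by (rule prod.cong[OF refl]) (use \<sigma>p in \<open>simp add: A_def succ_cycle_def\<close>)
    finally show "sign \<sigma> * (\<Prod>p\<in>{1..2 * n + 1}. A (\<sigma> p) (q p) (q (succ_cycle n p))) =
      (if q 1 = a \<and> q (2 * n + 1) = b
      then sign \<sigma> * (\<Prod>p\<in>{1..2 * n}. of_bool (e (\<sigma> p) = (q p, q (p + 1)))) else 0)"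
      by (simp add: A_def)
  qed
  finally have eq: "0 = \<dots>" .
  have fin: "finite (PiE {1..2 * n + 1} (\<lambda>_. UNIV :: 'v set))" by (simp add: finite_PiE)
  show ?thesis unfolding sum.inter_filter[OF fin] by (rule eq[symmetric])
qed

text \<open>
  Expanding every matrix into matrix units: the edge function \<open>e\<close> selects one entry of each matrix, and
  only the selection that \<open>Q\<close> prescribes contributes. Separating the entries of \<open>M\<close> from integer
  coefficients is what carries the identity from integers to an arbitrary commutative ring, including
  those of positive characteristic.
\<close>

lemma prod_permuted_entries:
  fixes M :: "nat \<Rightarrow> 'x::finite \<Rightarrow> 'r::comm_ring_1"
  assumes \<sigma>: "\<sigma> permutes L" and L: "finite L"
  shows "(\<Prod>p\<in>L. M (\<sigma> p) (Q p)) =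
    (\<Sum>e\<in>PiE L (\<lambda>_. UNIV). of_int (\<Prod>p\<in>L. of_bool (e (\<sigma> p) = Q p)) * (\<Prod>l\<in>L. M l (e l)))"
proof -
  define e0 where "e0 = restrict (\<lambda>l. Q (inv \<sigma> l)) L"
  have e0: "e0 \<in> PiE L (\<lambda>_. UNIV)" by (auto simp: e0_def)
  have in_L: "\<sigma> p \<in> L \<longleftrightarrow> p \<in> L" for p using permutes_in_image[OF \<sigma>] .
  have "(\<Sum>e\<in>PiE L (\<lambda>_. UNIV). of_int (\<Prod>p\<in>L. of_bool (e (\<sigma> p) = Q p)) * (\<Prod>l\<in>L. M l (e l))) =
    (\<Sum>e\<in>PiE L (\<lambda>_. UNIV). if e = e0 then (\<Prod>l\<in>L. M l (e l)) else 0)"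
  proof (rule sum.cong[OF refl])
    fix e assume e: "e \<in> PiE L (\<lambda>_. UNIV :: 'x set)"
    show "of_int (\<Prod>p\<in>L. of_bool (e (\<sigma> p) = Q p)) * (\<Prod>l\<in>L. M l (e l)) =
      (if e = e0 then (\<Prod>l\<in>L. M l (e l)) else 0)"
    proof (cases "e = e0")
      case True
      have "e (\<sigma> p) = Q p" if "p \<in> L" for p
        using that in_L permutes_inverses(2)[OF \<sigma>] by (simp add: True e0_def)
      then have "(\<Prod>p\<in>L. of_bool (e (\<sigma> p) = Q p)) = (1 :: int)" by (intro prod.neutral) simp
      then show ?thesis using True by simp
    next
      case False
      then obtain l where l: "l \<in> L" "e l \<noteq> e0 l"
        using e e0 by (metis PiE_ext)
      then have "inv \<sigma> l \<in> L" "e (\<sigma> (inv \<sigma> l)) \<noteq> Q (inv \<sigma> l)"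
        using permutes_in_image[OF permutes_inv[OF \<sigma>]] permutes_inverses(1)[OF \<sigma>]
        by (auto simp: e0_def)
      then have "(\<Prod>p\<in>L. of_bool (e (\<sigma> p) = Q p)) = (0 :: int)" using L by (intro prod_zero) auto
      then show ?thesis using False by simp
    qed
  qed
  also have "\<dots> = (\<Prod>l\<in>L. M l (e0 l))"
    using e0 L by (simp add: sum.delta' finite_PiE)
  also have "\<dots> = (\<Prod>p\<in>L. M (\<sigma> p) (e0 (\<sigma> p)))"
    by (subst prod.permute[OF \<sigma>]) simp
  also have "\<dots> = (\<Prod>p\<in>L. M (\<sigma> p) (Q p))"
    by (rule prod.cong[OF refl]) (simp add: e0_def in_L permutes_inverses(2)[OF \<sigma>])
  finally show ?thesis by simp
qed

lemma signed_path_sums_cancel: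
  fixes M :: "nat \<Rightarrow> 'v::finite \<times> 'v \<Rightarrow> 'r::comm_ring_1" and w :: "'v \<Rightarrow> 'r"
  assumes n: "n = CARD('v)"
  shows "(\<Sum>\<sigma> | \<sigma> permutes {1..2 * n}. of_int (sign \<sigma>) *
    (\<Sum>q\<in>{q \<in> PiE {1..2 * n + 1} (\<lambda>_. UNIV). q 1 = a}.
      (\<Prod>p\<in>{1..2 * n}. M (\<sigma> p) (q p, q (p + 1))) * w (q (2 * n + 1)))) = 0"
proof -
  let ?L = "{1..2 * n}"
  let ?P = "PiE {1..2 * n + 1} (\<lambda>_. UNIV) :: (nat \<Rightarrow> 'v) set"
  let ?E = "PiE ?L (\<lambda>_. UNIV) :: (nat \<Rightarrow> 'v \<times> 'v) set"
  define g where "g \<sigma> q e = (\<Prod>p\<in>?L. of_bool (e (\<sigma> p) = (q p, q (p + 1))) :: int)"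
    for \<sigma> :: "nat \<Rightarrow> nat" and q :: "nat \<Rightarrow> 'v" and e :: "nat \<Rightarrow> 'v \<times> 'v"
  have fP: "finite ?P" and fE: "finite ?E" by (simp_all add: finite_PiE)
  have "of_int (sign \<sigma>) * (\<Sum>q\<in>{q \<in> ?P. q 1 = a}. (\<Prod>p\<in>?L. M (\<sigma> p) (q p, q (p + 1))) * w (q (2 * n + 1)))
    = (\<Sum>e\<in>?E. \<Sum>b\<in>UNIV. (\<Prod>l\<in>?L. M l (e l)) * w b *
        of_int (\<Sum>q\<in>{q \<in> ?P. q 1 = a \<and> q (2 * n + 1) = b}. sign \<sigma> * g \<sigma> q e))"
    if \<sigma>: "\<sigma> permutes ?L" for \<sigma>
  proof -
    have "(\<Sum>q\<in>{q \<in> ?P. q 1 = a}. (\<Prod>p\<in>?L. M (\<sigma> p) (q p, q (p + 1))) * w (q (2 * n + 1)))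
      = (\<Sum>b\<in>UNIV. \<Sum>q\<in>{q \<in> {q \<in> ?P. q 1 = a}. q (2 * n + 1) = b}. (\<Prod>p\<in>?L. M (\<sigma> p) (q p, q (p + 1))) * w (q (2 * n + 1)))"
      by (rule sum.group[symmetric]) (use fP in auto)
    also have "\<dots> = (\<Sum>b\<in>UNIV. \<Sum>q\<in>{q \<in> ?P. q 1 = a \<and> q (2 * n + 1) = b}.
        \<Sum>e\<in>?E. of_int (g \<sigma> q e) * (\<Prod>l\<in>?L. M l (e l)) * w b)"
    proof (rule sum.cong[OF refl], rule sum.cong)
      fix b q assume "q \<in> {q \<in> ?P. q 1 = a \<and> q (2 * n + 1) = b}"
      then have "q (2 * n + 1) = b" by simp
      then show "(\<Prod>p\<in>?L. M (\<sigma> p) (q p, q (p + 1))) * w (q (2 * n + 1)) =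
        (\<Sum>e\<in>?E. of_int (g \<sigma> q e) * (\<Prod>l\<in>?L. M l (e l)) * w b)"
        using prod_permuted_entries[OF \<sigma>, of M "\<lambda>p. (q p, q (p + 1))"]
        by (simp only: g_def sum_distrib_right finite_atLeastAtMost)
    qed auto
    also have "\<dots> = (\<Sum>b\<in>UNIV. \<Sum>e\<in>?E. \<Sum>q\<in>{q \<in> ?P. q 1 = a \<and> q (2 * n + 1) = b}.
        of_int (g \<sigma> q e) * (\<Prod>l\<in>?L. M l (e l)) * w b)"
      by (rule sum.cong[OF refl]) (rule sum.swap)
    also have "\<dots> = (\<Sum>e\<in>?E. \<Sum>b\<in>UNIV. \<Sum>q\<in>{q \<in> ?P. q 1 = a \<and> q (2 * n + 1) = b}.
        of_int (g \<sigma> q e) * (\<Prod>l\<in>?L. M l (e l)) * w b)"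
      by (rule sum.swap)
    finally have eq: "(\<Sum>q\<in>{q \<in> ?P. q 1 = a}. (\<Prod>p\<in>?L. M (\<sigma> p) (q p, q (p + 1))) * w (q (2 * n + 1))) = \<dots>" .
    show ?thesis unfolding eq of_int_sum sum_distrib_left of_int_mult
      by (intro sum.cong refl) (simp only: mult_ac)
  qed
  then have "(\<Sum>\<sigma> | \<sigma> permutes ?L. of_int (sign \<sigma>) *
    (\<Sum>q\<in>{q \<in> ?P. q 1 = a}. (\<Prod>p\<in>?L. M (\<sigma> p) (q p, q (p + 1))) * w (q (2 * n + 1)))) =
    (\<Sum>\<sigma> | \<sigma> permutes ?L. \<Sum>e\<in>?E. \<Sum>b\<in>UNIV. (\<Prod>l\<in>?L. M l (e l)) * w b *
        of_int (\<Sum>q\<in>{q \<in> ?P. q 1 = a \<and> q (2 * n + 1) = b}. sign \<sigma> * g \<sigma> q e))"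
    by (intro sum.cong refl) simp
  also have "\<dots> = (\<Sum>e\<in>?E. \<Sum>b\<in>UNIV. (\<Prod>l\<in>?L. M l (e l)) * w b *
    (\<Sum>\<sigma> | \<sigma> permutes ?L. of_int (\<Sum>q\<in>{q \<in> ?P. q 1 = a \<and> q (2 * n + 1) = b}. sign \<sigma> * g \<sigma> q e)))"
    by (rule sum_distrib_swap)
  also have "\<dots> = 0"
  proof (rule sum.neutral, rule ballI, rule sum.neutral, rule ballI)
    fix e b
    have "(\<Sum>\<sigma> | \<sigma> permutes ?L. \<Sum>q\<in>{q \<in> ?P. q 1 = a \<and> q (2 * n + 1) = b}. sign \<sigma> * g \<sigma> q e) = 0"
      unfolding g_def by (rule signed_walks_cancel[OF n])
    then have "(\<Sum>\<sigma> | \<sigma> permutes ?L. of_int (\<Sum>q\<in>{q \<in> ?P. q 1 = a \<and> q (2 * n + 1) = b}. sign \<sigma> * g \<sigma> q e)) = (0 :: 'r)"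
      unfolding of_int_sum[symmetric] by (simp only: of_int_0)
    then show "(\<Prod>l\<in>?L. M l (e l)) * w b *
      (\<Sum>\<sigma> | \<sigma> permutes ?L. of_int (\<Sum>q\<in>{q \<in> ?P. q 1 = a \<and> q (2 * n + 1) = b}. sign \<sigma> * g \<sigma> q e)) = 0"
      by (simp only: mult_zero_right)
  qed
  finally show ?thesis .
qed

lemma foldr_matrix_vector_mult_component:
  fixes M :: "nat \<Rightarrow> 'r::comm_ring_1 ^ 'v ^ 'v::finite"
  shows "foldr (\<lambda>i v. M i *v v) [1..<Suc r] w $ a =
    (\<Sum>q\<in>{q \<in> PiE {1..Suc r} (\<lambda>_. UNIV). q 1 = a}.
      (\<Prod>p\<in>{1..r}. M p $ q p $ q (p + 1)) * w $ q (Suc r))"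
proof (induction r arbitrary: w)
  case 0
  have "{q \<in> PiE {1..Suc 0} (\<lambda>_. UNIV). q 1 = a} = {restrict (\<lambda>_. a) {1}}"
    by (auto simp: PiE_iff extensional_def fun_eq_iff)
  then show ?case by simp
next
  case (Suc r)
  let ?S = "\<lambda>r. {q \<in> PiE {1..Suc r} (\<lambda>_. UNIV :: 'v set). q 1 = a}"
  have "foldr (\<lambda>i v. M i *v v) [1..<Suc (Suc r)] w $ a =
    (\<Sum>q\<in>?S r. \<Sum>b\<in>UNIV. (\<Prod>p\<in>{1..r}. M p $ q p $ q (p + 1)) * (M (Suc r) $ q (Suc r) $ b * w $ b))"
    using Suc.IH[of "M (Suc r) *v w"]
    by (simp add: matrix_vector_mult_def sum_distrib_left)
  also have "\<dots> = (\<Sum>(q, b)\<in>?S r \<times> UNIV. (\<Prod>p\<in>{1..r}. M p $ q p $ q (p + 1)) * (M (Suc r) $ q (Suc r) $ b * w $ b))"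
    by (simp add: sum.cartesian_product)
  also have "\<dots> = (\<Sum>q\<in>?S (Suc r). (\<Prod>p\<in>{1..Suc r}. M p $ q p $ q (p + 1)) * w $ q (Suc (Suc r)))"
  proof (rule sum.reindex_bij_witness[of _ "\<lambda>q. (restrict q {1..Suc r}, q (Suc (Suc r)))"
        "\<lambda>(q, b). q(Suc (Suc r) := b)"])
    fix x assume "x \<in> ?S r \<times> (UNIV :: 'v set)"
    then obtain q b where x: "x = (q, b)" and q: "q \<in> ?S r" by auto
    have out: "q (Suc (Suc r)) = undefined" using q by (auto simp: PiE_iff extensional_def)
    show "(\<lambda>q. (restrict q {1..Suc r}, q (Suc (Suc r)))) (case x of (q, b) \<Rightarrow> q(Suc (Suc r) := b)) = x"
      using q by (auto simp: x fun_eq_iff PiE_iff extensional_def)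
    show "(case x of (q, b) \<Rightarrow> q(Suc (Suc r) := b)) \<in> ?S (Suc r)"
      using q by (auto simp: x PiE_iff extensional_def)
    have "(\<Prod>p\<in>{1..r}. M p $ (q(Suc (Suc r) := b)) p $ (q(Suc (Suc r) := b)) (p + 1)) =
      (\<Prod>p\<in>{1..r}. M p $ q p $ q (p + 1))"
      by (rule prod.cong[OF refl]) auto
    moreover have "{1..Suc r} = insert (Suc r) {1..r}" by auto
    ultimately show "(\<Prod>p\<in>{1..Suc r}. M p $ (case x of (q, b) \<Rightarrow> q(Suc (Suc r) := b)) p $
            (case x of (q, b) \<Rightarrow> q(Suc (Suc r) := b)) (p + 1)) *
         w $ (case x of (q, b) \<Rightarrow> q(Suc (Suc r) := b)) (Suc (Suc r)) =
         (case x of (q, b) \<Rightarrow> (\<Prod>p\<in>{1..r}. M p $ q p $ q (p + 1)) * (M (Suc r) $ q (Suc r) $ b * w $ b))"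
      by (simp add: x mult_ac)
  next
    fix q assume q: "q \<in> ?S (Suc r)"
    have "restrict q {1..Suc r} \<in> ?S r" using q by (auto simp: PiE_iff)
    then show "(restrict q {1..Suc r}, q (Suc (Suc r))) \<in> ?S r \<times> UNIV" by simp
    show "(case (restrict q {1..Suc r}, q (Suc (Suc r))) of (q, b) \<Rightarrow> q(Suc (Suc r) := b)) = q"
      using q by (auto simp: fun_eq_iff PiE_iff extensional_def)
  qed
  finally show ?case .
qed

text \<open>
  The form in which the identity is needed: the matrices act one after the other on a vector.
\<close>

theorem amitsur_levitzki:
  fixes M :: "nat \<Rightarrow> 'r::comm_ring_1 ^ 'v ^ 'v::finite"
  assumes n: "n = CARD('v)"
  shows "(\<Sum>\<sigma> | \<sigma> permutes {1..2 * n}.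
    of_int (sign \<sigma>) * foldr (\<lambda>i v. M (\<sigma> i) *v v) [1..<2 * n + 1] w $ a) = 0"
proof -
  have "foldr (\<lambda>i v. M (\<sigma> i) *v v) [1..<2 * n + 1] w $ a =
    (\<Sum>q\<in>{q \<in> PiE {1..2 * n + 1} (\<lambda>_. UNIV). q 1 = a}.
      (\<Prod>p\<in>{1..2 * n}. M (\<sigma> p) $ q p $ q (p + 1)) * w $ q (2 * n + 1))" for \<sigma> :: "nat \<Rightarrow> nat"
    using foldr_matrix_vector_mult_component[of "\<lambda>i. M (\<sigma> i)" "2 * n" w a] by simp
  then show ?thesis
    using signed_path_sums_cancel[OF n, where a = a and M = "\<lambda>p x. M p $ fst x $ snd x"
      and w = "\<lambda>x. w $ x"] by (simp only: fst_conv snd_conv)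
qed

section \<open>Jacobian matrices in Witt algebras\<close>

lemma rn_prod_Cons: "ys \<noteq> [] \<Longrightarrow> rn_prod mul (x # ys) = mul x (rn_prod mul ys)"
  by (cases ys) auto

fun walk :: "('a \<Rightarrow> 'v \<times> 'v) \<Rightarrow> 'a list \<Rightarrow> 'v \<Rightarrow> 'v \<Rightarrow> bool" where
  "walk e [] a b \<longleftrightarrow> a = b"
| "walk e (x # xs) a b \<longleftrightarrow> fst (e x) = a \<and> walk e xs (snd (e x)) b"

text \<open>
  What the three families have in common. The coefficient algebra \<open>U\<close> need only be a subset of the type
  with its own multiplication, so \<open>h\<close> realizes it inside a commutative ring, where matrices can be
  multiplied. The values of \<open>D j\<close> on the unit and on the coordinates \<open>X i\<close> provide vector fields whose
  Jacobian matrices are zero or matrix units.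
\<close>

locale witt_embedding =
  fixes U :: "('e \<Rightarrow>\<^sub>0 'k::field) set"
    and mul :: "('e \<Rightarrow>\<^sub>0 'k) \<Rightarrow> ('e \<Rightarrow>\<^sub>0 'k) \<Rightarrow> ('e \<Rightarrow>\<^sub>0 'k)"
    and D :: "'n::finite \<Rightarrow> ('e \<Rightarrow>\<^sub>0 'k) \<Rightarrow> ('e \<Rightarrow>\<^sub>0 'k)"
    and h :: "('e \<Rightarrow>\<^sub>0 'k) \<Rightarrow> 'r::comm_ring_1"
    and unit :: "'e \<Rightarrow>\<^sub>0 'k"
    and X :: "'n \<Rightarrow> ('e \<Rightarrow>\<^sub>0 'k)"
  assumes subspace: "pm.subspace U"
    and mul_closed: "u \<in> U \<Longrightarrow> v \<in> U \<Longrightarrow> mul u v \<in> U"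
    and D_closed: "u \<in> U \<Longrightarrow> D j u \<in> U"
    and D_add: "D j (u + v) = D j u + D j v"
    and h_add: "h (u + v) = h u + h v"
    and h_mul: "u \<in> U \<Longrightarrow> v \<in> U \<Longrightarrow> h (mul u v) = h u * h v"
    and h_eq_0: "u \<in> U \<Longrightarrow> h u = 0 \<Longrightarrow> u = 0"
    and unit_closed: "unit \<in> U" and h_unit: "h unit = 1" and D_unit: "D j unit = 0"
    and X_closed: "X i \<in> U" and D_X: "D j (X i) = (if i = j then unit else 0)"
begin

abbreviation A :: "('k, ('e \<Rightarrow>\<^sub>0 'k) ^ 'n) nalg"
  where "A \<equiv> witt U mul pm_scale D"

abbreviation S :: "(('e \<Rightarrow>\<^sub>0 'k) ^ 'n) set"
  where "S \<equiv> {a. \<forall>i. a $ i \<in> U}"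

lemma space_A: "nalg.space A = S"
  by (simp add: witt_def)

lemma scal_A: "nalg.scal A c a $ i = pm_scale c (a $ i)"
  by (simp add: witt_def)

lemma U_0: "0 \<in> U" and U_add: "u \<in> U \<Longrightarrow> v \<in> U \<Longrightarrow> u + v \<in> U"
  and U_scale: "u \<in> U \<Longrightarrow> pm_scale c u \<in> U"
  and U_diff: "u \<in> U \<Longrightarrow> v \<in> U \<Longrightarrow> u - v \<in> U"
  and U_sum: "(\<And>x. x \<in> B \<Longrightarrow> g x \<in> U) \<Longrightarrow> sum g B \<in> U"
  using subspace by (auto intro: pm.subspace_0 pm.subspace_add pm.subspace_scale pm.subspace_diff pm.subspace_sum)

lemma h_0: "h 0 = 0"
  using h_add[of 0 0] by simp

lemma h_minus: "h (- u) = - h u"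
  using h_add[of u "- u"] h_0 by (simp add: eq_neg_iff_add_eq_0 add.commute)

lemma h_diff: "h (u - v) = h u - h v"
  using h_add[of u "- v"] h_minus by simp

lemma h_sum: "h (sum g B) = (\<Sum>x\<in>B. h (g x))"
  by (induction B rule: infinite_finite_induct) (simp_all add: h_0 h_add)

lemma h_sign: "h (pm_scale (of_int (sign \<sigma>)) u) = of_int (sign \<sigma>) * h u"
  by (cases \<sigma> rule: sign_cases) (simp_all add: h_minus)

lemma D_0: "D j 0 = 0"
  using D_add[of j 0 0] by simp

definition jacobian :: "('e \<Rightarrow>\<^sub>0 'k) ^ 'n \<Rightarrow> 'r ^ 'n ^ 'n"
  where "jacobian a = (\<chi> i j. h (D j (a $ i)))"

definition embed :: "('e \<Rightarrow>\<^sub>0 'k) ^ 'n \<Rightarrow> 'r ^ 'n"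
  where "embed a = (\<chi> i. h (a $ i))"

lemma embed_add: "embed (a + b) = embed a + embed b"
  by (simp add: embed_def vec_eq_iff h_add)

lemma jacobian_add: "jacobian (a + b) = jacobian a + jacobian b"
  by (simp add: jacobian_def vec_eq_iff h_add D_add)

lemma embed_inject:
  assumes "a \<in> S" "b \<in> S" "embed a = embed b" shows "a = b"
proof -
  have "a $ i = b $ i" for i
  proof -
    have "h (a $ i - b $ i) = 0" using assms(3) by (simp add: embed_def vec_eq_iff h_diff)
    then show ?thesis using h_eq_0[of "a $ i - b $ i"] assms U_diff by simp
  qed
  then show ?thesis by (simp add: vec_eq_iff)
qed

lemma S_add: "a \<in> S \<Longrightarrow> b \<in> S \<Longrightarrow> a + b \<in> S" and S_0: "0 \<in> S"
  by (auto intro: U_add U_0)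

lemma S_sum: "(\<And>x. x \<in> B \<Longrightarrow> g x \<in> S) \<Longrightarrow> sum g B \<in> S"
  by (induction B rule: infinite_finite_induct) (auto intro: U_add U_0)

lemma prod_closed: "a \<in> S \<Longrightarrow> b \<in> S \<Longrightarrow> nalg.prod A a b \<in> S"
  by (auto simp: witt_def intro!: U_sum mul_closed D_closed)

text \<open>
  The key observation: \<open>a \<circ> b\<close> has coefficients \<open>\<Sum>\<^sub>j b\<^sub>j \<partial>\<^sub>j(a\<^sub>i)\<close>, which is the Jacobian matrix of \<open>a\<close>
  applied to the vector \<open>b\<close>. Hence a right-normed word \<open>a\<^sub>1 \<circ> \<dots> \<circ> a\<^sub>k\<close> is the product of the Jacobian
  matrices of \<open>a\<^sub>1, \<dots>, a\<^bsub>k-1\<^esub>\<close> applied to \<open>a\<^sub>k\<close>.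
\<close>

lemma embed_prod:
  assumes "a \<in> S" "b \<in> S"
  shows "embed (nalg.prod A a b) = jacobian a *v embed b"
  using assms
  by (auto simp: vec_eq_iff embed_def witt_def h_sum h_mul D_closed jacobian_def
      matrix_vector_mult_def mult.commute intro!: sum.cong)

lemma prod_add_left:
  assumes "a \<in> S" "b \<in> S" "c \<in> S"
  shows "nalg.prod A (a + b) c = nalg.prod A a c + nalg.prod A b c"
proof (rule embed_inject)
  show "embed (nalg.prod A (a + b) c) = embed (nalg.prod A a c + nalg.prod A b c)"
    by (simp only: embed_add embed_prod[OF S_add[OF assms(1,2)] assms(3)] embed_prod[OF assms(1,3)]
        embed_prod[OF assms(2,3)] jacobian_add matrix_vector_mult_add_rdistrib)
qed (intro S_add prod_closed assms)+

lemma prod_add_right: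
  assumes "a \<in> S" "b \<in> S" "c \<in> S"
  shows "nalg.prod A a (b + c) = nalg.prod A a b + nalg.prod A a c"
proof (rule embed_inject)
  show "embed (nalg.prod A a (b + c)) = embed (nalg.prod A a b + nalg.prod A a c)"
    by (simp only: embed_add embed_prod[OF assms(1) S_add[OF assms(2,3)]] embed_prod[OF assms(1,3)]
        embed_prod[OF assms(1,2)] matrix_vector_right_distrib)
qed (intro S_add prod_closed assms)+

lemma prod_0_left: "b \<in> S \<Longrightarrow> nalg.prod A 0 b = 0"
  using prod_add_left[OF S_0 S_0, of b] by (metis add_0_left add_cancel_left_left)

lemma prod_0_right: "a \<in> S \<Longrightarrow> nalg.prod A a 0 = 0"
  using prod_add_right[OF _ S_0 S_0, of a] by (metis add_0_left add_cancel_left_left)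

lemma prod_sum_left:
  assumes "finite B" "\<And>x. x \<in> B \<Longrightarrow> g x \<in> S" "b \<in> S"
  shows "nalg.prod A (sum g B) b = (\<Sum>x\<in>B. nalg.prod A (g x) b)"
  using assms(1,2)
proof (induction B rule: finite_induct)
  case (insert x F)
  have "nalg.prod A (g x + sum g F) b = nalg.prod A (g x) b + nalg.prod A (sum g F) b"
    using insert.prems by (intro prod_add_left S_sum assms(3)) auto
  then show ?case using insert by simp
qed (simp add: prod_0_left[OF assms(3)])

lemma prod_sum_right:
  assumes "finite B" "\<And>x. x \<in> B \<Longrightarrow> g x \<in> S" "a \<in> S"
  shows "nalg.prod A a (sum g B) = (\<Sum>x\<in>B. nalg.prod A a (g x))"
  using assms(1,2)
proof (induction B rule: finite_induct)
  case (insert x F)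
  have "nalg.prod A a (g x + sum g F) = nalg.prod A a (g x) + nalg.prod A a (sum g F)"
    using insert.prems by (intro prod_add_right S_sum assms(3)) auto
  then show ?case using insert by simp
qed (simp add: prod_0_right[OF assms(3)])

lemma rn_prod_closed: "xs \<noteq> [] \<Longrightarrow> set xs \<subseteq> S \<Longrightarrow> rn_prod (nalg.prod A) xs \<in> S"
proof (induction xs rule: induct_list012)
  case (3 x y zs)
  then show ?case using prod_closed[of x "rn_prod (nalg.prod A) (y # zs)"] by simp
qed auto

lemma embed_rn_prod:
  assumes "set xs \<subseteq> S" "y \<in> S"
  shows "embed (rn_prod (nalg.prod A) (xs @ [y])) = foldr (\<lambda>x v. jacobian x *v v) xs (embed y)"
  using assms(1)
proof (induction xs)
  case (Cons x xs)
  have "rn_prod (nalg.prod A) (xs @ [y]) \<in> S"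
    using Cons.prems assms(2) by (intro rn_prod_closed) auto
  with Cons show ?case
    by (simp add: rn_prod_Cons embed_prod del: mem_Collect_eq)
qed simp

text \<open>
  After passing to Jacobian matrices this is the Amitsur--Levitzki identity applied to a vector.
\<close>

theorem standard_identity: "satisfies_standard A CARD('n)"
  unfolding satisfies_standard_def
proof (intro allI impI)
  fix a :: "nat \<Rightarrow> ('e \<Rightarrow>\<^sub>0 'k) ^ 'n"
  let ?n = "CARD('n)"
  let ?w = "\<lambda>\<sigma>. rn_prod (nalg.prod A) (map (\<lambda>i. a (\<sigma> i)) [1..<2 * ?n + 1] @ [a (2 * ?n + 1)])"
  assume "\<forall>i\<in>{1..2 * ?n + 1}. a i \<in> nalg.space A"
  then have a: "a i \<in> S" if "i \<in> {1..2 * ?n + 1}" for i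
    using that space_A by blast
  have sub: "set (map (\<lambda>i. a (\<sigma> i)) [1..<2 * ?n + 1]) \<subseteq> S" if "\<sigma> permutes {1..2 * ?n}" for \<sigma>
  proof
    fix y assume "y \<in> set (map (\<lambda>i. a (\<sigma> i)) [1..<2 * ?n + 1])"
    then obtain i where "i \<in> set [1..<2 * ?n + 1]" "y = a (\<sigma> i)" by (metis (no_types, lifting) imageE set_map)
    moreover from this have "i \<in> {1..2 * ?n}" by auto
    ultimately have "i \<in> {1..2 * ?n}" "y = a (\<sigma> i)" by blast+
    then show "y \<in> S" using a[of "\<sigma> i"] permutes_in_image[OF that, of i] by auto
  qed
  have last: "a (2 * ?n + 1) \<in> S" by (rule a) simp
  show "(\<Sum>\<sigma> | \<sigma> permutes {1..2 * ?n}. nalg.scal A (of_int (sign \<sigma>)) (?w \<sigma>)) = 0"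
  proof (rule embed_inject)
    have "?w \<sigma> \<in> S" if "\<sigma> permutes {1..2 * ?n}" for \<sigma>
      using sub[OF that] last by (intro rn_prod_closed) auto
    then show "(\<Sum>\<sigma> | \<sigma> permutes {1..2 * ?n}. nalg.scal A (of_int (sign \<sigma>)) (?w \<sigma>)) \<in> S"
      by (intro S_sum) (auto simp: scal_A intro: U_scale)
    have "embed (\<Sum>\<sigma> | \<sigma> permutes {1..2 * ?n}. nalg.scal A (of_int (sign \<sigma>)) (?w \<sigma>)) $ i =
      (\<Sum>\<sigma> | \<sigma> permutes {1..2 * ?n}. of_int (sign \<sigma>) * embed (?w \<sigma>) $ i)" for i
      by (simp add: embed_def h_sum scal_A h_sign)
    also have "\<dots> i = (\<Sum>\<sigma> | \<sigma> permutes {1..2 * ?n}. of_int (sign \<sigma>) *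
      foldr (\<lambda>i v. jacobian (a (\<sigma> i)) *v v) [1..<2 * ?n + 1] (embed (a (2 * ?n + 1))) $ i)" for i
      by (rule sum.cong[OF refl])
        (simp only: embed_rn_prod[OF sub last] mem_Collect_eq foldr_map o_def)
    also have "\<dots> i = 0" for i
      by (rule amitsur_levitzki[OF refl])
    finally show "embed (\<Sum>\<sigma> | \<sigma> permutes {1..2 * ?n}. nalg.scal A (of_int (sign \<sigma>)) (?w \<sigma>)) = embed 0"
      by (simp add: vec_eq_iff embed_def h_0)
  qed (rule S_0)
qed

text \<open>
  Two kinds of vector fields suffice for the lower bound. The constant fields \<open>\<partial>\<^sub>b\<close> have zero Jacobian
  matrix and so vanish unless they come last in a word; the linear fields \<open>x\<^sub>t \<partial>\<^sub>s\<close> have the matrix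
  unit \<open>E\<^sub>s\<^sub>t\<close> as Jacobian matrix. The latter are indexed by the edge \<open>(s, t)\<close>.
\<close>

definition constant_field :: "'n \<Rightarrow> ('e \<Rightarrow>\<^sub>0 'k) ^ 'n"
  where "constant_field b = (\<chi> i. if i = b then unit else 0)"

definition linear_field :: "'n \<times> 'n \<Rightarrow> ('e \<Rightarrow>\<^sub>0 'k) ^ 'n"
  where "linear_field x = (\<chi> i. if i = fst x then X (snd x) else 0)"

lemma constant_field_closed: "constant_field b \<in> S"
  by (simp add: constant_field_def unit_closed U_0)

lemma linear_field_closed: "linear_field x \<in> S"
  by (simp add: linear_field_def X_closed U_0)

lemma jacobian_constant_field: "jacobian (constant_field b) *v v = 0"
  by (simp add: vec_eq_iff jacobian_def constant_field_def matrix_vector_mult_def D_unit D_0 h_0)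

lemma jacobian_linear_field:
  "(jacobian (linear_field x) *v v) $ i = (if i = fst x then v $ snd x else 0)"
proof -
  have "(jacobian (linear_field x) *v v) $ i =
    (\<Sum>j\<in>UNIV. if j = snd x then (if i = fst x then v $ j else 0) else 0)"
    unfolding matrix_vector_mult_def vec_lambda_beta
    by (rule sum.cong[OF refl]) (simp add: jacobian_def linear_field_def D_X D_0 h_0 h_unit)
  then show ?thesis by simp
qed

lemma embed_constant_field: "embed (constant_field b) $ i = of_bool (i = b)"
  by (simp add: embed_def constant_field_def h_unit h_0)

lemma foldr_jacobian_linear_fields:
  assumes "\<And>x. x \<in> set xs \<Longrightarrow> a x = linear_field (e x)"
  shows "foldr (\<lambda>x v. jacobian (a x) *v v) xs (embed (constant_field b)) $ i = of_bool (walk e xs i b)"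
  using assms
  by (induction xs arbitrary: i) (auto simp: embed_constant_field jacobian_linear_field)

lemma foldr_jacobian_constant_field:
  assumes "x \<in> set xs" "a x = constant_field b"
  shows "foldr (\<lambda>x v. jacobian (a x) *v v) xs w = 0"
  using assms(1)
proof (induction xs)
  case (Cons y ys)
  then show ?case using assms(2) by (cases "x = y") (auto simp: jacobian_constant_field)
qed simp

text \<open>
  Substituting one constant field and linear fields otherwise, a word becomes a product of matrix units
  applied to a unit vector: it survives precisely when the constant field is last and the edges form a
  walk.
\<close>

lemma rn_prod_fields:
  assumes a: "a = (\<lambda>x. if x = t then constant_field b else linear_field (e x))"
    and w: "distinct w" "t \<in> set w"
  shows "rn_prod (nalg.prod A) (map a w) $ i =
    (if last w = t \<and> walk e (butlast w) i b then unit else 0)"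
proof -
  define xs y where "xs = butlast w" and "y = last w"
  have w_eq: "w = xs @ [y]"
  proof -
    have "w \<noteq> []" using w(2) by auto
    from append_butlast_last_id[OF this] show ?thesis by (simp add: xs_def y_def)
  qed
  have aS: "a x \<in> S" for x unfolding a using constant_field_closed linear_field_closed by presburger
  have rS: "rn_prod (nalg.prod A) (map a w) \<in> S"
    using w(2) aS by (intro rn_prod_closed) auto
  have "embed (rn_prod (nalg.prod A) (map a w)) = foldr (\<lambda>x v. jacobian x *v v) (map a xs) (embed (a y))"
    unfolding w_eq map_append list.map using aS by (intro embed_rn_prod) auto
  also have "\<dots> = foldr (\<lambda>x v. jacobian (a x) *v v) xs (embed (a y))"
    by (simp only: foldr_map o_def)
  finally have eq: "embed (rn_prod (nalg.prod A) (map a w)) = \<dots>" .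
  have "embed (rn_prod (nalg.prod A) (map a w)) $ i = of_bool (y = t \<and> walk e xs i b)"
  proof (cases "y = t")
    case True
    then have "t \<notin> set xs" using w by (simp add: w_eq)
    then have "\<And>x. x \<in> set xs \<Longrightarrow> a x = linear_field (e x)" by (auto simp: a)
    from foldr_jacobian_linear_fields[of xs a e b i, OF this] show ?thesis
      using True unfolding eq by (simp add: a)
  next
    case False
    then have "t \<in> set xs" using w by (auto simp: w_eq)
    then show ?thesis
      unfolding eq using foldr_jacobian_constant_field[of t xs a b] False by (simp add: a)
  qed
  then have "h (rn_prod (nalg.prod A) (map a w) $ i) = h (if y = t \<and> walk e xs i b then unit else 0)"
    by (auto simp: embed_def h_unit h_0)
  then have "h (rn_prod (nalg.prod A) (map a w) $ i - (if y = t \<and> walk e xs i b then unit else 0)) = 0"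
    by (simp add: h_diff)
  moreover have "rn_prod (nalg.prod A) (map a w) $ i - (if y = t \<and> walk e xs i b then unit else 0) \<in> U"
    using rS unit_closed U_0 by (intro U_diff) auto
  ultimately have "rn_prod (nalg.prod A) (map a w) $ i - (if y = t \<and> walk e xs i b then unit else 0) = 0"
    by (rule h_eq_0[rotated])
  then show ?thesis
    unfolding xs_def[symmetric] y_def[symmetric] by (rule eq_iff_diff_eq_0[THEN iffD2])
qed

lemma leval_superset:
  assumes "finite B" "Poly_Mapping.keys f \<subseteq> B"
  shows "leval A a f $ i = (\<Sum>w\<in>B. pm_scale (Poly_Mapping.lookup f w) (rn_prod (nalg.prod A) (map a w) $ i))"
  unfolding leval_def sum_component scal_A
  using assms by (intro sum.mono_neutral_left) (auto simp: in_keys_iff)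

text \<open>
  Evaluating an identity at these fields gives linear relations between its coefficients, one for every
  choice of edges and end points.
\<close>

theorem sum_over_walks_eq_0:
  fixes e :: "nat \<Rightarrow> 'n \<times> 'n" and b :: 'n
  assumes f: "left_identity A f" and V: "finite V" "t \<in> V"
    and keys: "\<And>w. w \<in> Poly_Mapping.keys f \<Longrightarrow> distinct w \<and> set w = V"
  shows "(\<Sum>u\<in>{u \<in> permutations_of_set (V - {t}). walk e u i b}. Poly_Mapping.lookup f (u @ [t])) = 0"
proof -
  define a where "a = (\<lambda>x. if x = t then constant_field b else linear_field (e x))"
  let ?B = "permutations_of_set V"
  let ?c = "Poly_Mapping.lookup f"
  have aS: "\<forall>x. a x \<in> nalg.space A"
    unfolding a_def space_A using constant_field_closed linear_field_closed by presburger
  have fin: "finite ?B" by simp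
  have "0 = leval A a f $ i" using f aS by (simp add: left_identity_def)
  also have "\<dots> = (\<Sum>w\<in>?B. pm_scale (?c w) (rn_prod (nalg.prod A) (map a w) $ i))"
    using keys by (intro leval_superset fin) (auto simp: permutations_of_set_def)
  also have "\<dots> = (\<Sum>w\<in>?B. if last w = t \<and> walk e (butlast w) i b then pm_scale (?c w) unit else 0)"
    by (rule sum.cong[OF refl], subst rn_prod_fields[OF a_def])
      (use V in \<open>auto simp: permutations_of_set_def\<close>)
  also have "\<dots> = (\<Sum>w\<in>{w\<in>?B. last w = t \<and> walk e (butlast w) i b}. pm_scale (?c w) unit)"
    using fin by (rule sum.inter_filter[symmetric])
  also have "\<dots> = pm_scale (\<Sum>w\<in>{w\<in>?B. last w = t \<and> walk e (butlast w) i b}. ?c w) unit"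
    by (rule pm.scale_sum_left[symmetric])
  also have "(\<Sum>w\<in>{w\<in>?B. last w = t \<and> walk e (butlast w) i b}. ?c w) =
    (\<Sum>u\<in>{u \<in> permutations_of_set (V - {t}). walk e u i b}. ?c (u @ [t]))"
  proof (rule sum.reindex_bij_witness[of _ "\<lambda>u. u @ [t]" butlast])
    fix w assume "w \<in> {w\<in>?B. last w = t \<and> walk e (butlast w) i b}"
    then have w: "distinct w" "set w = V" "last w = t" "walk e (butlast w) i b"
      by (auto simp: permutations_of_set_def)
    then have eq: "butlast w @ [t] = w" using V by (metis append_butlast_last_id empty_iff empty_set)
    show "butlast w @ [t] = w" "?c (butlast w @ [t]) = ?c w" using eq by auto
    have "distinct (butlast w @ [t])" "set (butlast w @ [t]) = V" using eq w by simp_all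
    then have "distinct (butlast w)" "set (butlast w) = V - {t}" by auto
    then show "butlast w \<in> {u \<in> permutations_of_set (V - {t}). walk e u i b}"
      using w by (simp add: permutations_of_set_def)
  next
    fix u assume "u \<in> {u \<in> permutations_of_set (V - {t}). walk e u i b}"
    then show "u @ [t] \<in> {w\<in>?B. last w = t \<and> walk e (butlast w) i b}"
      using V by (auto simp: permutations_of_set_def)
  qed auto
  finally have "pm_scale (\<Sum>u\<in>{u \<in> permutations_of_set (V - {t}). walk e u i b}. ?c (u @ [t])) unit = 0"
    by (rule sym)
  moreover have "unit \<noteq> 0" using h_unit h_0 by auto
  ultimately show ?thesis unfolding pm.scale_eq_0_iff by blast
qed

end

section \<open>Edge systems with few walks\<close>

lemma walk_append: "walk e (xs @ ys) a b \<longleftrightarrow> (\<exists>c. walk e xs a c \<and> walk e ys c b)"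
  by (induction xs arbitrary: a) auto

lemma walk_map: "walk e (map g xs) a b \<longleftrightarrow> walk (\<lambda>x. e (g x)) xs a b"
  by (induction xs arbitrary: a) auto

lemma walk_cong: "(\<And>x. x \<in> set xs \<Longrightarrow> e x = e' x) \<Longrightarrow> walk e xs a b \<longleftrightarrow> walk e' xs a b"
  by (induction xs arbitrary: a) auto

lemma walk_inj_on:
  assumes "inj_on v B" "\<And>x. x \<in> set xs \<Longrightarrow> s x \<in> B \<and> t x \<in> B" "a \<in> B" "b \<in> B"
  shows "walk (\<lambda>x. (v (s x), v (t x))) xs (v a) (v b) \<longleftrightarrow> walk (\<lambda>x. (s x, t x)) xs a b"
  using assms(2,3)
  by (induction xs arbitrary: a) (use assms(1,4) in \<open>auto simp: inj_on_eq_iff\<close>)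

lemma walk_hd: "walk e xs a b \<Longrightarrow> xs \<noteq> [] \<Longrightarrow> fst (e (hd xs)) = a"
  by (cases xs) auto

lemma walk_distinct_successively:
  "walk e xs a b \<Longrightarrow> distinct xs \<Longrightarrow> successively (\<lambda>x y. x \<noteq> y \<and> snd (e x) = fst (e y)) xs"
  by (induction xs arbitrary: a rule: induct_list012) auto

lemma walk_upt:
  assumes "\<And>k. j \<le> k \<Longrightarrow> k < N \<Longrightarrow> e k = (pos k, pos (Suc k))" "j \<le> N"
  shows "walk e [j..<N] (pos j) (pos N)"
  using assms(2,1)
  by (induction j rule: inc_induct) (auto simp: upt_conv_Cons)

lemma increasing_list_unique:
  fixes xs :: "nat list"
  assumes "successively (<) xs" "successively (<) ys" "set xs = set ys"
  shows "xs = ys"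
proof -
  have "sorted_wrt (<) xs" "sorted_wrt (<) ys"
    using assms(1,2) by (auto simp: successively_iff_sorted_wrt_strong)
  then show ?thesis using assms(3) strict_sorted_equal by blast
qed

lemma successively_upt: "successively (<) [i..<j]"
  by (simp add: successively_iff_sorted_wrt_strong)

lemma increasing_eq_upt:
  assumes "successively (<) ks" "set ks = {..<N}"
  shows "ks = [0..<N]"
  by (rule increasing_list_unique[OF assms(1) successively_upt])
    (simp only: assms(2) set_upt atLeast0LessThan)

lemma successively_weaken:
  assumes "successively P xs"
    and "\<And>x y. x \<in> set (butlast xs) \<Longrightarrow> y \<in> set (tl xs) \<Longrightarrow> P x y \<Longrightarrow> Q x y"
  shows "successively Q xs"
  using assms
proof (induction xs rule: induct_list012)
  case (3 x y zs)
  have "successively Q (y # zs)"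
  proof (rule 3(2))
    fix a b assume "a \<in> set (butlast (y # zs))" "b \<in> set (tl (y # zs))" "P a b"
    then show "Q a b" using 3(4)[of a b] by auto
  qed (use 3(3) in simp)
  then show ?case using 3(3,4) by simp
qed auto

text \<open>
  The staircase \<open>E\<^sub>0\<^sub>0, E\<^sub>0\<^sub>1, E\<^sub>1\<^sub>1, E\<^sub>1\<^sub>2, \<dots>\<close>, with edge \<open>k\<close> leading from \<open>k div 2\<close> to \<open>(k + 1) div 2\<close>. A walk
  cannot return to a smaller vertex and must use the loop at a vertex before leaving it, so the edges
  only fit together in increasing order. With \<open>n\<close> vertices there is room for \<open>2n - 1\<close> edges.
\<close>

lemma staircase_walk_iff:
  assumes ks: "ks \<in> permutations_of_set {..<N}"
  shows "walk (\<lambda>k. (k div 2, (k + 1) div 2)) ks 0 (N div 2) \<longleftrightarrow> ks = [0..<N]"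
proof
  assume w: "walk (\<lambda>k. (k div 2, (k + 1) div 2)) ks 0 (N div 2)"
  have "successively (\<lambda>x y. x \<noteq> y \<and> (x + 1) div 2 = y div 2) ks"
    using walk_distinct_successively[OF w] ks by (simp add: permutations_of_set_def)
  then have "successively (<) ks" by (rule successively_mono) auto
  then show "ks = [0..<N]"
    by (rule increasing_eq_upt) (use ks in \<open>simp add: permutations_of_set_def\<close>)
next
  assume "ks = [0..<N]"
  then show "walk (\<lambda>k. (k div 2, (k + 1) div 2)) ks 0 (N div 2)"
    using walk_upt[of 0 N "\<lambda>k. (k div 2, (k + 1) div 2)" "\<lambda>k. k div 2"] by simp
qed

text \<open>
  The staircase with a second loop at the vertex \<open>0\<close>. The truncated \<open>k - 1\<close> makes the edges \<open>0\<close> and \<open>1\<close>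
  both loops at \<open>0\<close>, and their order is the only freedom.
\<close>

lemma double_loop_walk_iff:
  assumes ks: "ks \<in> permutations_of_set {..<N}" and N: "N \<ge> 2"
  shows "walk (\<lambda>k. ((k - 1) div 2, k div 2)) ks 0 ((N - 1) div 2) \<longleftrightarrow>
    ks = [0..<N] \<or> ks = 1 # 0 # [2..<N]"
proof
  assume w: "walk (\<lambda>k. ((k - 1) div 2, k div 2)) ks 0 ((N - 1) div 2)"
  have dist: "distinct ks" and set: "set ks = {..<N}" using ks by (auto simp: permutations_of_set_def)
  have R: "successively (\<lambda>x y. x < y \<or> x = 1 \<and> y = 0) ks"
    by (rule successively_mono[OF walk_distinct_successively[OF w dist]]) auto
  obtain us vs where split: "ks = us @ 0 # vs"
    using set N split_list[of 0 ks] by auto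
  have "successively (\<lambda>x y. x < y \<or> x = 1 \<and> y = 0) (0 # vs)"
    using R by (simp add: split successively_append_iff)
  moreover have "0 \<notin> set vs" using dist by (simp add: split)
  ultimately have incr: "successively (<) (0 # vs)"
    by (elim successively_weaken) auto
  show "ks = [0..<N] \<or> ks = 1 # 0 # [2..<N]"
  proof (cases us rule: rev_cases)
    case Nil
    then show ?thesis using increasing_eq_upt[OF _ set] incr split by simp
  next
    case (snoc us' z)
    then have z: "z = 1" using R by (auto simp: split successively_append_iff)
    have "successively (\<lambda>x y. x < y \<or> x = 1 \<and> y = 0) us" using R by (simp add: split successively_append_iff)
    moreover have "0 \<notin> set us" using dist by (auto simp: split)
    ultimately have "successively (<) us"
      by (elim successively_weaken) (metis list.set_sel(2) tl_Nil)
    then have "sorted_wrt (<) us" by (auto simp: successively_iff_sorted_wrt_strong)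
    then have "us' = []" using \<open>0 \<notin> set us\<close> by (cases us') (auto simp: snoc z sorted_wrt_append)
    then have ks: "ks = 1 # 0 # vs" by (simp add: split snoc z)
    have "0 # vs = 0 # [2..<N]"
    proof (rule increasing_list_unique[OF incr])
      show "successively (<) (0 # [2..<N])"
        using successively_upt[of 2 N] by (cases "2 < N") (auto simp: upt_conv_Cons)
      have "set (0 # vs) = {..<N} - {1}" using set dist unfolding ks by auto
      also have "\<dots> = set (0 # [2..<N])" using N by auto
      finally show "set (0 # vs) = set (0 # [2..<N])" .
    qed
    then show ?thesis using ks by simp
  qed
next
  have "walk (\<lambda>k. ((k - 1) div 2, k div 2)) [j..<N] ((j - 1) div 2) ((N - 1) div 2)" if "j \<le> N" for j
    using walk_upt[of j N "\<lambda>k. ((k - 1) div 2, k div 2)" "\<lambda>k. (k - 1) div 2"] that by simp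
  from this[of 0] this[of 2]
  show "ks = [0..<N] \<or> ks = 1 # 0 # [2..<N] \<Longrightarrow> walk (\<lambda>k. ((k - 1) div 2, k div 2)) ks 0 ((N - 1) div 2)"
    using N by auto
qed

text \<open>
  The staircase with \<open>2n\<close> edges closed up to a circle by an edge from the last vertex to \<open>0\<close>. A closed
  walk from \<open>0\<close> can start with the loop at \<open>0\<close> or keep it for the end.
\<close>

lemma closed_walk_iff:
  assumes ks: "ks \<in> permutations_of_set {..<2 * n}" and n: "n > 0"
  shows "walk (\<lambda>k. (k div 2, ((k + 1) div 2) mod n)) ks 0 0 \<longleftrightarrow>
    ks = [0..<2 * n] \<or> ks = [1..<2 * n] @ [0]"
proof
  let ?N = "2 * n"
  assume w: "walk (\<lambda>k. (k div 2, ((k + 1) div 2) mod n)) ks 0 0"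
  have dist: "distinct ks" and set: "set ks = {..<?N}" using ks by (auto simp: permutations_of_set_def)
  \<comment> \<open>The successor relation of the walk increases except after the closing edge \<open>2n - 1\<close>, so the list
    consists of two increasing runs.\<close>
  define R where "R x y \<longleftrightarrow> x \<noteq> y \<and> ((x + 1) div 2) mod n = y div 2" for x y :: nat
  have R: "successively R ks"
    using walk_distinct_successively[OF w dist] unfolding R_def by simp
  have R_less: "x < y" if "R x y" "x < ?N" "x \<noteq> ?N - 1" for x y
  proof -
    have "(x + 1) div 2 < n" using that by linarith
    then show ?thesis using that(1) unfolding R_def by auto
  qed
  have R_0: "y = 1" if "R 0 y" for y using that by (auto simp: R_def)
  have R_last: "y \<in> {0, 1}" if "R (?N - 1) y" for y
    using that n by (auto simp: R_def)
  obtain us vs where split: "ks = us @ (?N - 1) # vs"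
    using set n split_list[of "?N - 1" ks] by auto
  have R1: "successively R (us @ [?N - 1])" and R2: "successively R vs"
    using R by (auto simp: split successively_append_iff successively_Cons)
  have ne: "?N - 1 \<notin> set us" "?N - 1 \<notin> set vs" using dist by (auto simp: split)
  have sub: "x < ?N" if "x \<in> set us \<union> set vs" for x using set that by (auto simp: split)
  have incr: "successively (<) (us @ [?N - 1])"
    using R1
  proof (rule successively_weaken)
    fix x y assume "x \<in> set (butlast (us @ [?N - 1]))" "R x y"
    then show "x < y" using R_less[of x y] sub[of x] ne by (auto simp: butlast_append)
  qed
  have hd: "hd (us @ [?N - 1]) \<in> {0, 1}"
    using walk_hd[OF w] by (cases us) (auto simp: split)
  show "ks = [0..<?N] \<or> ks = [1..<?N] @ [0]"
  proof (cases vs)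
    case Nil
    then show ?thesis using increasing_eq_upt[OF _ set] incr split by simp
  next
    case (Cons v vs')
    have "R (?N - 1) v" using R by (auto simp: split Cons successively_append_iff)
    then have "v = 0 \<or> v = 1" using R_last by blast
    then show ?thesis
    proof
      assume v: "v = 0"
      then have h1: "hd (us @ [?N - 1]) = 1" using hd dist by (cases us) (auto simp: split Cons)
      have "vs' = []"
      proof (rule ccontr)
        assume "vs' \<noteq> []"
        then have "R 0 (hd vs')" using R2 by (cases vs') (auto simp: Cons v)
        then have "hd vs' = 1" by (rule R_0)
        then have "1 \<in> set vs'" using \<open>vs' \<noteq> []\<close> hd_in_set by metis
        moreover have "1 \<in> set (us @ [?N - 1])" using h1 by (metis append_is_Nil_conv hd_in_set list.distinct(1))
        ultimately show False using dist by (auto simp: split Cons)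
      qed
      then have ks: "ks = (us @ [?N - 1]) @ [0]" by (simp add: split Cons v)
      have "us @ [?N - 1] = [1..<?N]"
      proof (rule increasing_list_unique[OF incr successively_upt])
        have "set (us @ [?N - 1]) \<union> {0} = set ks" by (simp only: ks set_append list.set)
        moreover have "0 \<notin> set (us @ [?N - 1])" using dist by (simp only: ks distinct_append) auto
        ultimately have "set (us @ [?N - 1]) = {..<?N} - {0}" unfolding set by blast
        also have "\<dots> = set [1..<?N]" by auto
        finally show "set (us @ [?N - 1]) = set [1..<?N]" .
      qed
      then show ?thesis using ks by simp
    next
      assume v: "v = 1"
      then have "hd (us @ [?N - 1]) = 0" using hd dist by (cases us) (auto simp: split Cons)
      then obtain us' where us: "us = 0 # us'" using n by (cases us) auto
      have "R 0 (hd (us' @ [?N - 1]))" using R1 by (cases us') (auto simp: us)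
      then have "hd (us' @ [?N - 1]) = 1" by (rule R_0)
      then have "1 \<in> set (us' @ [?N - 1])" by (metis append_is_Nil_conv hd_in_set list.distinct(1))
      then have False using dist by (auto simp: split Cons us v)
      then show ?thesis ..
    qed
  qed
next
  have "walk (\<lambda>k. (k div 2, ((k + 1) div 2) mod n)) [j..<2 * n] ((j div 2) mod n) 0" if "j \<le> 2 * n" for j
    using walk_upt[of j "2 * n" "\<lambda>k. (k div 2, ((k + 1) div 2) mod n)" "\<lambda>k. (k div 2) mod n"] that by simp
  from this[of 0] this[of 1] n
  show "ks = [0..<2 * n] \<or> ks = [1..<2 * n] @ [0] \<Longrightarrow> walk (\<lambda>k. (k div 2, ((k + 1) div 2) mod n)) ks 0 0"
    by (auto simp: walk_append)
qed

section \<open>Alternating functions on words\<close>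

text \<open>
  A function on the orderings of \<open>W\<close> that changes sign when the first two letters are exchanged and when
  the first letter is moved to the end is alternating, because one transposition of adjacent letters
  and the long cycle generate the symmetric group. For \<open>2n\<close> letters the long cycle is odd.
\<close>

context
  fixes c :: "'a list \<Rightarrow> 'k::comm_ring_1" and W :: "'a set"
  assumes swap_first: "\<And>x y r. x # y # r \<in> permutations_of_set W \<Longrightarrow> c (x # y # r) = - c (y # x # r)"
    and rotate_once: "\<And>x r. x # r \<in> permutations_of_set W \<Longrightarrow> c (x # r) = - c (r @ [x])"
begin

lemma rotate_prefix:
  "us @ vs \<in> permutations_of_set W \<Longrightarrow> c (us @ vs) = (-1) ^ length us * c (vs @ us)"
proof (induction us arbitrary: vs)
  case (Cons x us)
  have "c ((x # us) @ vs) = - c (us @ vs @ [x])"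
    using rotate_once[of x "us @ vs"] Cons.prems by simp
  also have "c (us @ vs @ [x]) = (-1) ^ length us * c ((vs @ [x]) @ us)"
    by (rule Cons.IH) (use Cons.prems in \<open>auto simp: permutations_of_set_def\<close>)
  finally show ?case by simp
qed simp

text \<open>
  Rotate the two letters to the front, exchange them there and rotate back; the two rotations have the
  same sign.
\<close>

lemma swap_adjacent:
  assumes "us @ x # y # vs \<in> permutations_of_set W"
  shows "c (us @ x # y # vs) = - c (us @ y # x # vs)"
proof -
  have "us @ y # x # vs \<in> permutations_of_set W" "x # y # (vs @ us) \<in> permutations_of_set W"
    using assms by (auto simp: permutations_of_set_def)
  then show ?thesis
    using rotate_prefix[OF assms] rotate_prefix[of us "y # x # vs"] swap_first[of x y "vs @ us"]
    by simp
qed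

lemma move_right:
  "us @ x # vs @ ws \<in> permutations_of_set W \<Longrightarrow>
    c (us @ x # vs @ ws) = (-1) ^ length vs * c (us @ vs @ x # ws)"
proof (induction vs arbitrary: us)
  case (Cons y vs)
  have "c (us @ x # y # vs @ ws) = - c ((us @ [y]) @ x # vs @ ws)"
    using swap_adjacent[of us x y "vs @ ws"] Cons.prems by simp
  also have "c ((us @ [y]) @ x # vs @ ws) = (-1) ^ length vs * c ((us @ [y]) @ vs @ x # ws)"
    by (rule Cons.IH) (use Cons.prems in \<open>auto simp: permutations_of_set_def\<close>)
  finally show ?case by simp
qed simp

lemma swap_any:
  assumes "us @ x # vs @ y # ws \<in> permutations_of_set W"
  shows "c (us @ x # vs @ y # ws) = - c (us @ y # vs @ x # ws)"
proof -
  have mem: "us @ y # vs @ x # ws \<in> permutations_of_set W" "(us @ vs) @ x # y # ws \<in> permutations_of_set W"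
    using assms by (auto simp: permutations_of_set_def)
  show ?thesis
    using move_right[of us x vs "y # ws"] move_right[of us y vs "x # ws"] assms mem
      swap_adjacent[of "us @ vs" x y ws] by simp
qed

text \<open>
  Exchanging two letters by renaming, rather than by position, is the form that fits an induction over
  permutations.
\<close>

lemma transpose_letters:
  assumes u: "u \<in> permutations_of_set W" and xy: "x \<in> W" "y \<in> W" "x \<noteq> y"
  shows "c (map (Transposition.transpose x y) u) = - c u"
proof -
  have *: "c (map (Transposition.transpose x y) (us @ x # vs @ y # ws)) = - c (us @ x # vs @ y # ws)"
    if "us @ x # vs @ y # ws \<in> permutations_of_set W" for us vs ws x y
  proof -
    have "map (Transposition.transpose x y) us = us" "map (Transposition.transpose x y) vs = vs"
      "map (Transposition.transpose x y) ws = ws"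
      using that by (auto simp: permutations_of_set_def Transposition.transpose_def intro!: map_idI)
    then show ?thesis using swap_any[OF that] by (simp add: Transposition.transpose_def)
  qed
  have "x \<in> set u" "y \<in> set u" using u xy by (auto simp: permutations_of_set_def)
  then obtain us r where r: "u = us @ x # r" by (meson split_list)
  have "y \<in> set us \<or> y \<in> set r" using \<open>y \<in> set u\<close> xy by (auto simp: r)
  then show ?thesis
  proof
    assume "y \<in> set r"
    then obtain vs ws where "r = vs @ y # ws" by (meson split_list)
    then show ?thesis using *[of us x vs y ws] u by (simp add: r)
  next
    assume "y \<in> set us"
    then obtain vs ws where "us = vs @ y # ws" by (meson split_list)
    then show ?thesis using *[of vs y ws x r] u by (simp add: r transpose_commute)
  qed
qed

lemma alternating_permute:
  assumes \<sigma>: "\<sigma> permutes I" "finite I" and v: "inj_on v I" "v ` I = W"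
    and ks: "ks \<in> permutations_of_set I"
  shows "c (map (\<lambda>i. v (\<sigma> i)) ks) = of_int (sign \<sigma>) * c (map v ks)"
  using \<sigma>
proof (induction rule: permutes_induct)
  case (swap i j \<sigma>)
  let ?t = "Transposition.transpose i j"
  have in_I: "\<sigma> k \<in> I" if "k \<in> set ks" for k
    using that ks permutes_in_image[OF swap(4)] by (simp add: permutations_of_set_def)
  have vt: "v (?t k) = Transposition.transpose (v i) (v j) (v k)" if "k \<in> I" for k
    using that swap(1,2) v(1) by (auto simp: Transposition.transpose_def inj_on_eq_iff)
  have mem: "map (\<lambda>i. v (\<sigma> i)) ks \<in> permutations_of_set W"
  proof -
    have "set (map (\<lambda>i. v (\<sigma> i)) ks) = v ` (\<sigma> ` I)" using ks by (auto simp: permutations_of_set_def)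
    moreover have "inj_on (\<lambda>i. v (\<sigma> i)) I"
      using comp_inj_on[OF permutes_inj_on[OF swap(4)], of v I] v(1) permutes_image[OF swap(4)]
      by (simp add: o_def)
    ultimately show ?thesis
      using ks v(2) permutes_image[OF swap(4)] by (simp add: permutations_of_set_def distinct_map)
  qed
  have "map (\<lambda>k. v ((?t \<circ> \<sigma>) k)) ks = map (Transposition.transpose (v i) (v j)) (map (\<lambda>i. v (\<sigma> i)) ks)"
    using vt in_I by simp
  also have "c \<dots> = - c (map (\<lambda>i. v (\<sigma> i)) ks)"
    by (rule transpose_letters[OF mem]) (use swap v in \<open>auto simp: inj_on_eq_iff\<close>)
  also have "\<dots> = of_int (sign (?t \<circ> \<sigma>)) * c (map v ks)"
  proof -
    have "permutation \<sigma>" using swap(4) \<open>finite I\<close> by (rule permutes_imp_permutation[rotated])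
    then have "sign (?t \<circ> \<sigma>) = - sign \<sigma>"
      using swap(3) by (simp add: sign_compose permutation_swap_id sign_swap_id)
    then show ?thesis using swap(5) by simp
  qed
  finally show ?case .
qed simp

end

section \<open>Multilinear identities\<close>

lemma sum_single_lookup:
  assumes "finite B" "Poly_Mapping.keys f \<subseteq> B"
  shows "(\<Sum>w\<in>B. Poly_Mapping.single w (Poly_Mapping.lookup f w)) = f"
proof (rule poly_mapping_eqI)
  fix k
  have "Poly_Mapping.lookup (\<Sum>w\<in>B. Poly_Mapping.single w (Poly_Mapping.lookup f w)) k =
    (\<Sum>w\<in>B. if w = k then Poly_Mapping.lookup f w else 0)"
    by (simp add: lookup_sum lookup_single when_def)
  also have "\<dots> = Poly_Mapping.lookup f k"
    using assms by (auto simp: in_keys_iff)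
  finally show "Poly_Mapping.lookup (\<Sum>w\<in>B. Poly_Mapping.single w (Poly_Mapping.lookup f w)) k =
    Poly_Mapping.lookup f k" .
qed

lemma pm_scale_single: "pm_scale c (Poly_Mapping.single w x) = Poly_Mapping.single w (c * x)"
  by (rule poly_mapping_eqI) (simp add: lookup_pm_scale lookup_single when_def)

text \<open>
  The cyclic rearrangement of arguments in \<open>\<tau>\<^sub>l s\<^sub>2\<^sub>n\<close>.
\<close>

definition last_to_front :: "(nat \<Rightarrow> nat) \<Rightarrow> nat \<Rightarrow> nat \<Rightarrow> nat"
  where "last_to_front v l = (\<lambda>i. if i = 0 then v l else if i \<le> l then v (i - 1) else v i)"

definition std_word :: "nat \<Rightarrow> (nat \<Rightarrow> nat) \<Rightarrow> nat \<Rightarrow> (nat \<Rightarrow> nat) \<Rightarrow> nat list"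
  where "std_word n v l \<sigma> = map (\<lambda>i. last_to_front v l (\<sigma> i)) [1..<2 * n + 1] @ [v l]"

lemma tau_std_eq: "tau_std n l v =
  (\<Sum>\<sigma> | \<sigma> permutes {1..2 * n}. Poly_Mapping.single (std_word n v l \<sigma>) (of_int (sign \<sigma>)))"
  by (simp add: tau_std_def std_poly_def std_word_def last_to_front_def)

lemma map_std_word: "map \<phi> (std_word n v l \<sigma>) = std_word n (\<phi> \<circ> v) l \<sigma>"
  by (simp add: std_word_def last_to_front_def)

lemma last_to_front_bij:
  assumes v: "bij_betw v {..2 * n} V" and l: "l \<le> 2 * n"
  shows "inj_on (last_to_front v l) {1..2 * n}" "last_to_front v l ` {1..2 * n} = V - {v l}"
proof -
  define g where "g i = (if i \<le> l then i - 1 else i)" for i :: nat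
  have eq: "last_to_front v l i = v (g i)" if "i \<in> {1..2 * n}" for i
    using that by (simp add: last_to_front_def g_def)
  have g: "bij_betw g {1..2 * n} ({..2 * n} - {l})"
    by (rule bij_betw_byWitness[where f' = "\<lambda>j. if j < l then j + 1 else j"])
      (use l in \<open>auto simp: g_def\<close>)
  have "bij_betw v ({..2 * n} - {l}) (V - {v l})"
    using v l by (auto simp: bij_betw_def inj_on_def)
  from bij_betw_trans[OF g this] have "bij_betw (last_to_front v l) {1..2 * n} (V - {v l})"
    using eq by (subst bij_betw_cong[of _ _ "v \<circ> g"]) auto
  then show "inj_on (last_to_front v l) {1..2 * n}" "last_to_front v l ` {1..2 * n} = V - {v l}"
    by (auto simp: bij_betw_def)
qed

lemma upt_permutation: "[1..<2 * n + 1] \<in> permutations_of_set {1..2 * n}"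
  by (auto simp: permutations_of_set_def)

lemma std_word_mem:
  assumes v: "bij_betw v {..2 * n} V" and l: "l \<le> 2 * n" and \<sigma>: "\<sigma> permutes {1..2 * n}"
  shows "map (\<lambda>i. last_to_front v l (\<sigma> i)) [1..<2 * n + 1] \<in> permutations_of_set (V - {v l})"
proof -
  note b = last_to_front_bij[OF v l]
  have s: "set [1..<2 * n + 1] = {1..2 * n}" by auto
  have "inj_on (last_to_front v l \<circ> \<sigma>) {1..2 * n}"
    using permutes_inj_on[OF \<sigma>] permutes_image[OF \<sigma>] b(1) by (intro comp_inj_on) auto
  moreover have "(last_to_front v l \<circ> \<sigma>) ` {1..2 * n} = V - {v l}"
    by (simp only: image_comp[symmetric] permutes_image[OF \<sigma>] b(2))
  ultimately show ?thesis
    unfolding permutations_of_set_def mem_Collect_eq distinct_map set_map s by (simp add: o_def del: upt_Suc)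
qed

text \<open>
  Every ordering of \<open>2n + 1\<close> letters is determined by its last letter and a permutation of the others.
  Injectivity suffices, since \<open>(2n + 1) \<cdot> (2n)! = (2n + 1)!\<close>.
\<close>

lemma bij_betw_std_word:
  assumes v: "bij_betw v {..2 * n} V"
  shows "bij_betw (\<lambda>(l, \<sigma>). std_word n v l \<sigma>) ({..2 * n} \<times> {\<sigma>. \<sigma> permutes {1..2 * n}}) (permutations_of_set V)"
proof -
  let ?B = "{..2 * n} \<times> {\<sigma>. \<sigma> permutes {1..2 * n}}"
  let ?f = "\<lambda>(l, \<sigma>). std_word n v l \<sigma>"
  have finV: "finite V" using v bij_betw_finite by blast
  have cardV: "card V = 2 * n + 1" using bij_betw_same_card[OF v] by simp
  have inj: "inj_on ?f ?B"
  proof (rule inj_onI, clarsimp)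
    fix l \<sigma> l' \<sigma>'
    assume l: "l \<le> 2 * n" "l' \<le> 2 * n" and \<sigma>: "\<sigma> permutes {Suc 0..2 * n}" "\<sigma>' permutes {Suc 0..2 * n}"
      and eq: "std_word n v l \<sigma> = std_word n v l' \<sigma>'"
    then have "v l = v l'" by (simp add: std_word_def)
    then have ll: "l = l'" using v l by (auto simp: bij_betw_def inj_on_def)
    have "\<sigma> i = \<sigma>' i" for i
    proof (cases "i \<in> {1..2 * n}")
      case True
      then have "i \<in> set [1..<2 * n + 1]"
        unfolding set_upt atLeastLessThan_iff atLeastAtMost_iff by linarith
      then have "last_to_front v l (\<sigma> i) = last_to_front v l (\<sigma>' i)"
        using eq unfolding std_word_def ll by (simp del: upt_Suc)
      moreover have "\<sigma> i \<in> {1..2 * n}" "\<sigma>' i \<in> {1..2 * n}"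
        using permutes_in_image[OF \<sigma>(1), of i] permutes_in_image[OF \<sigma>(2), of i] True by auto
      ultimately show ?thesis using last_to_front_bij(1)[OF v l(1)] by (auto dest: inj_onD)
    next
      case False
      then show ?thesis using permutes_not_in[OF \<sigma>(1), of i] permutes_not_in[OF \<sigma>(2), of i] by simp
    qed
    then show "l = l' \<and> \<sigma> = \<sigma>'" using ll by auto
  qed
  have "?f ` ?B \<subseteq> permutations_of_set V"
  proof clarsimp
    fix l \<sigma> assume l: "l \<le> 2 * n" and \<sigma>: "\<sigma> permutes {Suc 0..2 * n}"
    then have "map (\<lambda>i. last_to_front v l (\<sigma> i)) [1..<2 * n + 1] \<in> permutations_of_set (V - {v l})"
      using std_word_mem[OF v l] by simp
    moreover have "v l \<in> V" using v l by (auto simp: bij_betw_def)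
    ultimately show "std_word n v l \<sigma> \<in> permutations_of_set V"
      unfolding std_word_def permutations_of_set_def by auto
  qed
  moreover have "card (?f ` ?B) = card (permutations_of_set V)"
    unfolding card_image[OF inj] using finV cardV
    by (simp add: card_cartesian_product card_permutations)
  ultimately have "?f ` ?B = permutations_of_set V" by (intro card_subset_eq) (simp_all add: finV)
  with inj show ?thesis by (simp add: bij_betw_def)
qed

context witt_embedding
begin

text \<open>
  The relations of \<open>sum_over_walks_eq_0\<close> with variables addressed by their positions in a reference
  ordering \<open>u\<close>, and vertices by natural numbers below \<open>n\<close>.
\<close>

lemma coefficient_relation:
  fixes s r :: "nat \<Rightarrow> nat"
  assumes f: "left_identity A f" and V: "finite V" "t \<in> V"
    and keys: "\<And>w. w \<in> Poly_Mapping.keys f \<Longrightarrow> distinct w \<and> set w = V"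
    and u: "u \<in> permutations_of_set (V - {t})"
    and bounds: "\<And>k. k < length u \<Longrightarrow> s k < CARD('n) \<and> r k < CARD('n)" "i < CARD('n)" "b < CARD('n)"
  shows "(\<Sum>ks\<in>{ks \<in> permutations_of_set {..<length u}. walk (\<lambda>k. (s k, r k)) ks i b}.
    Poly_Mapping.lookup f (map ((!) u) ks @ [t])) = 0"
proof -
  obtain v :: "nat \<Rightarrow> 'n" where v: "bij_betw v {0..<CARD('n)} UNIV"
    using ex_bij_betw_nat_finite[of "UNIV :: 'n set"] by auto
  then have v_inj: "inj_on v {..<CARD('n)}" by (simp add: bij_betw_def lessThan_atLeast0)
  have u_bij: "bij_betw ((!) u) {..<length u} (V - {t})"
    using u bij_betw_nth[of u "{..<length u}" "V - {t}"] by (auto simp: permutations_of_set_def)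
  define idx where "idx = the_inv_into {..<length u} ((!) u)"
  have idx1: "idx (u ! k) = k" if "k < length u" for k
    unfolding idx_def using u_bij that by (auto simp: bij_betw_def the_inv_into_f_f)
  have idx2: "u ! idx x = x" "idx x < length u" if "x \<in> V - {t}" for x
  proof -
    obtain k where "k < length u" "x = u ! k"
      using \<open>x \<in> V - {t}\<close> u_bij unfolding bij_betw_def by (metis imageE lessThan_iff)
    then show "u ! idx x = x" "idx x < length u" using idx1 by simp_all
  qed
  define e where "e x = (v (s (idx x)), v (r (idx x)))" for x
  have "0 = (\<Sum>w\<in>{w \<in> permutations_of_set (V - {t}). walk e w (v i) (v b)}. Poly_Mapping.lookup f (w @ [t]))"
    using sum_over_walks_eq_0[OF f V keys] by simp
  also have "\<dots> = (\<Sum>ks\<in>{ks \<in> permutations_of_set {..<length u}. walk (\<lambda>k. (s k, r k)) ks i b}.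
    Poly_Mapping.lookup f (map ((!) u) ks @ [t]))"
  proof (rule sum.reindex_bij_witness[of _ "map ((!) u)" "map idx"])
    have walk_iff: "walk e (map ((!) u) ks) (v i) (v b) \<longleftrightarrow> walk (\<lambda>k. (s k, r k)) ks i b"
      if "ks \<in> permutations_of_set {..<length u}" for ks
    proof -
      have lt: "k < length u" if "k \<in> set ks" for k
        using that \<open>ks \<in> _\<close> by (auto simp: permutations_of_set_def)
      have "walk e (map ((!) u) ks) (v i) (v b) \<longleftrightarrow> walk (\<lambda>k. (v (s k), v (r k))) ks (v i) (v b)"
        unfolding walk_map by (rule walk_cong) (simp add: e_def idx1 lt)
      also have "\<dots> \<longleftrightarrow> walk (\<lambda>k. (s k, r k)) ks i b"
        by (rule walk_inj_on[OF v_inj]) (use bounds lt in auto)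
      finally show ?thesis .
    qed
    fix w assume w: "w \<in> {w \<in> permutations_of_set (V - {t}). walk e w (v i) (v b)}"
    then have w': "set w = V - {t}" "distinct w" by (auto simp: permutations_of_set_def)
    show eq: "map ((!) u) (map idx w) = w"
      unfolding map_map by (rule map_idI) (use w' idx2 in auto)
    show "Poly_Mapping.lookup f (map ((!) u) (map idx w) @ [t]) = Poly_Mapping.lookup f (w @ [t])"
      using eq by simp
    have "inj_on idx (V - {t})" using idx2 by (metis inj_onI)
    moreover have "idx ` (V - {t}) = {..<length u}"
      using idx1 idx2 u_bij by (auto simp: bij_betw_def image_iff) (metis imageI lessThan_iff)
    ultimately have mem: "map idx w \<in> permutations_of_set {..<length u}"
      using w' by (simp add: permutations_of_set_def distinct_map)
    have "walk (\<lambda>k. (s k, r k)) (map idx w) i b"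
      using walk_iff[OF mem] w unfolding eq by blast
    with mem show "map idx w \<in> {ks \<in> permutations_of_set {..<length u}. walk (\<lambda>k. (s k, r k)) ks i b}"
      by blast
  next
    fix ks assume ks: "ks \<in> {ks \<in> permutations_of_set {..<length u}. walk (\<lambda>k. (s k, r k)) ks i b}"
    then have ks': "set ks = {..<length u}" "distinct ks" by (auto simp: permutations_of_set_def)
    show "map idx (map ((!) u) ks) = ks"
      unfolding map_map by (rule map_idI) (use ks' idx1 in auto)
    have "map ((!) u) ks \<in> permutations_of_set (V - {t})"
      using u_bij ks' by (simp add: permutations_of_set_def distinct_map bij_betw_def)
    moreover have "walk e (map ((!) u) ks) (v i) (v b)"
    proof -
      have "k < length u" if "k \<in> set ks" for k using that ks' by auto
      then have "walk e (map ((!) u) ks) (v i) (v b) \<longleftrightarrow> walk (\<lambda>k. (v (s k), v (r k))) ks (v i) (v b)"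
        unfolding walk_map by (intro walk_cong) (simp add: e_def idx1)
      also have "\<dots> \<longleftrightarrow> walk (\<lambda>k. (s k, r k)) ks i b"
        by (rule walk_inj_on[OF v_inj]) (use bounds ks' in auto)
      finally show ?thesis using ks by simp
    qed
    ultimately show "map ((!) u) ks \<in> {w \<in> permutations_of_set (V - {t}). walk e w (v i) (v b)}" by simp
  qed
  finally show ?thesis by simp
qed

context
  fixes f :: "'k lpoly" and V :: "nat set"
  assumes f: "left_identity A f" and V: "finite V"
    and keys: "\<And>w. w \<in> Poly_Mapping.keys f \<Longrightarrow> distinct w \<and> set w = V"
begin

text \<open>
  With fewer than \<open>2n\<close> edges, the edges of a word can be placed on the staircase, where no other
  ordering forms a walk.
\<close>

lemma short_coefficient_eq_0:
  assumes t: "t \<in> V" and u: "u \<in> permutations_of_set (V - {t})" and len: "length u < 2 * CARD('n)"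
  shows "Poly_Mapping.lookup f (u @ [t]) = 0"
proof -
  let ?W = "{ks \<in> permutations_of_set {..<length u}. walk (\<lambda>k. (k div 2, (k + 1) div 2)) ks 0 (length u div 2)}"
  have "(\<Sum>ks\<in>?W. Poly_Mapping.lookup f (map ((!) u) ks @ [t])) = 0"
    by (rule coefficient_relation[OF f V t keys u]) (use len in auto)
  moreover have "[0..<length u] \<in> permutations_of_set {..<length u}"
    by (auto simp: permutations_of_set_def)
  then have "?W = {[0..<length u]}" using staircase_walk_iff by auto
  ultimately show ?thesis by (simp add: map_nth)
qed

text \<open>
  With \<open>2n\<close> edges two orderings remain, and their coefficients cancel.
\<close>

lemma coefficient_swap_first:
  assumes t: "t \<in> V" and u: "x # y # r \<in> permutations_of_set (V - {t})"
    and len: "length (x # y # r) = 2 * CARD('n)"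
  shows "Poly_Mapping.lookup f ((x # y # r) @ [t]) = - Poly_Mapping.lookup f ((y # x # r) @ [t])"
proof -
  let ?u = "x # y # r"
  define N where "N = 2 * CARD('n)"
  have len: "length ?u = N" using len by (simp only: N_def)
  let ?W = "{ks \<in> permutations_of_set {..<N}. walk (\<lambda>k. ((k - 1) div 2, k div 2)) ks 0 ((N - 1) div 2)}"
  have "(\<Sum>ks\<in>{ks \<in> permutations_of_set {..<length ?u}. walk (\<lambda>k. ((k - 1) div 2, k div 2)) ks 0 ((N - 1) div 2)}.
      Poly_Mapping.lookup f (map ((!) ?u) ks @ [t])) = 0"
    by (rule coefficient_relation[OF f V t keys u]) (use len in \<open>auto simp: N_def\<close>)
  then have sum: "(\<Sum>ks\<in>?W. Poly_Mapping.lookup f (map ((!) ?u) ks @ [t])) = 0"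
    unfolding len .
  have N2: "N \<ge> 2" using len by simp
  have mem: "[0..<N] \<in> permutations_of_set {..<N}" "1 # 0 # [2..<N] \<in> permutations_of_set {..<N}"
    using N2 by (auto simp: permutations_of_set_def)
  have "ks \<in> ?W \<longleftrightarrow> ks = [0..<N] \<or> ks = 1 # 0 # [2..<N]" for ks
    using double_loop_walk_iff[OF _ N2, of ks] mem by (metis (no_types, lifting) mem_Collect_eq)
  then have "?W = {[0..<N], 1 # 0 # [2..<N]}" by blast
  moreover have "[0..<N] = 0 # 1 # [2..<N]"
  proof -
    have "0 < N" "1 < N" using N2 by linarith+
    then show ?thesis by (simp only: upt_conv_Cons One_nat_def[symmetric] numeral_2_eq_2)
  qed
  moreover have "map ((!) ?u) [0..<N] = ?u" unfolding len[symmetric] by (rule map_nth)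
  moreover from calculation(2,3) have "map ((!) ?u) [2..<N] = r" by simp
  ultimately show ?thesis using sum by (simp add: eq_neg_iff_add_eq_0)
qed

lemma coefficient_rotate:
  assumes t: "t \<in> V" and u: "x # r \<in> permutations_of_set (V - {t})"
    and len: "length (x # r) = 2 * CARD('n)"
  shows "Poly_Mapping.lookup f ((x # r) @ [t]) = - Poly_Mapping.lookup f ((r @ [x]) @ [t])"
proof -
  let ?u = "x # r" and ?N = "2 * CARD('n)"
  let ?e = "\<lambda>k. (k div 2, ((k + 1) div 2) mod CARD('n))"
  let ?W = "{ks \<in> permutations_of_set {..<?N}. walk ?e ks 0 0}"
  have "(\<Sum>ks\<in>{ks \<in> permutations_of_set {..<length ?u}. walk ?e ks 0 0}.
      Poly_Mapping.lookup f (map ((!) ?u) ks @ [t])) = 0"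
    by (rule coefficient_relation[OF f V t keys u]) (use len in auto)
  then have sum: "(\<Sum>ks\<in>?W. Poly_Mapping.lookup f (map ((!) ?u) ks @ [t])) = 0"
    unfolding len .
  have n0: "CARD('n) > 0" by simp
  have mem: "[0..<?N] \<in> permutations_of_set {..<?N}" "[1..<?N] @ [0] \<in> permutations_of_set {..<?N}"
    by (auto simp: permutations_of_set_def)
  have "ks \<in> ?W \<longleftrightarrow> ks = [0..<?N] \<or> ks = [1..<?N] @ [0]" for ks
    using closed_walk_iff[OF _ n0, of ks] mem by (metis (no_types, lifting) mem_Collect_eq)
  then have "?W = {[0..<?N], [1..<?N] @ [0]}" by blast
  moreover have upt: "[0..<?N] = 0 # [1..<?N]" by (simp add: upt_conv_Cons)
  moreover have "map ((!) ?u) [0..<?N] = ?u" unfolding len[symmetric] by (rule map_nth)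
  moreover from this have "map ((!) ?u) [1..<?N] = r" unfolding upt by simp
  moreover have "[0..<?N] \<noteq> [1..<?N] @ [0]"
  proof
    assume "[0..<?N] = [1..<?N] @ [0]"
    moreover have "1 < ?N" using n0 by linarith
    ultimately show False by (simp add: upt_conv_Cons)
  qed
  ultimately show ?thesis using sum by (simp add: eq_neg_iff_add_eq_0)
qed

text \<open>
  For every last letter the coefficients are alternating in the remaining \<open>2n\<close> letters, hence
  proportional to the signs.
\<close>

lemma multilinear_identity_std_combination:
  assumes v: "bij_betw v {..2 * CARD('n)} V"
  shows "\<exists>c. f = (\<Sum>l\<le>2 * CARD('n). pm_scale (c l) (tau_std CARD('n) l v))"
proof -
  let ?n = "CARD('n)"
  let ?c = "\<lambda>l. Poly_Mapping.lookup f (std_word ?n v l id)"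
  have cardV: "card V = 2 * ?n + 1" using bij_betw_same_card[OF v] by simp
  have alt: "Poly_Mapping.lookup f (std_word ?n v l \<sigma>) = ?c l * of_int (sign \<sigma>)"
    if l: "l \<le> 2 * ?n" and \<sigma>: "\<sigma> permutes {1..2 * ?n}" for l \<sigma>
  proof -
    have t: "v l \<in> V" using v l by (auto simp: bij_betw_def)
    have len: "length u = 2 * ?n" if "u \<in> permutations_of_set (V - {v l})" for u
      using that t V cardV distinct_card[of u] by (auto simp: permutations_of_set_def)
    show ?thesis
      unfolding std_word_def
      using alternating_permute[where c = "\<lambda>u. Poly_Mapping.lookup f (u @ [v l])" and W = "V - {v l}",
        OF _ _ \<sigma> _ last_to_front_bij[OF v l] upt_permutation]
        coefficient_swap_first[OF t _ len] coefficient_rotate[OF t _ len]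
      by (simp add: mult.commute del: upt_Suc)
  qed
  have "f = (\<Sum>w\<in>permutations_of_set V. Poly_Mapping.single w (Poly_Mapping.lookup f w))"
    by (rule sum_single_lookup[symmetric]) (use keys V in \<open>simp, auto simp: permutations_of_set_def\<close>)
  also have "\<dots> = (\<Sum>(l, \<sigma>)\<in>{..2 * ?n} \<times> {\<sigma>. \<sigma> permutes {1..2 * ?n}}.
      Poly_Mapping.single (std_word ?n v l \<sigma>) (Poly_Mapping.lookup f (std_word ?n v l \<sigma>)))"
    by (subst sum.reindex_bij_betw[OF bij_betw_std_word[OF v], symmetric])
      (simp add: case_prod_unfold)
  also have "\<dots> = (\<Sum>l\<le>2 * ?n. \<Sum>\<sigma> | \<sigma> permutes {1..2 * ?n}.
      Poly_Mapping.single (std_word ?n v l \<sigma>) (Poly_Mapping.lookup f (std_word ?n v l \<sigma>)))"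
    by (rule sum.cartesian_product[symmetric])
  also have "\<dots> = (\<Sum>l\<le>2 * ?n. pm_scale (?c l) (tau_std ?n l v))"
  proof (rule sum.cong[OF refl])
    fix l assume "l \<in> {..2 * ?n}"
    then have l: "l \<le> 2 * ?n" by simp
    show "(\<Sum>\<sigma> | \<sigma> permutes {1..2 * ?n}.
      Poly_Mapping.single (std_word ?n v l \<sigma>) (Poly_Mapping.lookup f (std_word ?n v l \<sigma>))) =
      pm_scale (?c l) (tau_std ?n l v)"
      unfolding tau_std_eq pm.scale_sum_right pm_scale_single
      by (rule sum.cong[OF refl]) (simp only: alt[OF l] mem_Collect_eq)
  qed
  finally show ?thesis by (rule exI[of _ ?c])
qed

end

end

section \<open>Linearization\<close>

lemma sum_alternating_supersets:
  assumes "finite J" "R \<subseteq> J"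
  shows "(\<Sum>T\<in>Pow J. (-1) ^ card T * (if R \<subseteq> T then x else 0)) =
    (if R = J then (-1) ^ card J * x else (0 :: 'k::comm_ring_1))"
proof -
  have "(\<Sum>T\<in>Pow J. (-1) ^ card T * (if R \<subseteq> T then x else 0)) =
    (\<Sum>T\<in>Pow J. if R \<subseteq> T then (-1) ^ card T * x else 0)"
    by (rule sum.cong[OF refl]) simp
  also have "\<dots> = (\<Sum>T\<in>{T\<in>Pow J. R \<subseteq> T}. (-1) ^ card T * x)"
    by (rule sum.inter_filter[symmetric]) (use assms in simp)
  also have "\<dots> = (\<Sum>T\<in>{T\<in>Pow J. R \<subseteq> T}. (-1) ^ card T) * x"
    by (rule sum_distrib_right[symmetric])
  also have "\<dots> = (if R = J then (-1) ^ card J * x else 0)"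
  proof (cases "R = J")
    case True
    then have "{T\<in>Pow J. R \<subseteq> T} = {J}" by auto
    then show ?thesis using True by simp
  next
    case False
    then have "R \<subset> J" using assms by blast
    have "(\<Sum>T\<in>{T\<in>Pow J. R \<subseteq> T}. (-1) ^ card T) = (0 :: 'k)"
    proof (rule sum_alternating_cancels)
      show "finite {T \<in> Pow J. R \<subseteq> T}" using assms by simp
      show "card {T \<in> {T \<in> Pow J. R \<subseteq> T}. even (card T)} = card {T \<in> {T \<in> Pow J. R \<subseteq> T}. odd (card T)}"
        using card_subsupersets_even_odd[OF assms(1) \<open>R \<subset> J\<close>] by (simp add: conj_assoc)
    qed
    then show ?thesis using False by simp
  qed
  finally show ?thesis .
qed

lemma single_sum: "Poly_Mapping.single w (sum g B) = (\<Sum>x\<in>B. Poly_Mapping.single w (g x))"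
  by (induction B rule: infinite_finite_induct) (simp_all add: single_add)

text \<open>
  Full polarization: the variable \<open>t\<close> is replaced by the sum of new variables \<open>j < d\<close> with \<open>\<phi> j = t\<close>, and
  only the words that use every new variable once are kept.
\<close>

definition linearize :: "nat \<Rightarrow> (nat \<Rightarrow> nat) \<Rightarrow> ('k::field) lpoly \<Rightarrow> 'k lpoly"
  where "linearize d \<phi> f =
    (\<Sum>u\<in>permutations_of_set {..<d}. Poly_Mapping.single u (Poly_Mapping.lookup f (map \<phi> u)))"

lemma lookup_linearize:
  "Poly_Mapping.lookup (linearize d \<phi> f) u =
    (if u \<in> permutations_of_set {..<d} then Poly_Mapping.lookup f (map \<phi> u) else 0)"
proof -
  have "Poly_Mapping.lookup (linearize d \<phi> f) u =
    (\<Sum>u'\<in>permutations_of_set {..<d}. if u' = u then Poly_Mapping.lookup f (map \<phi> u') else 0)"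
    by (simp add: linearize_def lookup_sum lookup_single when_def)
  also have "\<dots> = (if u \<in> permutations_of_set {..<d} then Poly_Mapping.lookup f (map \<phi> u) else 0)"
    by (rule sum.delta) simp
  finally show ?thesis .
qed

lemma keys_linearize: "Poly_Mapping.keys (linearize d \<phi> f) \<subseteq> permutations_of_set {..<d}"
  by (auto simp: in_keys_iff lookup_linearize split: if_splits)

lemma mem_permutations_of_lessThan:
  assumes "length u \<le> d" "set u = {..<d}"
  shows "u \<in> permutations_of_set {..<d}"
proof -
  have "card (set u) = d" by (simp add: assms(2))
  then have "distinct u" using assms(1) card_length[of u] by (intro card_distinct) simp
  then show ?thesis using assms(2) by (simp add: permutations_of_set_def)
qed

context witt_embedding
begin

lemma lookup_leval:
  assumes "finite B" "Poly_Mapping.keys f \<subseteq> B"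
  shows "Poly_Mapping.lookup (leval A a f $ i) \<gamma> = (\<Sum>w\<in>B. Poly_Mapping.lookup f w *
    Poly_Mapping.lookup (rn_prod (nalg.prod A) (map a w) $ i) \<gamma>)"
  unfolding leval_superset[OF assms] by (simp add: lookup_sum lookup_pm_scale)

text \<open>
  Multilinearity of the right-normed product: a word in sums is the sum over all ways of choosing one
  summand for each letter.
\<close>

lemma rn_prod_sums:
  assumes b: "\<And>j. b j \<in> S" and T: "finite T" and w: "w \<noteq> []"
  shows "rn_prod (nalg.prod A) (map (\<lambda>t. \<Sum>j\<in>{j\<in>T. \<phi> j = t}. b j) w) =
    (\<Sum>u\<in>{u. set u \<subseteq> T \<and> map \<phi> u = w}. rn_prod (nalg.prod A) (map b u))"
  using w
proof (induction w rule: list_nonempty_induct)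
  case (single t)
  have "(\<Sum>j\<in>{j\<in>T. \<phi> j = t}. b j) = (\<Sum>u\<in>{u. set u \<subseteq> T \<and> map \<phi> u = [t]}. rn_prod (nalg.prod A) (map b u))"
    by (rule sum.reindex_bij_witness[of _ hd "\<lambda>j. [j]"]) auto
  then show ?case by simp
next
  case (cons t w)
  let ?a = "\<lambda>t. \<Sum>j\<in>{j\<in>T. \<phi> j = t}. b j"
  let ?L = "\<lambda>w. {u. set u \<subseteq> T \<and> map \<phi> u = w}"
  have ne: "u \<noteq> []" if "u \<in> ?L w" for u using that cons.hyps by auto
  have fL: "finite (?L w)"
    by (rule finite_subset[OF _ finite_lists_length_eq[OF T, of "length w"]]) auto
  have cl: "rn_prod (nalg.prod A) (map b u) \<in> S" if "u \<in> ?L w" for u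
    using ne[OF that] b by (intro rn_prod_closed) auto
  have fT: "finite {j\<in>T. \<phi> j = t}" using T by simp
  have "rn_prod (nalg.prod A) (map ?a (t # w)) = nalg.prod A (?a t) (rn_prod (nalg.prod A) (map ?a w))"
    using cons.hyps by (simp add: rn_prod_Cons)
  also have "\<dots> = nalg.prod A (?a t) (\<Sum>u\<in>?L w. rn_prod (nalg.prod A) (map b u))"
    by (simp only: cons.IH)
  also have "\<dots> = (\<Sum>j\<in>{j\<in>T. \<phi> j = t}. nalg.prod A (b j) (\<Sum>u\<in>?L w. rn_prod (nalg.prod A) (map b u)))"
    by (rule prod_sum_left[OF fT b S_sum[OF cl]])
  also have "\<dots> = (\<Sum>j\<in>{j\<in>T. \<phi> j = t}. \<Sum>u\<in>?L w. nalg.prod A (b j) (rn_prod (nalg.prod A) (map b u)))"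
    by (rule sum.cong[OF refl]) (rule prod_sum_right[OF fL cl b])
  also have "\<dots> = (\<Sum>(j, u)\<in>{j\<in>T. \<phi> j = t} \<times> ?L w. nalg.prod A (b j) (rn_prod (nalg.prod A) (map b u)))"
    by (rule sum.cartesian_product)
  also have "\<dots> = (\<Sum>u\<in>?L (t # w). rn_prod (nalg.prod A) (map b u))"
  proof (rule sum.reindex_bij_witness[of _ "\<lambda>u. (hd u, tl u)" "\<lambda>(j, u). j # u"])
    fix x assume "x \<in> {j\<in>T. \<phi> j = t} \<times> ?L w"
    then obtain j u where x: "x = (j, u)" and "u \<in> ?L w" by blast
    then have "map b u \<noteq> []" using ne by blast
    then show "rn_prod (nalg.prod A) (map b (case x of (j, u) \<Rightarrow> j # u)) =
      (case x of (j, u) \<Rightarrow> nalg.prod A (b j) (rn_prod (nalg.prod A) (map b u)))"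
      by (simp add: x rn_prod_Cons)
  qed auto
  finally show ?case .
qed

text \<open>
  Inclusion--exclusion over the set \<open>T\<close> of new variables that are substituted isolates the words in
  which all \<open>d\<close> of them occur; a word of length at most \<open>d\<close> that contains them all is an ordering of
  them. Shorter words drop out, so no homogeneous components have to be separated first.
\<close>

theorem left_identity_linearize:
  assumes f: "left_identity A f" and len: "\<And>w. w \<in> Poly_Mapping.keys f \<Longrightarrow> length w \<le> d" and d: "d > 0"
  shows "left_identity A (linearize d \<phi> f)"
  unfolding left_identity_def
proof (intro conjI allI impI)
  have "set [] \<noteq> {..<d}" using d by auto
  then show "left_poly (linearize d \<phi> f)"
    using subsetD[OF keys_linearize, of "[]" d \<phi> f] unfolding left_poly_def permutations_of_set_def by blast
  fix b :: "nat \<Rightarrow> ('e \<Rightarrow>\<^sub>0 'k) ^ 'n"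
  assume "\<forall>j. b j \<in> nalg.space A"
  then have b: "b j \<in> S" for j unfolding space_A by blast
  let ?J = "{..<d}"
  let ?L = "\<lambda>T w. {u. set u \<subseteq> T \<and> map \<phi> u = w}"
  define K where "K = Poly_Mapping.keys f"
  define c where "c = Poly_Mapping.lookup f"
  have "Poly_Mapping.lookup (leval A b (linearize d \<phi> f) $ i) \<gamma> = 0" for i \<gamma>
  proof -
    define val where "val u = Poly_Mapping.lookup (rn_prod (nalg.prod A) (map b u) $ i) \<gamma>" for u
    have fK: "finite K" by (simp add: K_def)
    have fL: "finite (?L ?J w)" for w
      by (rule finite_subset[OF _ finite_lists_length_eq[of ?J "length w"]]) auto
    have eval: "(\<Sum>w\<in>K. c w * (\<Sum>u\<in>?L ?J w. if set u \<subseteq> T then val u else 0)) = 0"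
      if T: "T \<subseteq> ?J" for T
    proof -
      let ?a = "\<lambda>t. \<Sum>j\<in>{j\<in>T. \<phi> j = t}. b j"
      have fT: "finite T" using T by (rule finite_subset) simp
      have aS: "?a t \<in> S" for t by (rule S_sum[OF b])
      have "0 = Poly_Mapping.lookup (leval A ?a f $ i) \<gamma>"
        using f aS unfolding left_identity_def space_A by simp
      also have "\<dots> = (\<Sum>w\<in>K. c w * Poly_Mapping.lookup (rn_prod (nalg.prod A) (map ?a w) $ i) \<gamma>)"
        unfolding c_def by (rule lookup_leval) (simp_all add: K_def)
      also have "\<dots> = (\<Sum>w\<in>K. c w * (\<Sum>u\<in>?L ?J w. if set u \<subseteq> T then val u else 0))"
      proof (rule sum.cong[OF refl])
        fix w assume "w \<in> K"
        then have ne: "w \<noteq> []" using f by (auto simp: K_def left_identity_def left_poly_def)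
        have "Poly_Mapping.lookup (rn_prod (nalg.prod A) (map ?a w) $ i) \<gamma> = (\<Sum>u\<in>?L T w. val u)"
          unfolding rn_prod_sums[where b = b and T = T and w = w and \<phi> = \<phi>, OF b fT ne] by (simp only: sum_component lookup_sum val_def)
        also have "?L T w = {u \<in> ?L ?J w. set u \<subseteq> T}" using T by blast
        also have "(\<Sum>u\<in>\<dots>. val u) = (\<Sum>u\<in>?L ?J w. if set u \<subseteq> T then val u else 0)"
          by (rule sum.inter_filter[OF fL])
        finally show "c w * Poly_Mapping.lookup (rn_prod (nalg.prod A) (map ?a w) $ i) \<gamma> =
          c w * (\<Sum>u\<in>?L ?J w. if set u \<subseteq> T then val u else 0)" by simp
      qed
      finally show ?thesis by simp
    qed
    have "0 = (\<Sum>T\<in>Pow ?J. (-1) ^ card T * (\<Sum>w\<in>K. c w * (\<Sum>u\<in>?L ?J w. if set u \<subseteq> T then val u else 0)))"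
      by (simp add: eval)
    also have "\<dots> = (\<Sum>T\<in>Pow ?J. \<Sum>w\<in>K. \<Sum>u\<in>?L ?J w. c w * ((-1) ^ card T * (if set u \<subseteq> T then val u else 0)))"
      by (simp only: sum_distrib_left mult.left_commute)
    also have "\<dots> = (\<Sum>w\<in>K. \<Sum>T\<in>Pow ?J. \<Sum>u\<in>?L ?J w. c w * ((-1) ^ card T * (if set u \<subseteq> T then val u else 0)))"
      by (rule sum.swap)
    also have "\<dots> = (\<Sum>w\<in>K. \<Sum>u\<in>?L ?J w. \<Sum>T\<in>Pow ?J. c w * ((-1) ^ card T * (if set u \<subseteq> T then val u else 0)))"
      by (rule sum.cong[OF refl]) (rule sum.swap)
    also have "\<dots> = (\<Sum>w\<in>K. \<Sum>u\<in>?L ?J w. if set u = ?J then (-1) ^ d * (c w * val u) else 0)"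
    proof (rule sum.cong[OF refl], rule sum.cong[OF refl])
      fix w u assume "u \<in> ?L ?J w"
      then have "set u \<subseteq> ?J" by simp
      from sum_alternating_supersets[OF _ this, of "val u"]
      show "(\<Sum>T\<in>Pow ?J. c w * ((-1) ^ card T * (if set u \<subseteq> T then val u else 0))) =
        (if set u = ?J then (-1) ^ d * (c w * val u) else 0)"
        by (simp add: sum_distrib_left[symmetric])
    qed
    also have "\<dots> = (\<Sum>w\<in>K. \<Sum>u\<in>{u\<in>?L ?J w. set u = ?J}. (-1) ^ d * (c w * val u))"
      by (rule sum.cong[OF refl]) (rule sum.inter_filter[OF fL, symmetric])
    also have "\<dots> = (\<Sum>w\<in>K. \<Sum>u\<in>{u\<in>permutations_of_set ?J. map \<phi> u = w}. (-1) ^ d * (c w * val u))"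
    proof (rule sum.cong[OF refl], rule sum.cong)
      fix w assume "w \<in> K"
      then have "length w \<le> d" using len by (simp add: K_def)
      then show "{u\<in>?L ?J w. set u = ?J} = {u\<in>permutations_of_set ?J. map \<phi> u = w}"
        using mem_permutations_of_lessThan[of _ d] by (auto simp: permutations_of_set_def)
    qed simp
    also have "\<dots> = (\<Sum>w\<in>K. \<Sum>u\<in>{u\<in>{u\<in>permutations_of_set ?J. map \<phi> u \<in> K}. map \<phi> u = w}. (-1) ^ d * (c (map \<phi> u) * val u))"
      by (intro sum.cong) auto
    also have "\<dots> = (\<Sum>u\<in>{u\<in>permutations_of_set ?J. map \<phi> u \<in> K}. (-1) ^ d * (c (map \<phi> u) * val u))"
      by (rule sum.group) (auto simp: fK)
    also have "\<dots> = (\<Sum>u\<in>permutations_of_set ?J. (-1) ^ d * (c (map \<phi> u) * val u))"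
      by (rule sum.mono_neutral_left) (auto simp: c_def K_def in_keys_iff)
    also have "\<dots> = (-1) ^ d * (\<Sum>u\<in>permutations_of_set ?J. Poly_Mapping.lookup (linearize d \<phi> f) u * val u)"
      by (simp add: sum_distrib_left lookup_linearize c_def)
    also have "\<dots> = (-1) ^ d * Poly_Mapping.lookup (leval A b (linearize d \<phi> f) $ i) \<gamma>"
      unfolding val_def by (subst lookup_leval[OF _ keys_linearize]) simp_all
    finally show ?thesis by simp
  qed
  then show "leval A b (linearize d \<phi> f) = 0"
    by (auto simp: vec_eq_iff intro: poly_mapping_eqI)
qed

lemma leval_single: "leval A a (Poly_Mapping.single w x) $ i = pm_scale x (rn_prod (nalg.prod A) (map a w) $ i)"
  by (subst leval_superset[of "{w}"]) auto

lemma leval_add: "leval A a (f + g) = leval A a f + leval A a g"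
proof -
  let ?B = "Poly_Mapping.keys f \<union> Poly_Mapping.keys g"
  have "leval A a (f + g) $ i = leval A a f $ i + leval A a g $ i" for i
    by (subst (1 2 3) leval_superset[of ?B])
      (use keys_add[of f g] in \<open>auto simp: lookup_add pm.scale_left_distrib sum.distrib\<close>)
  then show ?thesis by (simp add: vec_eq_iff)
qed

lemma leval_0: "leval A a 0 = 0"
  by (simp add: leval_def)

lemma leval_sum: "leval A a (sum g B) = (\<Sum>x\<in>B. leval A a (g x))"
  by (induction B rule: infinite_finite_induct) (simp_all add: leval_0 leval_add)

lemma leval_scale: "leval A a (pm_scale c f) $ i = pm_scale c (leval A a f $ i)"
  by (subst (1 2) leval_superset[of "Poly_Mapping.keys f"])
    (auto simp: lookup_pm_scale pm.scale_sum_right in_keys_iff)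

lemma left_identity_subspace: "pm.subspace {f. left_identity A f}"
proof (rule pm.subspaceI)
  show "0 \<in> {f. left_identity A f}" by (simp add: left_identity_def left_poly_def leval_0)
  show "f + g \<in> {f. left_identity A f}" if "f \<in> {f. left_identity A f}" "g \<in> {f. left_identity A f}" for f g
    using that keys_add[of f g] by (auto simp: left_identity_def left_poly_def leval_add)
  show "pm_scale c f \<in> {f. left_identity A f}" if "f \<in> {f. left_identity A f}" for c f
    using that by (auto simp: left_identity_def left_poly_def leval_scale vec_eq_iff in_keys_iff lookup_pm_scale)
qed

theorem left_identity_tau_std:
  assumes l: "l \<le> 2 * CARD('n)"
  shows "left_identity A (tau_std CARD('n) l v)"
  unfolding left_identity_def
proof (intro conjI allI impI)
  let ?n = "CARD('n)"
  show "left_poly (tau_std ?n l v)"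
    unfolding left_poly_def tau_std_eq in_keys_iff lookup_sum lookup_single
    by (simp add: std_word_def)
  fix a :: "nat \<Rightarrow> ('e \<Rightarrow>\<^sub>0 'k) ^ 'n"
  assume a: "\<forall>i. a i \<in> nalg.space A"
  define b where "b i = (if i = 2 * ?n + 1 then a (v l) else a (last_to_front v l i))" for i
  have "b i \<in> nalg.space A" for i using a by (simp add: b_def)
  then have "0 = (\<Sum>\<sigma> | \<sigma> permutes {1..2 * ?n}. nalg.scal A (of_int (sign \<sigma>))
    (rn_prod (nalg.prod A) (map (\<lambda>i. b (\<sigma> i)) [1..<2 * ?n + 1] @ [b (2 * ?n + 1)])))"
    using standard_identity[unfolded satisfies_standard_def, THEN spec, of b] by simp
  also have "\<dots> = (\<Sum>\<sigma> | \<sigma> permutes {1..2 * ?n}. leval A a (Poly_Mapping.single (std_word ?n v l \<sigma>) (of_int (sign \<sigma>))))"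
  proof (rule sum.cong[OF refl])
    fix \<sigma> assume "\<sigma> \<in> {\<sigma>. \<sigma> permutes {1..2 * ?n}}"
    then have \<sigma>: "\<sigma> permutes {1..2 * ?n}" by simp
    have "map (\<lambda>i. b (\<sigma> i)) [1..<2 * ?n + 1] = map (\<lambda>i. a (last_to_front v l (\<sigma> i))) [1..<2 * ?n + 1]"
    proof (rule map_cong[OF refl])
      fix i assume "i \<in> set [1..<2 * ?n + 1]"
      then have "i \<in> {1..2 * ?n}" unfolding set_upt atLeastLessThan_iff atLeastAtMost_iff by linarith
      then have "\<sigma> i \<in> {1..2 * ?n}" using permutes_in_image[OF \<sigma>] by blast
      then show "b (\<sigma> i) = a (last_to_front v l (\<sigma> i))" by (simp add: b_def)
    qed
    then have "map (\<lambda>i. b (\<sigma> i)) [1..<2 * ?n + 1] @ [b (2 * ?n + 1)] = map a (std_word ?n v l \<sigma>)"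
      by (simp add: std_word_def b_def del: upt_Suc)
    then show "nalg.scal A (of_int (sign \<sigma>))
      (rn_prod (nalg.prod A) (map (\<lambda>i. b (\<sigma> i)) [1..<2 * ?n + 1] @ [b (2 * ?n + 1)])) =
      leval A a (Poly_Mapping.single (std_word ?n v l \<sigma>) (of_int (sign \<sigma>)))"
      by (simp add: vec_eq_iff leval_single scal_A)
  qed
  finally show "leval A a (tau_std ?n l v) = 0"
    unfolding tau_std_eq leval_sum by (rule sym)
qed

lemma length_le_ldegree: "w \<in> Poly_Mapping.keys f \<Longrightarrow> length w \<le> ldegree f"
  unfolding ldegree_def by (rule Max_ge) auto

lemma key_of_max_length:
  assumes "f \<noteq> 0"
  obtains w where "w \<in> Poly_Mapping.keys f" "length w = ldegree f"
proof -
  have ne: "Poly_Mapping.keys f \<noteq> {}" using assms by simp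
  have "ldegree f \<in> insert 0 (length ` Poly_Mapping.keys f)"
    unfolding ldegree_def by (rule Max_in) auto
  then consider "ldegree f = 0" | w where "w \<in> Poly_Mapping.keys f" "length w = ldegree f" by force
  then show ?thesis
  proof cases
    case 1
    from ne obtain w where "w \<in> Poly_Mapping.keys f" by blast
    then show ?thesis using that[of w] length_le_ldegree[of w f] 1 by simp
  qed (use that in blast)
qed

theorem multilinear_identity_degree:
  assumes f: "left_identity A f" and ml: "multilinear f" and nz: "f \<noteq> 0"
  shows "ldegree f \<ge> 2 * CARD('n) + 1"
proof (rule ccontr)
  assume small: "\<not> ?thesis"
  obtain V where V: "finite V" "card V = ldegree f"
    and keys: "\<And>w. w \<in> Poly_Mapping.keys f \<Longrightarrow> distinct w \<and> set w = V"
    using ml by (auto simp: multilinear_def)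
  obtain w where w: "w \<in> Poly_Mapping.keys f" using nz by (metis all_not_in_conv keys_eq_empty)
  then have "w \<noteq> []" using f by (auto simp: left_identity_def left_poly_def)
  then obtain u t where ut: "w = u @ [t]" by (metis rev_exhaust)
  have "distinct w" "set w = V" using keys w by auto
  then have t: "t \<in> V" and u: "u \<in> permutations_of_set (V - {t})"
    by (auto simp: ut permutations_of_set_def)
  have "length w = ldegree f" using distinct_card[of w] V \<open>distinct w\<close> \<open>set w = V\<close> by simp
  then have "length u < 2 * CARD('n)" using small by (simp add: ut)
  from short_coefficient_eq_0[OF f V(1) keys t u this] show False
    using w by (simp add: ut in_keys_iff)
qed

theorem multilinear_identity_std:
  assumes f: "left_identity A f" and ml: "multilinear f" and deg: "ldegree f = 2 * CARD('n) + 1"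
  shows "std_combination CARD('n) f"
  unfolding std_combination_def
proof (intro allI impI)
  fix v assume v: "bij_betw v {..2 * CARD('n)} (lvars f)"
  obtain V where V: "finite V"
    and keys: "\<And>w. w \<in> Poly_Mapping.keys f \<Longrightarrow> distinct w \<and> set w = V"
    using ml by (auto simp: multilinear_def)
  have "f \<noteq> 0" using deg by (auto simp: ldegree_def)
  then have "lvars f = V" using keys by (auto simp: lvars_def)
  then show "\<exists>c. f = (\<Sum>l\<le>2 * CARD('n). pm_scale (c l) (tau_std CARD('n) l v))"
    using multilinear_identity_std_combination[OF f V keys] v by simp
qed

text \<open>
  Linearizing along a longest word \<open>w\<close> yields a multilinear identity of the same degree in which the
  identity ordering has the coefficient of \<open>w\<close>.
\<close>

theorem identity_degree:
  assumes f: "left_identity A f" and nz: "f \<noteq> 0"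
  shows "ldegree f \<ge> 2 * CARD('n) + 1"
proof -
  obtain w where w: "w \<in> Poly_Mapping.keys f" "length w = ldegree f"
    using key_of_max_length[OF nz] .
  define d where "d = ldegree f"
  define g where "g = linearize d ((!) w) f"
  have "w \<noteq> []" using f w by (auto simp: left_identity_def left_poly_def)
  then have d: "d > 0" unfolding d_def w(2)[symmetric] by simp
  have g: "left_identity A g"
    unfolding g_def by (rule left_identity_linearize[OF f _ d]) (simp add: d_def length_le_ldegree)
  have "[0..<d] \<in> permutations_of_set {..<d}" by (auto simp: permutations_of_set_def)
  moreover have "map ((!) w) [0..<d] = w" using w map_nth[of w] by (simp add: d_def)
  ultimately have "Poly_Mapping.lookup g [0..<d] \<noteq> 0"
    using w by (simp add: g_def lookup_linearize in_keys_iff)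
  then have gk: "[0..<d] \<in> Poly_Mapping.keys g" by (simp add: in_keys_iff)
  then have g0: "g \<noteq> 0" by auto
  have gkeys: "distinct u \<and> set u = {..<d}" if "u \<in> Poly_Mapping.keys g" for u
    using that keys_linearize[of d "(!) w" f] by (auto simp: g_def permutations_of_set_def)
  have "length u = d" if "u \<in> Poly_Mapping.keys g" for u
    using gkeys[OF that] distinct_card[of u] by simp
  moreover obtain u where "u \<in> Poly_Mapping.keys g" "length u = ldegree g" using key_of_max_length[OF g0] .
  ultimately have dg: "ldegree g = d" by metis
  have "multilinear g"
    unfolding multilinear_def using gkeys dg by (intro exI[of _ "{..<d}"]) simp
  then show ?thesis using multilinear_identity_degree[OF g _ g0] dg by (simp add: d_def)
qed

text \<open>
  The linearization along a word \<open>w\<close> of length \<open>2n + 1\<close> is a combination of standard polynomials;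
  substituting the letters of \<open>w\<close> back keeps it in their span. Summing the results over all words \<open>w\<close>
  reproduces the part of degree \<open>2n + 1\<close> with the factor \<open>(2n + 1)!\<close>, which characteristic \<open>0\<close> allows
  to cancel. The rest is an identity of smaller degree, hence zero.
\<close>

theorem identity_std_span:
  assumes f: "left_identity A f" and deg: "ldegree f = 2 * CARD('n) + 1" and char: "CHAR('k) = 0"
  shows "f \<in> std_span CARD('n) f"
proof -
  let ?n = "CARD('n)"
  define d where "d = 2 * ?n + 1"
  let ?J = "permutations_of_set {..<d}"
  define W where "W = {w. set w \<subseteq> lvars f \<and> length w = d}"
  have fv: "finite (lvars f)" by (auto simp: lvars_def)
  have fW: "finite W" unfolding W_def by (rule finite_lists_length_eq[OF fv])
  define top where "top = (\<Sum>w\<in>W. Poly_Mapping.single w (Poly_Mapping.lookup f w))"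
  have push: "(\<Sum>u\<in>?J. Poly_Mapping.single (map \<phi> u) (Poly_Mapping.lookup f (map \<phi> u))) \<in> std_span ?n f"
    if \<phi>: "\<phi> ` {..2 * ?n} \<subseteq> lvars f" for \<phi>
  proof -
    define g where "g = linearize d \<phi> f"
    have g: "left_identity A g"
      unfolding g_def by (rule left_identity_linearize[OF f])
        (use length_le_ldegree[of _ f] deg in \<open>auto simp: d_def\<close>)
    have gkeys: "distinct u \<and> set u = {..<d}" if "u \<in> Poly_Mapping.keys g" for u
      using that keys_linearize[of d \<phi> f] by (auto simp: g_def permutations_of_set_def)
    have id: "bij_betw id {..2 * ?n} {..<d}" by (auto simp: d_def lessThan_Suc_atMost)
    obtain c where c: "g = (\<Sum>l\<le>2 * ?n. pm_scale (c l) (tau_std ?n l id))"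
      using multilinear_identity_std_combination[OF g _ gkeys id] by auto
    have tau: "(\<Sum>u\<in>?J. Poly_Mapping.single (map \<phi> u) (Poly_Mapping.lookup (tau_std ?n l id :: 'k lpoly) u)) =
      tau_std ?n l \<phi>" if l: "l \<le> 2 * ?n" for l
    proof -
      have "(\<Sum>u\<in>?J. Poly_Mapping.single (map \<phi> u) (Poly_Mapping.lookup (tau_std ?n l id :: 'k lpoly) u)) =
        (\<Sum>u\<in>?J. \<Sum>\<sigma> | \<sigma> permutes {1..2 * ?n}.
          if u = std_word ?n id l \<sigma> then Poly_Mapping.single (map \<phi> u) (of_int (sign \<sigma>)) else 0)"
        unfolding tau_std_eq lookup_sum single_sum
        by (intro sum.cong refl) (auto simp: lookup_single when_def)
      also have "\<dots> = (\<Sum>\<sigma> | \<sigma> permutes {1..2 * ?n}. \<Sum>u\<in>?J.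
          if u = std_word ?n id l \<sigma> then Poly_Mapping.single (map \<phi> u) (of_int (sign \<sigma>)) else 0)"
        by (rule sum.swap)
      also have "\<dots> = (\<Sum>\<sigma> | \<sigma> permutes {1..2 * ?n}.
          Poly_Mapping.single (map \<phi> (std_word ?n id l \<sigma>)) (of_int (sign \<sigma>)))"
      proof (rule sum.cong[OF refl])
        fix \<sigma> assume "\<sigma> \<in> {\<sigma>. \<sigma> permutes {1..2 * ?n}}"
        then have "std_word ?n id l \<sigma> \<in> ?J"
          using bij_betw_std_word[OF id] l by (auto simp: bij_betw_def)
        then show "(\<Sum>u\<in>?J. if u = std_word ?n id l \<sigma> then Poly_Mapping.single (map \<phi> u) (of_int (sign \<sigma>)) else 0) =
          (Poly_Mapping.single (map \<phi> (std_word ?n id l \<sigma>)) (of_int (sign \<sigma>)) :: 'k lpoly)"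
          by simp
      qed
      also have "\<dots> = tau_std ?n l \<phi>" by (simp add: tau_std_eq map_std_word)
      finally show ?thesis .
    qed
    have "(\<Sum>u\<in>?J. Poly_Mapping.single (map \<phi> u) (Poly_Mapping.lookup f (map \<phi> u))) =
      (\<Sum>u\<in>?J. Poly_Mapping.single (map \<phi> u) (Poly_Mapping.lookup g u))"
      by (rule sum.cong) (simp_all add: g_def lookup_linearize)
    also have "\<dots> = (\<Sum>u\<in>?J. \<Sum>l\<le>2 * ?n. pm_scale (c l) (Poly_Mapping.single (map \<phi> u) (Poly_Mapping.lookup (tau_std ?n l id) u)))"
      by (subst c) (simp add: lookup_sum lookup_pm_scale single_sum pm_scale_single)
    also have "\<dots> = (\<Sum>l\<le>2 * ?n. pm_scale (c l) (\<Sum>u\<in>?J. Poly_Mapping.single (map \<phi> u) (Poly_Mapping.lookup (tau_std ?n l id) u)))"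
      by (subst sum.swap) (simp only: pm.scale_sum_right)
    also have "\<dots> = (\<Sum>l\<le>2 * ?n. pm_scale (c l) (tau_std ?n l \<phi>))"
      by (rule sum.cong[OF refl]) (simp only: tau atMost_iff)
    also have "\<dots> \<in> std_span ?n f"
      unfolding std_span_def
      by (intro pm.span_sum pm.span_scale pm.span_base) (use \<phi> in auto)
    finally show ?thesis .
  qed
  \<comment> \<open>For each fixed ordering \<open>u\<close>, permuting positions by \<open>u\<close> permutes the words of length \<open>d\<close>.\<close>
  have "pm_scale (of_nat (fact d)) top = (\<Sum>u\<in>?J. top)"
  proof -
    have "(\<Sum>u\<in>?J. top) = (\<Sum>u\<in>?J. pm_scale 1 top)" by simp
    also have "\<dots> = pm_scale (\<Sum>u\<in>?J. 1) top" by (rule pm.scale_sum_left[symmetric])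
    finally show ?thesis by simp
  qed
  also have "\<dots> = (\<Sum>u\<in>?J. \<Sum>w\<in>W. Poly_Mapping.single (map ((!) w) u) (Poly_Mapping.lookup f (map ((!) w) u)))"
  proof (rule sum.cong[OF refl])
    fix u assume u: "u \<in> ?J"
    then have su: "set u = {..<d}" "length u = d"
      using distinct_card[of u] by (auto simp: permutations_of_set_def)
    have inj: "inj_on (\<lambda>w. map ((!) w) u) W"
    proof (rule inj_onI)
      fix w w' assume w: "w \<in> W" "w' \<in> W" and eq: "map ((!) w) u = map ((!) w') u"
      have "length w = d" "length w' = d" using w by (auto simp: W_def)
      moreover have "w ! k = w' ! k" if "k < d" for k
        using eq su(1) that unfolding map_eq_conv by blast
      ultimately show "w = w'" by (simp add: list_eq_iff_nth_eq)
    qed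
    have "(\<lambda>w. map ((!) w) u) ` W \<subseteq> W"
    proof (rule image_subsetI)
      fix w assume "w \<in> W"
      then have w: "set w \<subseteq> lvars f" "length w = d" by (simp_all add: W_def)
      then have "w ! k \<in> lvars f" if "k < d" for k using that nth_mem[of k w] by blast
      then show "map ((!) w) u \<in> W" using su unfolding W_def by auto
    qed
    then have "bij_betw (\<lambda>w. map ((!) w) u) W W"
      unfolding bij_betw_def using endo_inj_surj[OF fW _ inj] inj by blast
    from sum.reindex_bij_betw[OF this, of "\<lambda>w. Poly_Mapping.single w (Poly_Mapping.lookup f w)"]
    show "top = (\<Sum>w\<in>W. Poly_Mapping.single (map ((!) w) u) (Poly_Mapping.lookup f (map ((!) w) u)))"
      unfolding top_def by (rule sym)
  qed
  also have "\<dots> = (\<Sum>w\<in>W. \<Sum>u\<in>?J. Poly_Mapping.single (map ((!) w) u) (Poly_Mapping.lookup f (map ((!) w) u)))"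
    by (rule sum.swap)
  also have "\<dots> \<in> std_span ?n f"
  proof -
    have "(\<Sum>u\<in>?J. Poly_Mapping.single (map ((!) w) u) (Poly_Mapping.lookup f (map ((!) w) u))) \<in> std_span ?n f"
      if "w \<in> W" for w
      by (rule push[of "(!) w"]) (use that in \<open>auto simp: W_def d_def\<close>)
    then show ?thesis unfolding std_span_def by (rule pm.span_sum)
  qed
  finally have "pm_scale (of_nat (fact d)) top \<in> std_span ?n f" .
  then have "pm_scale (inverse (of_nat (fact d))) (pm_scale (of_nat (fact d)) top) \<in> std_span ?n f"
    unfolding std_span_def by (rule pm.span_scale)
  moreover have "of_nat (fact d) \<noteq> (0 :: 'k)"
    using char by (simp add: of_nat_eq_0_iff_char_dvd)
  ultimately have top: "top \<in> std_span ?n f" by simp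
  have "std_span ?n f \<subseteq> {f. left_identity A f}"
    unfolding std_span_def by (intro pm.span_minimal left_identity_subspace) (auto intro: left_identity_tau_std)
  with top have "left_identity A top" by blast
  then have diff: "left_identity A (f - top)"
    using pm.subspace_diff[OF left_identity_subspace, of f top] f by simp
  have "f - top = 0"
  proof (rule ccontr)
    assume nz: "f - top \<noteq> 0"
    obtain w where w: "w \<in> Poly_Mapping.keys (f - top)" "length w = ldegree (f - top)"
      using key_of_max_length[OF nz] .
    have lookup_top: "Poly_Mapping.lookup top w = (if w \<in> W then Poly_Mapping.lookup f w else 0)"
      unfolding top_def lookup_sum lookup_single when_def by (rule sum.delta[OF fW])
    then have "w \<notin> W" "w \<in> Poly_Mapping.keys f"
      using w(1) by (auto simp: in_keys_iff lookup_minus split: if_splits)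
    then have "length w \<noteq> d" "length w \<le> d"
      using length_le_ldegree[of w f] deg by (auto simp: W_def lvars_def d_def)
    then have "ldegree (f - top) < 2 * ?n + 1" using w(2) by (simp add: d_def)
    then show False using identity_degree[OF diff nz] by simp
  qed
  then show ?thesis using top by simp
qed

end

section \<open>The ring of divided power series\<close>

text \<open>
  In characteristic \<open>p\<close> the algebra \<open>O\<^sub>n(m)\<close> depends on the value \<open>m\<close> and has no type of its own. It is
  a subalgebra of the ring of all divided power series \<open>\<Sum> f\<^sub>\<gamma> x\<^sup>(\<^sup>\<gamma>\<^sup>)\<close>, with no bound on the exponents,
  which is a commutative ring on a type. Formal series serve as well as polynomials here, because each
  exponent splits into a sum of two in only finitely many ways.
\<close>

typedef ('k, 'n) divided_series = "UNIV :: ((nat ^ 'n) \<Rightarrow> 'k) set"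
  by simp

setup_lifting type_definition_divided_series

definition splits :: "nat ^ 'n \<Rightarrow> ((nat ^ 'n) \<times> (nat ^ 'n)) set"
  where "splits \<gamma> = {(\<alpha>, \<beta>). \<alpha> + \<beta> = \<gamma>}"

definition vec_binomial :: "nat ^ 'n \<Rightarrow> nat ^ 'n \<Rightarrow> nat"
  where "vec_binomial \<alpha> \<beta> = (\<Prod>i\<in>UNIV. (\<alpha> $ i + \<beta> $ i) choose (\<alpha> $ i))"

lemma finite_splits: "finite (splits (\<gamma> :: nat ^ 'n::finite))"
proof -
  have fin: "finite (vec_lambda ` (PiE UNIV (\<lambda>i. {..\<gamma> $ i})) :: (nat ^ 'n) set)"
    by (intro finite_imageI finite_PiE) auto
  have "\<alpha> \<in> vec_lambda ` (PiE UNIV (\<lambda>i. {..\<gamma> $ i}))" if "\<And>i. \<alpha> $ i \<le> \<gamma> $ i" for \<alpha> :: "nat ^ 'n"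
    using that by (intro image_eqI[of _ _ "\<lambda>i. \<alpha> $ i"]) auto
  then have "{\<alpha> :: nat ^ 'n. \<forall>i. \<alpha> $ i \<le> \<gamma> $ i} \<subseteq> vec_lambda ` (PiE UNIV (\<lambda>i. {..\<gamma> $ i}))"
    by blast
  then have "finite {\<alpha> :: nat ^ 'n. \<forall>i. \<alpha> $ i \<le> \<gamma> $ i}"
    using fin by (rule finite_subset)
  then have "finite ({\<alpha> :: nat ^ 'n. \<forall>i. \<alpha> $ i \<le> \<gamma> $ i} \<times> {\<alpha> :: nat ^ 'n. \<forall>i. \<alpha> $ i \<le> \<gamma> $ i})"
    by simp
  then show ?thesis
    by (rule finite_subset[rotated]) (auto simp: splits_def)
qed

lemma vec_binomial_commute: "vec_binomial \<alpha> \<beta> = vec_binomial \<beta> \<alpha>"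
  unfolding vec_binomial_def by (rule prod.cong[OF refl]) (metis add.commute add_diff_cancel_left' binomial_symmetric le_add1)

lemma vec_binomial_assoc:
  "vec_binomial \<alpha> \<beta> * vec_binomial (\<alpha> + \<beta>) \<gamma> = vec_binomial \<beta> \<gamma> * vec_binomial \<alpha> (\<beta> + \<gamma>)"
  unfolding vec_binomial_def prod.distrib[symmetric]
proof (rule prod.cong[OF refl])
  fix i
  have "(a + b + c choose (a + b)) * (a + b choose a) = (a + b + c choose a) * (b + c choose b)" for a b c :: nat
    using choose_mult[of a "a + b" "a + b + c"] by (simp add: add.assoc)
  from this[of "\<alpha> $ i" "\<beta> $ i" "\<gamma> $ i"]
  show "(\<alpha> $ i + \<beta> $ i choose \<alpha> $ i) * ((\<alpha> + \<beta>) $ i + \<gamma> $ i choose (\<alpha> + \<beta>) $ i) =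
    (\<beta> $ i + \<gamma> $ i choose \<beta> $ i) * (\<alpha> $ i + (\<beta> + \<gamma>) $ i choose \<alpha> $ i)"
    by (simp add: add.assoc mult.commute)
qed

instantiation divided_series :: (comm_ring_1, finite) comm_ring_1
begin

lift_definition zero_divided_series :: "('a, 'b) divided_series" is "\<lambda>_. 0" .
lift_definition one_divided_series :: "('a, 'b) divided_series" is "\<lambda>\<gamma>. if \<gamma> = 0 then 1 else 0" .
lift_definition plus_divided_series :: "('a, 'b) divided_series \<Rightarrow> ('a, 'b) divided_series \<Rightarrow> ('a, 'b) divided_series"
  is "\<lambda>f g \<gamma>. f \<gamma> + g \<gamma>" .
lift_definition minus_divided_series :: "('a, 'b) divided_series \<Rightarrow> ('a, 'b) divided_series \<Rightarrow> ('a, 'b) divided_series"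
  is "\<lambda>f g \<gamma>. f \<gamma> - g \<gamma>" .
lift_definition uminus_divided_series :: "('a, 'b) divided_series \<Rightarrow> ('a, 'b) divided_series"
  is "\<lambda>f \<gamma>. - f \<gamma>" .
lift_definition times_divided_series :: "('a, 'b) divided_series \<Rightarrow> ('a, 'b) divided_series \<Rightarrow> ('a, 'b) divided_series"
  is "\<lambda>f g \<gamma>. \<Sum>(\<alpha>, \<beta>)\<in>splits \<gamma>. of_nat (vec_binomial \<alpha> \<beta>) * f \<alpha> * g \<beta>" .

instance
proof
  fix f g h :: "('a, 'b) divided_series"
  show "f * g * h = f * (g * h)"
  proof (transfer, rule ext)
    fix f g h :: "nat ^ 'b \<Rightarrow> 'a" and \<epsilon>
    let ?s = "\<lambda>\<alpha> \<beta>. of_nat (vec_binomial \<alpha> \<beta>) :: 'a"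
    have "(\<Sum>(\<delta>, \<gamma>)\<in>splits \<epsilon>. ?s \<delta> \<gamma> * (\<Sum>(\<alpha>, \<beta>)\<in>splits \<delta>. ?s \<alpha> \<beta> * f \<alpha> * g \<beta>) * h \<gamma>) =
      (\<Sum>x\<in>splits \<epsilon>. \<Sum>y\<in>splits (fst x). ?s (fst x) (snd x) * ?s (fst y) (snd y) * f (fst y) * g (snd y) * h (snd x))"
      by (simp add: case_prod_unfold sum_distrib_left sum_distrib_right mult.assoc)
    also have "\<dots> = (\<Sum>(x, y)\<in>Sigma (splits \<epsilon>) (\<lambda>x. splits (fst x)).
        ?s (fst x) (snd x) * ?s (fst y) (snd y) * f (fst y) * g (snd y) * h (snd x))"
      by (rule sum.Sigma) (auto simp: finite_splits)
    also have "\<dots> = (\<Sum>(x, y)\<in>Sigma (splits \<epsilon>) (\<lambda>x. splits (snd x)).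
        ?s (fst x) (snd x) * f (fst x) * (?s (fst y) (snd y) * g (fst y) * h (snd y)))"
    proof (rule sum.reindex_bij_witness[of _
          "\<lambda>(x, y). ((fst x + fst y, snd y), (fst x, fst y))"
          "\<lambda>(x, y). ((fst y, snd y + snd x), (snd y, snd x))"])
      fix z assume "z \<in> Sigma (splits \<epsilon>) (\<lambda>x. splits (fst x))"
      then obtain \<alpha> \<beta> \<gamma> where z: "z = ((\<alpha> + \<beta>, \<gamma>), (\<alpha>, \<beta>))"
        by (auto simp: splits_def)
      have "of_nat (vec_binomial \<alpha> \<beta> * vec_binomial (\<alpha> + \<beta>) \<gamma>) =
        (of_nat (vec_binomial \<beta> \<gamma> * vec_binomial \<alpha> (\<beta> + \<gamma>)) :: 'a)"
        by (simp only: vec_binomial_assoc)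
      then have *: "?s \<alpha> (\<beta> + \<gamma>) * ?s \<beta> \<gamma> = ?s (\<alpha> + \<beta>) \<gamma> * ?s \<alpha> \<beta>"
        by (simp add: mult.commute)
      have "?s \<alpha> (\<beta> + \<gamma>) * f \<alpha> * (?s \<beta> \<gamma> * g \<beta> * h \<gamma>) =
        (?s \<alpha> (\<beta> + \<gamma>) * ?s \<beta> \<gamma>) * (f \<alpha> * g \<beta> * h \<gamma>)"
        by (simp add: mult_ac)
      also have "\<dots> = ?s (\<alpha> + \<beta>) \<gamma> * ?s \<alpha> \<beta> * f \<alpha> * g \<beta> * h \<gamma>"
        unfolding * by (simp add: mult_ac)
      finally show "(case case z of (x, y) \<Rightarrow> ((fst y, snd y + snd x), (snd y, snd x)) of (x, y) \<Rightarrow>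
          ?s (fst x) (snd x) * f (fst x) * (?s (fst y) (snd y) * g (fst y) * h (snd y))) =
        (case z of (x, y) \<Rightarrow> ?s (fst x) (snd x) * ?s (fst y) (snd y) * f (fst y) * g (snd y) * h (snd x))"
        by (simp add: z)
    qed (auto simp: splits_def add.assoc)
    also have "\<dots> = (\<Sum>x\<in>splits \<epsilon>. \<Sum>y\<in>splits (snd x).
        ?s (fst x) (snd x) * f (fst x) * (?s (fst y) (snd y) * g (fst y) * h (snd y)))"
      by (rule sum.Sigma[symmetric]) (auto simp: finite_splits)
    also have "\<dots> = (\<Sum>(\<alpha>, \<delta>)\<in>splits \<epsilon>. ?s \<alpha> \<delta> * f \<alpha> * (\<Sum>(\<beta>, \<gamma>)\<in>splits \<delta>. ?s \<beta> \<gamma> * g \<beta> * h \<gamma>))"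
      by (simp add: case_prod_unfold sum_distrib_left)
    finally show "(\<Sum>(\<delta>, \<gamma>)\<in>splits \<epsilon>. ?s \<delta> \<gamma> * (\<Sum>(\<alpha>, \<beta>)\<in>splits \<delta>. ?s \<alpha> \<beta> * f \<alpha> * g \<beta>) * h \<gamma>) =
      (\<Sum>(\<alpha>, \<delta>)\<in>splits \<epsilon>. ?s \<alpha> \<delta> * f \<alpha> * (\<Sum>(\<beta>, \<gamma>)\<in>splits \<delta>. ?s \<beta> \<gamma> * g \<beta> * h \<gamma>))" .
  qed
  show "f * g = g * f"
  proof (transfer, rule ext)
    fix f g :: "nat ^ 'b \<Rightarrow> 'a" and \<gamma>
    show "(\<Sum>(\<alpha>, \<beta>)\<in>splits \<gamma>. of_nat (vec_binomial \<alpha> \<beta>) * f \<alpha> * g \<beta>) =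
      (\<Sum>(\<alpha>, \<beta>)\<in>splits \<gamma>. of_nat (vec_binomial \<alpha> \<beta>) * g \<alpha> * f \<beta>)"
      by (rule sum.reindex_bij_witness[of _ prod.swap prod.swap])
        (auto simp: splits_def add.commute mult_ac vec_binomial_commute)
  qed
  show "1 * f = f"
  proof (transfer, rule ext)
    fix f :: "nat ^ 'b \<Rightarrow> 'a" and \<gamma> :: "nat ^ 'b"
    have "(\<Sum>(\<alpha>, \<beta>)\<in>splits \<gamma>. of_nat (vec_binomial \<alpha> \<beta>) * (if \<alpha> = 0 then 1 else 0) * f \<beta>) =
      (\<Sum>x\<in>splits \<gamma>. if x = (0, \<gamma>) then f \<gamma> else 0)"
      by (rule sum.cong[OF refl]) (auto simp: splits_def vec_binomial_def split: if_split_asm)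
    also have "\<dots> = f \<gamma>" by (subst sum.delta[OF finite_splits]) (auto simp: splits_def)
    finally show "(\<Sum>(\<alpha>, \<beta>)\<in>splits \<gamma>. of_nat (vec_binomial \<alpha> \<beta>) * (if \<alpha> = 0 then 1 else 0) * f \<beta>) = f \<gamma>" .
  qed
  show "(f + g) * h = f * h + g * h"
    by transfer (simp add: fun_eq_iff case_prod_unfold distrib_left distrib_right sum.distrib)
  show "(0 :: ('a, 'b) divided_series) \<noteq> 1" by transfer (auto simp: fun_eq_iff)
qed (transfer; simp add: fun_eq_iff algebra_simps)+

end

text \<open>
  A case of Kummer's theorem: adding \<open>a\<close> and \<open>b\<close> in base \<open>p\<close> carries out of the \<open>k\<close> lowest digits. Write \<open>a + b = p\<^sup>k + r\<close> with \<open>r < a\<close> and split the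
  binomial coefficient by Vandermonde: the factors \<open>p\<^sup>k choose j\<close> with \<open>0 < j < p\<^sup>k\<close> are divisible by
  \<open>p\<close>, and the remaining term is \<open>r choose a = 0\<close>. This is why truncating the divided powers at \<open>p\<^sup>m\<close> discards nothing.
\<close>

lemma prime_dvd_choose_carry:
  fixes p :: nat
  assumes p: "prime p" and a: "a < p ^ k" and b: "b < p ^ k" and carry: "p ^ k \<le> a + b"
  shows "p dvd (a + b choose a)"
proof -
  define q where "q = p ^ k"
  define r where "r = a + b - q"
  have r: "r < a" "a + b = q + r" using b carry by (auto simp: r_def q_def)
  have "p dvd (\<Sum>j\<le>a. (q choose j) * (r choose (a - j)))"
  proof (rule dvd_sum)
    fix j assume j: "j \<in> {..a}"
    show "p dvd (q choose j) * (r choose (a - j))"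
    proof (cases "j = 0")
      case True
      then show ?thesis using r by (simp add: binomial_eq_0)
    next
      case False
      have "p dvd (q choose j)"
      proof (rule ccontr)
        assume "\<not> p dvd (q choose j)"
        then have "coprime q (q choose j)" unfolding q_def using p by (simp add: prime_imp_coprime)
        moreover have "q dvd j * (q choose j)"
          using times_binomial_minus1_eq[of j q] False by simp
        ultimately have "q dvd j" by (simp add: coprime_dvd_mult_left_iff)
        then show False using False j a by (auto simp: q_def dest: dvd_imp_le)
      qed
      then show ?thesis by simp
    qed
  qed
  then show ?thesis by (simp add: r(2) vandermonde)
qed

section \<open>The three families of Witt algebras\<close>

text \<open>
  Coefficients of a derivative, for all three derivations. The first premise covers exponents at which
  a truncated subtraction shifts wrongly; there the coefficient must vanish.
\<close>

lemma lookup_sum_shifted: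
  assumes "\<And>\<alpha>. \<alpha> \<in> Poly_Mapping.keys f \<Longrightarrow> \<alpha> - b = \<gamma> \<Longrightarrow> \<alpha> \<noteq> \<gamma> + b \<Longrightarrow> c \<alpha> = 0"
    and "\<gamma> + b - b = \<gamma>" and "Poly_Mapping.lookup f (\<gamma> + b) = 0 \<Longrightarrow> c (\<gamma> + b) = 0"
  shows "Poly_Mapping.lookup (\<Sum>\<alpha>\<in>Poly_Mapping.keys f. Poly_Mapping.single (\<alpha> - b) (c \<alpha>)) \<gamma> = c (\<gamma> + b)"
proof -
  have "Poly_Mapping.lookup (\<Sum>\<alpha>\<in>Poly_Mapping.keys f. Poly_Mapping.single (\<alpha> - b) (c \<alpha>)) \<gamma> =
    (\<Sum>\<alpha>\<in>Poly_Mapping.keys f. if \<alpha> = \<gamma> + b then c \<alpha> else 0)"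
    unfolding lookup_sum by (rule sum.cong[OF refl]) (use assms(1,2) in \<open>auto simp: lookup_single when_def\<close>)
  then show ?thesis using assms(3) by (auto simp: in_keys_iff)
qed

lemma nat_vec_shift:
  fixes \<alpha> :: "nat ^ 'n"
  assumes "\<alpha> $ i \<noteq> 0" shows "\<alpha> - axis i 1 + axis i 1 = \<alpha>"
  using assms by (auto simp: vec_eq_iff axis_def)

lemma lookup_laurent_deriv:
  "Poly_Mapping.lookup (laurent_deriv i f) \<gamma> =
    of_int (\<gamma> $ i + 1) * Poly_Mapping.lookup f (\<gamma> + axis i 1)"
  unfolding laurent_deriv_def by (subst lookup_sum_shifted) auto

lemma lookup_mpoly_deriv:
  fixes f :: "('k::field, 'n::finite) mpoly"
  shows "Poly_Mapping.lookup (mpoly_deriv i f) \<gamma> =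
    of_nat (\<gamma> $ i + 1) * Poly_Mapping.lookup f (\<gamma> + axis i 1)"
  unfolding mpoly_deriv_def
proof (subst lookup_sum_shifted)
  fix \<alpha> :: "nat ^ 'n" assume "\<alpha> - axis i 1 = \<gamma>" "\<alpha> \<noteq> \<gamma> + axis i 1"
  then have "\<alpha> $ i = 0" using nat_vec_shift[of \<alpha> i] by (cases "\<alpha> $ i = 0") simp_all
  then show "of_nat (\<alpha> $ i) * Poly_Mapping.lookup f \<alpha> = 0" by simp
qed (simp_all del: of_nat_Suc)

lemma lookup_dp_deriv:
  fixes f :: "('k::field, 'n::finite) mpoly"
  shows "Poly_Mapping.lookup (dp_deriv i f) \<gamma> = Poly_Mapping.lookup f (\<gamma> + axis i 1)"
proof -
  have "dp_deriv i f = (\<Sum>\<alpha>\<in>Poly_Mapping.keys f.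
    Poly_Mapping.single (\<alpha> - axis i 1) (if \<alpha> $ i = 0 then 0 else Poly_Mapping.lookup f \<alpha>))"
    unfolding dp_deriv_def by (rule sum.cong[OF refl]) simp
  moreover have "Poly_Mapping.lookup \<dots> \<gamma> = Poly_Mapping.lookup f (\<gamma> + axis i 1)"
  proof (subst lookup_sum_shifted)
    fix \<alpha> :: "nat ^ 'n" assume "\<alpha> - axis i 1 = \<gamma>" "\<alpha> \<noteq> \<gamma> + axis i 1"
    then have "\<alpha> $ i = 0" using nat_vec_shift[of \<alpha> i] by (cases "\<alpha> $ i = 0") simp_all
    then show "(if \<alpha> $ i = 0 then 0 else Poly_Mapping.lookup f \<alpha>) = 0" by simp
  qed simp_all
  ultimately show ?thesis by simp
qed

lemma nat_axis_eq_iff: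
  "axis j (1 :: nat) = \<gamma> + axis i 1 \<longleftrightarrow> j = i \<and> \<gamma> = 0"
proof
  assume eq: "axis j (1 :: nat) = \<gamma> + axis i 1"
  then have "axis j (1 :: nat) $ i = \<gamma> $ i + 1" by simp
  then have "j = i" by (auto simp: axis_def split: if_splits)
  then show "j = i \<and> \<gamma> = 0" using eq by simp
qed simp

lemma nat_axis_neq_0: "\<gamma> + axis i 1 \<noteq> (0 :: nat ^ 'n)"
proof
  assume "\<gamma> + axis i 1 = (0 :: nat ^ 'n)"
  then have "(\<gamma> + axis i 1) $ i = (0 :: nat ^ 'n) $ i" by (rule arg_cong)
  then show False by simp
qed

lemma witt_embedding_laurent:
  "witt_embedding (UNIV :: ('k::field, 'n::finite) laurent set) (*) laurent_deriv (\<lambda>u. u)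
    (Poly_Mapping.single 0 1) (\<lambda>i. Poly_Mapping.single (axis i 1) 1)"
proof
  fix i j :: 'n
  show "laurent_deriv j (Poly_Mapping.single 0 1 :: ('k, 'n) laurent) = 0"
  proof (rule poly_mapping_eqI)
    fix \<gamma> :: "int ^ 'n"
    have "\<gamma> $ j = -1" if "0 = \<gamma> + axis j 1"
    proof -
      have "(0 :: int ^ 'n) $ j = (\<gamma> + axis j 1) $ j" using that by (rule arg_cong)
      then show ?thesis by simp
    qed
    then show "Poly_Mapping.lookup (laurent_deriv j (Poly_Mapping.single 0 1 :: ('k, 'n) laurent)) \<gamma> =
      Poly_Mapping.lookup 0 \<gamma>"
      by (auto simp: lookup_laurent_deriv lookup_single when_def simp del: of_int_add single_one)
  qed
  show "laurent_deriv j (Poly_Mapping.single (axis i 1) 1 :: ('k, 'n) laurent) =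
    (if i = j then Poly_Mapping.single 0 1 else 0)"
  proof (rule poly_mapping_eqI)
    fix \<gamma> :: "int ^ 'n"
    have "\<gamma> = 0" if "axis j 1 = \<gamma> + axis j (1 :: int)" using that by simp
    moreover have "\<gamma> $ j = -1" if "axis i 1 = \<gamma> + axis j (1 :: int)" "i \<noteq> j"
    proof -
      have "axis i (1 :: int) $ j = (\<gamma> + axis j 1) $ j" using that(1) by (rule arg_cong)
      then show ?thesis using that(2) by (simp add: axis_def)
    qed
    ultimately show "Poly_Mapping.lookup (laurent_deriv j (Poly_Mapping.single (axis i 1) 1 :: ('k, 'n) laurent)) \<gamma> =
      Poly_Mapping.lookup (if i = j then Poly_Mapping.single 0 1 else 0) \<gamma>"
      by (auto simp: lookup_laurent_deriv lookup_single when_def simp del: of_int_add single_one)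
  qed
  show "laurent_deriv j (u + v) = laurent_deriv j u + laurent_deriv j v" for u v :: "('k, 'n) laurent"
    by (rule poly_mapping_eqI) (simp add: lookup_laurent_deriv lookup_add distrib_left)
qed (auto simp: pm.subspace_UNIV)

lemma witt_embedding_mpoly:
  "witt_embedding (UNIV :: ('k::field, 'n::finite) mpoly set) (*) mpoly_deriv (\<lambda>u. u)
    (Poly_Mapping.single 0 1) (\<lambda>i. Poly_Mapping.single (axis i 1) 1)"
proof
  fix i j :: 'n
  show "mpoly_deriv j (Poly_Mapping.single 0 1 :: ('k, 'n) mpoly) = 0"
    by (rule poly_mapping_eqI) (simp add: lookup_mpoly_deriv lookup_single when_def eq_commute[of 0] nat_axis_neq_0 del: single_one of_nat_Suc One_nat_def)
  show "mpoly_deriv j (Poly_Mapping.single (axis i 1) 1 :: ('k, 'n) mpoly) =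
    (if i = j then Poly_Mapping.single 0 1 else 0)"
    by (rule poly_mapping_eqI) (auto simp: lookup_mpoly_deriv lookup_single nat_axis_eq_iff when_def simp del: single_one One_nat_def)
  show "mpoly_deriv j (u + v) = mpoly_deriv j u + mpoly_deriv j v" for u v :: "('k, 'n) mpoly"
    by (rule poly_mapping_eqI) (simp add: lookup_mpoly_deriv lookup_add distrib_left)
qed (auto simp: pm.subspace_UNIV)

lift_definition divided_series_of :: "('k::zero, 'n::finite) mpoly \<Rightarrow> ('k, 'n) divided_series"
  is "\<lambda>f \<gamma>. Poly_Mapping.lookup f \<gamma>" .

text \<open>
  On the carrier, the terms suppressed by the truncated multiplication have a binomial coefficient
  divisible by \<open>p\<close>, so they vanish in the untruncated product as well.
\<close>

lemma divided_series_of_dp_mult: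
  fixes u v :: "('k::field, 'n::finite) mpoly"
  assumes char: "CHAR('k) > 0" and u: "u \<in> dp_carrier m" and v: "v \<in> dp_carrier m"
  shows "divided_series_of (dp_mult m u v) = divided_series_of u * divided_series_of v"
proof (transfer fixing: u v m, rule ext)
  fix \<gamma> :: "nat ^ 'n"
  let ?p = "CHAR('k)"
  let ?t = "\<lambda>\<alpha> \<beta>. of_nat (vec_binomial \<alpha> \<beta>) * Poly_Mapping.lookup u \<alpha> * Poly_Mapping.lookup v \<beta>"
  have p: "prime ?p" using char by (rule prime_CHAR_semidom)
  have "Poly_Mapping.lookup (dp_mult m u v) \<gamma> =
    (\<Sum>\<alpha>\<in>Poly_Mapping.keys u. \<Sum>\<beta>\<in>Poly_Mapping.keys v. if \<alpha> + \<beta> = \<gamma> then ?t \<alpha> \<beta> else 0)"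
    unfolding dp_mult_def lookup_sum
  proof (rule sum.cong[OF refl], rule sum.cong[OF refl])
    fix \<alpha> \<beta> assume \<alpha>: "\<alpha> \<in> Poly_Mapping.keys u" and \<beta>: "\<beta> \<in> Poly_Mapping.keys v"
    have "(of_nat (vec_binomial \<alpha> \<beta>) :: 'k) = 0" if "\<not> (\<forall>i. \<alpha> $ i + \<beta> $ i < ?p ^ m i)"
    proof -
      from that obtain i where i: "?p ^ m i \<le> \<alpha> $ i + \<beta> $ i" by (auto simp: not_less)
      have "\<alpha> $ i < ?p ^ m i" "\<beta> $ i < ?p ^ m i" using \<alpha> \<beta> u v by (auto simp: dp_carrier_def)
      then have "?p dvd (\<alpha> $ i + \<beta> $ i choose \<alpha> $ i)" using prime_dvd_choose_carry[OF p _ _ i] by blast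
      also have "\<dots> dvd vec_binomial \<alpha> \<beta>" unfolding vec_binomial_def by (rule dvd_prodI) simp_all
      finally show ?thesis by (simp add: of_nat_eq_0_iff_char_dvd)
    qed
    then show "Poly_Mapping.lookup (if \<forall>i. \<alpha> $ i + \<beta> $ i < ?p ^ m i
        then Poly_Mapping.single (\<alpha> + \<beta>) (of_nat (\<Prod>i\<in>UNIV. \<alpha> $ i + \<beta> $ i choose \<alpha> $ i) *
          Poly_Mapping.lookup u \<alpha> * Poly_Mapping.lookup v \<beta>) else 0) \<gamma> =
      (if \<alpha> + \<beta> = \<gamma> then ?t \<alpha> \<beta> else 0)"
      unfolding vec_binomial_def[symmetric] by (auto simp: lookup_single when_def)
  qed
  also have "\<dots> = (\<Sum>(\<alpha>, \<beta>)\<in>Poly_Mapping.keys u \<times> Poly_Mapping.keys v. if \<alpha> + \<beta> = \<gamma> then ?t \<alpha> \<beta> else 0)"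
    by (rule sum.cartesian_product)
  also have "\<dots> = (\<Sum>x\<in>{x \<in> Poly_Mapping.keys u \<times> Poly_Mapping.keys v. fst x + snd x = \<gamma>}. ?t (fst x) (snd x))"
    by (subst sum.inter_filter) (simp_all add: case_prod_unfold)
  also have "\<dots> = (\<Sum>x\<in>splits \<gamma>. ?t (fst x) (snd x))"
    by (rule sum.mono_neutral_left[OF finite_splits]) (auto simp: splits_def in_keys_iff)
  finally show "Poly_Mapping.lookup (dp_mult m u v) \<gamma> = (\<Sum>(\<alpha>, \<beta>)\<in>splits \<gamma>. ?t \<alpha> \<beta>)"
    by (simp add: case_prod_unfold)
qed

lemma dp_carrier_lookup:
  "f \<in> dp_carrier m \<longleftrightarrow> (\<forall>\<alpha>. (\<exists>i. \<not> \<alpha> $ i < CHAR('k) ^ m i) \<longrightarrow> Poly_Mapping.lookup (f :: ('k::field, 'n::finite) mpoly) \<alpha> = 0)"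
  by (auto simp: dp_carrier_def in_keys_iff)

lemma witt_embedding_dp:
  fixes m :: "'n::finite \<Rightarrow> nat"
  assumes char: "CHAR('k::field) > 0" and m: "\<And>i. m i > 0"
  shows "witt_embedding (dp_carrier m :: ('k, 'n) mpoly set) (dp_mult m) dp_deriv divided_series_of
    (Poly_Mapping.single 0 1) (\<lambda>i. Poly_Mapping.single (axis i 1) 1)"
proof
  let ?p = "CHAR('k)"
  let ?U = "dp_carrier m :: ('k, 'n) mpoly set"
  have p: "?p > 1" using prime_CHAR_semidom[OF char] by (rule prime_gt_1_nat)
  have pm1: "1 < ?p ^ m i" for i using one_less_power[OF p m] .
  show sub: "pm.subspace ?U"
    by (rule pm.subspaceI) (auto simp: dp_carrier_lookup lookup_add lookup_pm_scale)
  fix i j :: 'n and u v :: "('k, 'n) mpoly"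
  show "dp_mult m u v \<in> ?U"
    unfolding dp_mult_def
    by (intro pm.subspace_sum[OF sub]) (auto simp: dp_carrier_lookup lookup_single when_def)
  show "dp_deriv j u \<in> ?U" if "u \<in> ?U"
    unfolding dp_carrier_lookup lookup_dp_deriv
  proof (intro allI impI)
    fix \<alpha> :: "nat ^ 'n" assume "\<exists>i. \<not> \<alpha> $ i < ?p ^ m i"
    then obtain i where "\<not> \<alpha> $ i < ?p ^ m i" ..
    then have "\<not> (\<alpha> + axis j 1) $ i < ?p ^ m i" by (simp add: not_less trans_le_add1)
    then show "Poly_Mapping.lookup u (\<alpha> + axis j 1) = 0" using that unfolding dp_carrier_lookup by blast
  qed
  show "dp_deriv j (u + v) = dp_deriv j u + dp_deriv j v"
    by (rule poly_mapping_eqI) (simp add: lookup_dp_deriv lookup_add)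
  show "divided_series_of (u + v) = divided_series_of u + divided_series_of v"
    by transfer (simp add: lookup_add fun_eq_iff)
  show "divided_series_of (dp_mult m u v) = divided_series_of u * divided_series_of v"
    if "u \<in> ?U" "v \<in> ?U"
    using divided_series_of_dp_mult[OF char that] .
  show "u = 0" if "divided_series_of u = 0"
    using that by transfer (auto simp: fun_eq_iff intro: poly_mapping_eqI)
  show "Poly_Mapping.single 0 1 \<in> ?U"
    using p by (auto simp: dp_carrier_lookup lookup_single when_def simp del: single_one)
  show "divided_series_of (Poly_Mapping.single 0 1 :: ('k, 'n) mpoly) = 1"
    by transfer (auto simp: lookup_single when_def fun_eq_iff simp del: single_one)
  show "dp_deriv j (Poly_Mapping.single 0 1 :: ('k, 'n) mpoly) = 0"
    by (rule poly_mapping_eqI) (simp add: lookup_dp_deriv lookup_single when_def eq_commute[of 0] nat_axis_neq_0 del: single_one One_nat_def)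
  show "Poly_Mapping.single (axis i 1) 1 \<in> ?U"
    using pm1 p by (auto simp: dp_carrier_lookup lookup_single when_def axis_def)
  show "dp_deriv j (Poly_Mapping.single (axis i 1) 1 :: ('k, 'n) mpoly) =
    (if i = j then Poly_Mapping.single 0 1 else 0)"
    by (rule poly_mapping_eqI) (auto simp: lookup_dp_deriv lookup_single nat_axis_eq_iff when_def simp del: single_one One_nat_def)
qed

theorem theorem4p1:
  fixes W :: "('k::field, ('k, 'n::finite) laurent ^ 'n) nalg"
    and Wp :: "('k, ('k, 'n) mpoly ^ 'n) nalg"
    and Wm :: "('k, ('k, 'n) mpoly ^ 'n) nalg"
    and m :: "'n \<Rightarrow> nat"
    and n :: nat
  assumes n: "n = CARD('n)"
    and W: "W = W_rsym"
    and Wp: "Wp = W_plus_rsym"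
    and m: "\<And>i. m i > 0"
    and Wm: "Wm = W_rsym_dp m"
  shows
    "(CHAR('k) = 0 \<longrightarrow>
        (satisfies_standard W n \<and> (\<forall>l\<le>2 * n. left_identity W (tau_std n l id))) \<and>
        (\<forall>f. left_identity W f \<and> f \<noteq> 0 \<longrightarrow> ldegree f \<ge> 2 * n + 1) \<and>
        (\<forall>f. left_identity W f \<and> ldegree f = 2 * n + 1 \<longrightarrow>
               f \<in> std_span n f \<and> (multilinear f \<longrightarrow> std_combination n f))) \<and>
     (CHAR('k) = 0 \<longrightarrow>
        (satisfies_standard Wp n \<and> (\<forall>l\<le>2 * n. left_identity Wp (tau_std n l id))) \<and>
        (\<forall>f. left_identity Wp f \<and> f \<noteq> 0 \<longrightarrow> ldegree f \<ge> 2 * n + 1) \<and>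
        (\<forall>f. left_identity Wp f \<and> ldegree f = 2 * n + 1 \<longrightarrow>
               f \<in> std_span n f \<and> (multilinear f \<longrightarrow> std_combination n f))) \<and>
     (CHAR('k) > 0 \<longrightarrow>
        (satisfies_standard Wm n \<and> (\<forall>l\<le>2 * n. left_identity Wm (tau_std n l id))) \<and>
        (\<forall>f. left_identity Wm f \<and> multilinear f \<and> f \<noteq> 0 \<longrightarrow> ldegree f \<ge> 2 * n + 1) \<and>
        (\<forall>f. left_identity Wm f \<and> multilinear f \<and> ldegree f = 2 * n + 1 \<longrightarrow>
               std_combination n f))"
proof (intro conjI[of "_ \<longrightarrow> _"] impI)
  note * = witt_embedding.standard_identity witt_embedding.left_identity_tau_std
    witt_embedding.identity_degree witt_embedding.identity_std_span
    witt_embedding.multilinear_identity_degree witt_embedding.multilinear_identity_std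
  assume char: "CHAR('k) = 0"
  note L = *[OF witt_embedding_laurent[where 'k = 'k and 'n = 'n], folded W_rsym_def W n]
  note P = *[OF witt_embedding_mpoly[where 'k = 'k and 'n = 'n], folded W_plus_rsym_def Wp n]
  show "(satisfies_standard W n \<and> (\<forall>l\<le>2 * n. left_identity W (tau_std n l id))) \<and>
    (\<forall>f. left_identity W f \<and> f \<noteq> 0 \<longrightarrow> ldegree f \<ge> 2 * n + 1) \<and>
    (\<forall>f. left_identity W f \<and> ldegree f = 2 * n + 1 \<longrightarrow>
      f \<in> std_span n f \<and> (multilinear f \<longrightarrow> std_combination n f))"
    using L char by blast
  show "(satisfies_standard Wp n \<and> (\<forall>l\<le>2 * n. left_identity Wp (tau_std n l id))) \<and>
    (\<forall>f. left_identity Wp f \<and> f \<noteq> 0 \<longrightarrow> ldegree f \<ge> 2 * n + 1) \<and>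
    (\<forall>f. left_identity Wp f \<and> ldegree f = 2 * n + 1 \<longrightarrow>
      f \<in> std_span n f \<and> (multilinear f \<longrightarrow> std_combination n f))"
    using P char by blast
next
  note * = witt_embedding.standard_identity witt_embedding.left_identity_tau_std
    witt_embedding.multilinear_identity_degree witt_embedding.multilinear_identity_std
  assume char: "CHAR('k) > 0"
  note M = *[OF witt_embedding_dp[where m = m, OF char m], folded W_rsym_dp_def Wm n]
  show "(satisfies_standard Wm n \<and> (\<forall>l\<le>2 * n. left_identity Wm (tau_std n l id))) \<and>
    (\<forall>f. left_identity Wm f \<and> multilinear f \<and> f \<noteq> 0 \<longrightarrow> ldegree f \<ge> 2 * n + 1) \<and>
    (\<forall>f. left_identity Wm f \<and> multilinear f \<and> ldegree f = 2 * n + 1 \<longrightarrow> std_combination n f)"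
  proof (intro conjI allI impI)
    show "satisfies_standard Wm n" by (rule M(1))
    show "left_identity Wm (tau_std n l id)" if "l \<le> 2 * n" for l using that by (rule M(2))
    show "ldegree f \<ge> 2 * n + 1" if "left_identity Wm f \<and> multilinear f \<and> f \<noteq> 0" for f
      using M(3)[of f] that by simp
    show "std_combination n f" if "left_identity Wm f \<and> multilinear f \<and> ldegree f = 2 * n + 1" for f
      using M(4)[of f] that by simp
  qed
qed

end
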